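(* Assume that $\lambda\in C^1((0,\infty))$, that $\lambda(\sigma)\to0$ as $\sigma\to\infty$, and that there is $\Lambda>0$ such that $-\Lambda/(2\sigma^{3/2})\le\lambda'(\sigma)\le0$ for all $\sigma>0$. Let $1<q<2$, $p>\frac{q}{2-q}+q$ and $R>0$. Let $\rho\in L^1(\mathbb{R}^3)\cap L^p(\mathbb{R}^3)$ with $\rho\ge0$ be spherically symmetric. Then $$\lambda(|\nabla U^N_\rho|)\nabla U^N_\rho\in W^{1,q}_{loc}(\mathbb{R}^3)$$ with $$\left\|\nabla\left[\lambda(|\nabla U^N_\rho|)\nabla U^N_\rho\right]\right\|_{L^q(B_R)}\le C\|\rho\|_p^{1/2},$$ where, for the given fixed $\lambda$, the constant $C=C(p,q,R)>0$ depends only on $p,q,R$ (not on $\rho$).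
   Context: $B_R$ denotes the ball in $\mathbb{R}^3$ of radius $R$ centred at the origin, and $p$ is a real number. The Newtonian potential of $\rho$ (gravitational constant $1$) is $U^N_\rho(x)=-\int_{\mathbb{R}^3}\frac{\rho(y)}{|x-y|}\,dy$, with weak gradient $\nabla U^N_\rho(x)=\int_{\mathbb{R}^3}\frac{x-y}{|x-y|^3}\rho(y)\,dy$. Convention: $\lambda(|u|)u=0$ if $u=0$. $W^{1,q}_{loc}$ for a vector field is understood componentwise. *)

theory Defs
  imports "HOL-Analysis.Analysis"
begin

text \<open>Lebesgue spaces with respect to Lebesgue measure, for real exponents \<open>1 \<le> q < \<infinity>\<close>.
  The Bochner integral of a non-integrable function is \<open>0\<close>, so \<open>Lp_norm\<close> is the \<open>L\<^sup>q\<close> norm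
  only for functions satisfying \<open>in_Lp\<close>.\<close>

definition in_Lp :: "real \<Rightarrow> 'a::euclidean_space set \<Rightarrow> ('a \<Rightarrow> 'b::euclidean_space) \<Rightarrow> bool" where
  "in_Lp q S f \<longleftrightarrow> set_borel_measurable lebesgue S f \<and>
     set_integrable lebesgue S (\<lambda>x. norm (f x) powr q)"

definition Lp_norm :: "real \<Rightarrow> 'a::euclidean_space set \<Rightarrow> ('a \<Rightarrow> 'b::euclidean_space) \<Rightarrow> real" where
  "Lp_norm q S f = (LINT x:S|lebesgue. norm (f x) powr q) powr (1 / q)"

definition in_Lp_loc :: "real \<Rightarrow> ('a::euclidean_space \<Rightarrow> 'b::euclidean_space) \<Rightarrow> bool" where
  "in_Lp_loc q f \<longleftrightarrow> (\<forall>K. compact K \<longrightarrow> in_Lp q K f)"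

definition partial_deriv :: "'n::finite \<Rightarrow> (real^'n \<Rightarrow> real) \<Rightarrow> real^'n \<Rightarrow> real" where
  "partial_deriv j f x = frechet_derivative f (at x) (axis j 1)"

primrec C_k :: "nat \<Rightarrow> (real^'n::finite \<Rightarrow> real) \<Rightarrow> bool" where
  "C_k 0 f \<longleftrightarrow> continuous_on UNIV f"
| "C_k (Suc k) f \<longleftrightarrow> (\<forall>x. f differentiable (at x)) \<and> (\<forall>j. C_k k (partial_deriv j f))"

definition test_function :: "(real^'n::finite \<Rightarrow> real) \<Rightarrow> bool" where
  "test_function \<phi> \<longleftrightarrow> (\<forall>k. C_k k \<phi>) \<and> compact (closure {x. \<phi> x \<noteq> 0})"

definition has_weak_partial ::
    "(real^'n::finite \<Rightarrow> real) \<Rightarrow> 'n \<Rightarrow> (real^'n \<Rightarrow> real) \<Rightarrow> bool" where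
  "has_weak_partial f j g \<longleftrightarrow> in_Lp_loc 1 f \<and> in_Lp_loc 1 g \<and>
     (\<forall>\<phi>. test_function \<phi> \<longrightarrow>
        (LINT x|lebesgue. f x * partial_deriv j \<phi> x) = - (LINT x|lebesgue. g x * \<phi> x))"

text \<open>Row \<open>i\<close> of the weak Jacobian is the weak gradient of component \<open>i\<close>. It is determined
  up to null sets, hence is treated as a relation rather than as a function.\<close>

definition has_weak_jacobian ::
    "(real^'n::finite \<Rightarrow> real^'m::finite) \<Rightarrow> (real^'n \<Rightarrow> real^'n^'m) \<Rightarrow> bool" where
  "has_weak_jacobian F D \<longleftrightarrow>
     (\<forall>i j. has_weak_partial (\<lambda>x. F x $ i) j (\<lambda>x. D x $ i $ j))"

definition in_W1_loc :: "real \<Rightarrow> (real^'n::finite \<Rightarrow> real) \<Rightarrow> bool" where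
  "in_W1_loc q f \<longleftrightarrow> in_Lp_loc q f \<and> (\<forall>j. \<exists>g. in_Lp_loc q g \<and> has_weak_partial f j g)"

definition vec_in_W1_loc :: "real \<Rightarrow> (real^'n::finite \<Rightarrow> real^'m::finite) \<Rightarrow> bool" where
  "vec_in_W1_loc q F \<longleftrightarrow> (\<forall>i. in_W1_loc q (\<lambda>x. F x $ i))"

text \<open>Elements of \<open>L\<^sup>p\<close> are classes of functions modulo null sets, so symmetry is required
  almost everywhere only.\<close>

definition spherically_symmetric :: "('a::euclidean_space \<Rightarrow> real) \<Rightarrow> bool" where
  "spherically_symmetric \<rho> \<longleftrightarrow> (\<exists>f. AE x in lebesgue. \<rho> x = f (norm x))"

text \<open>The weak gradient of the Newtonian potential \<open>x \<mapsto> - (\<integral> \<rho> y / \<bar>x - y\<bar> dy)\<close>, in the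
  representative given by the singular integral; the value is \<open>0\<close> on the null set of points
  where that integral does not converge absolutely.\<close>

definition newton_gradient :: "(real^3 \<Rightarrow> real) \<Rightarrow> real^3 \<Rightarrow> real^3" where
  "newton_gradient \<rho> x = (LINT y|lebesgue. (\<rho> y / norm (x - y) ^ 3) *\<^sub>R (x - y))"

end

theory Submission
  imports Defs
begin

text \<open>
For a radial density, Newton's theorem gives the field \<open>M(r) x / r\<^sup>3\<close>, where \<open>M(r)\<close> is the mass
in the ball of radius \<open>r\<close>, so the transformed field is \<open>g(\<bar>x\<bar>) x\<close> with \<open>g(r) = \<mu>(M(r) / r\<^sup>2) / r\<close>
and \<open>\<mu>(\<sigma>) = \<lambda>(\<sigma>) \<sigma>\<close>. The hypotheses on \<open>\<lambda>\<close> give \<open>\<bar>\<mu>(\<sigma>)\<bar> \<le> C \<sigma>\<^bsup>1/2\<^esup>\<close> and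
\<open>\<bar>\<mu>'(\<sigma>)\<bar> \<le> C \<sigma>\<^bsup>-1/2\<^esup>\<close>, so the Jacobian is bounded by \<open>r \<rho> M\<^bsup>-1/2\<^esup> + M\<^bsup>1/2\<^esup> / r\<^sup>2\<close>. The second
term is controlled by \<open>M(r) \<le> C \<parallel>\<rho>\<parallel>\<^sub>p r\<^bsup>3 - 3/p\<^esup>\<close>. In the first, the \<open>q\<close>-th power is split
between \<open>\<rho>\<^sup>p\<close> and \<open>M\<^bsup>-s\<^esup> \<rho>\<close> for some \<open>s < 1\<close>, and \<open>M\<^bsup>-s\<^esup> M'\<close> is integrable because
\<open>M' = 4 \<pi> r\<^sup>2 \<rho>\<close>.

Newton's theorem is needed almost everywhere only. Reflections show that the field is radial, and
testing its divergence against radial ramps determines its strength.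
\<close>

section \<open>Lipschitz functions and translation invariance\<close>

text \<open>The density is merely integrable in the radius, so the enclosed mass is absolutely
  continuous but need not have a pointwise derivative. It may also vanish on an initial interval,
  which is where the square-root behaviour of \<open>\<mu>\<close> is singular. Hence the
  one-dimensional calculus works with integral increments, first for quantities shifted by a
  positive amount and then in the limit. It stays away from the origin, which is controlled by the
  weight s^3 on the derivative of the profile. Both terms of the Jacobian bound are homogeneous of
  degree 1/2 in the density; this is the origin of the square root of the norm. Dividing density and
  mass by the norm before splitting leaves integrals bounded uniformly in the density. The splitting
  exponent is q (p - 1) / (2 (p - q)); the lower bound on p makes it less than 1. Spheres are
  reached through averages over shells: ramps are Lipschitz, so translation invariance applies to
  them, and equal averages over all shells give equality at almost every radius.\<close>

definition lipschitz_on_balls :: "('a::real_normed_vector \<Rightarrow> 'b::real_normed_vector) \<Rightarrow> bool" where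
  "lipschitz_on_balls f \<longleftrightarrow> (\<forall>r. \<exists>L. L-lipschitz_on (cball 0 r) f)"

lemma lipschitz_on_ballsD: "lipschitz_on_balls f \<Longrightarrow> \<exists>L. L-lipschitz_on (cball 0 r) f"
  by (simp add: lipschitz_on_balls_def)

lemma lipschitz_on_imp_on_balls: "L-lipschitz_on UNIV f \<Longrightarrow> lipschitz_on_balls f"
  unfolding lipschitz_on_balls_def using lipschitz_on_subset by blast

lemma continuous_lipschitz_on_balls:
  assumes "lipschitz_on_balls f" shows "continuous_on UNIV f"
proof -
  have "continuous (at x) f" for x
  proof -
    obtain L where "L-lipschitz_on (cball 0 (norm x + 1)) f" using assms lipschitz_on_ballsD by blast
    then have "continuous_on (cball 0 (norm x + 1)) f" by (rule lipschitz_on_continuous_on)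
    then have "continuous_on (ball 0 (norm x + 1)) f" by (rule continuous_on_subset) auto
    then show ?thesis
      by (simp add: continuous_on_eq_continuous_at)
  qed
  then show ?thesis by (simp add: continuous_on_eq_continuous_within)
qed

lemma bounded_lipschitz_on_balls:
  fixes f :: "'a::euclidean_space \<Rightarrow> 'b::real_normed_vector"
  assumes "lipschitz_on_balls f"
  obtains B where "B \<ge> 0" "\<And>x. norm x \<le> r \<Longrightarrow> norm (f x) \<le> B"
proof -
  have "compact (f ` cball 0 r)"
    using continuous_lipschitz_on_balls[OF assms] compact_cball
    by (meson compact_continuous_image continuous_on_subset subset_UNIV)
  then have "bounded (f ` cball 0 r)" by (rule compact_imp_bounded)
  then obtain B where "\<forall>y\<in>f ` cball 0 r. norm y \<le> B" by (auto simp: bounded_iff)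
  then show ?thesis
    by (intro that[of "max 0 B"]) (auto simp: le_max_iff_disj)
qed

lemma lipschitz_on_balls_norm_diff: "lipschitz_on_balls (\<lambda>x. norm (x - a))"
proof (rule lipschitz_on_imp_on_balls[of 1], rule lipschitz_onI)
  fix x y :: 'a
  show "dist (norm (x - a)) (norm (y - a)) \<le> 1 * dist x y"
    using norm_triangle_ineq3[of "x - a" "y - a"] by (simp add: dist_norm)
qed simp

lemma lipschitz_on_balls_inner: "lipschitz_on_balls (\<lambda>x. x \<bullet> a)"
proof (rule lipschitz_on_imp_on_balls[of "norm a"], rule lipschitz_onI)
  fix x y :: 'a
  show "dist (x \<bullet> a) (y \<bullet> a) \<le> norm a * dist x y"
    using Cauchy_Schwarz_ineq2[of "x - y" a] by (simp add: dist_norm inner_diff_left mult.commute)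
qed simp

text \<open>A product of Lipschitz functions is Lipschitz only where the factors are bounded.
  Products such as a coordinate times a cutoff occur throughout, which is why the Lipschitz
  condition is imposed ball by ball.\<close>

lemma lipschitz_on_balls_mult:
  fixes f g :: "'a::euclidean_space \<Rightarrow> real"
  assumes "lipschitz_on_balls f" "lipschitz_on_balls g"
  shows "lipschitz_on_balls (\<lambda>x. f x * g x)"
  unfolding lipschitz_on_balls_def
proof
  fix r
  obtain L where L: "L-lipschitz_on (cball 0 r) f" using assms lipschitz_on_ballsD by blast
  obtain M where M: "M-lipschitz_on (cball 0 r) g" using assms lipschitz_on_ballsD by blast
  obtain B where B: "B \<ge> 0" "\<And>x. norm x \<le> r \<Longrightarrow> norm (f x) \<le> B"
    using bounded_lipschitz_on_balls[OF assms(1)] by blast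
  obtain C where C: "C \<ge> 0" "\<And>x. norm x \<le> r \<Longrightarrow> norm (g x) \<le> C"
    using bounded_lipschitz_on_balls[OF assms(2)] by blast
  show "\<exists>L. L-lipschitz_on (cball 0 r) (\<lambda>x. f x * g x)"
  proof (rule exI[of _ "B * M + C * L"], rule lipschitz_onI)
    fix x y :: 'a assume x: "x \<in> cball 0 r" and y: "y \<in> cball 0 r"
    have "f x * g x - f y * g y = f x * (g x - g y) + g y * (f x - f y)"
      by (simp add: algebra_simps)
    also have "\<bar>\<dots>\<bar> \<le> \<bar>f x\<bar> * \<bar>g x - g y\<bar> + \<bar>g y\<bar> * \<bar>f x - f y\<bar>"
      by (metis abs_mult abs_triangle_ineq)
    also have "\<dots> \<le> B * (M * dist x y) + C * (L * dist x y)"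
      using B C x y lipschitz_onD[OF L x y] lipschitz_onD[OF M x y]
      by (intro add_mono mult_mono) (auto simp: dist_real_def)
    finally show "dist (f x * g x) (f y * g y) \<le> (B * M + C * L) * dist x y"
      by (simp add: dist_real_def algebra_simps)
  qed (use B C lipschitz_on_nonneg[OF L] lipschitz_on_nonneg[OF M] in auto)
qed

lemma lipschitz_on_balls_compose:
  fixes f :: "'a::real_normed_vector \<Rightarrow> real"
  assumes "L-lipschitz_on UNIV h" "lipschitz_on_balls f"
  shows "lipschitz_on_balls (\<lambda>x. h (f x))"
  unfolding lipschitz_on_balls_def
proof
  fix r
  obtain M where M: "M-lipschitz_on (cball 0 r) f" using assms lipschitz_on_ballsD by blast
  have "L-lipschitz_on (f ` cball 0 r) h" using assms(1) lipschitz_on_subset by blast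
  from lipschitz_on_compose2[OF M this]
  show "\<exists>L. L-lipschitz_on (cball 0 r) (\<lambda>x. h (f x))" by blast
qed

lemma emeasure_cball_less_top: "emeasure lborel (cball (c::'a::euclidean_space) r) < top"
  using emeasure_bounded_finite[OF bounded_cball, of c r] by (simp only: infinity_ennreal_def)

text \<open>This includes functions that are not measurable: such a function and its translate are
  both non-integrable, so both integrals take the default value 0.\<close>

lemma integral_lborel_translate:
  fixes f :: "'a::euclidean_space \<Rightarrow> 'b::euclidean_space"
  shows "(LINT x|lborel. f (x + a)) = (LINT x|lborel. f x)"
proof -
  have "(LINT x|lborel. f x) = (LINT x|distr lborel borel ((+) a). f x)"
    by (simp add: lborel_distr_plus)
  also have "\<dots> = (LINT x|lborel. f (x + a))"
  proof (cases "f \<in> borel_measurable borel")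
    case True
    then show ?thesis by (subst integral_distr) (simp_all add: add.commute)
  next
    case False
    have "\<not> integrable (distr lborel borel ((+) a)) f" using False by auto
    moreover have "\<not> integrable lborel (\<lambda>x. f (x + a))"
    proof
      assume "integrable lborel (\<lambda>x. f (x + a))"
      then have "(\<lambda>x. f (x + a)) \<in> borel_measurable borel" by auto
      then have "(\<lambda>x. f (x + a)) \<circ> (\<lambda>x. x - a) \<in> borel_measurable borel"
        by (intro measurable_comp) auto
      then show False using False by (simp add: comp_def)
    qed
    ultimately show ?thesis by (simp add: not_integrable_integral_eq)
  qed
  finally show ?thesis ..
qed

text \<open>Translation invariance gives the difference quotients integral zero; they converge
  boundedly to the derivative.\<close>

lemma integral_deriv_eq_0:
  fixes f :: "'a::euclidean_space \<Rightarrow> real"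
  assumes f: "lipschitz_on_balls f" and supp: "\<And>x. norm x > r \<Longrightarrow> f x = 0"
    and d: "AE x in lborel. ((\<lambda>t. f (x + t *\<^sub>R e)) has_real_derivative f' x) (at 0)"
    and [measurable]: "f' \<in> borel_measurable borel"
  shows "integrable lborel f'" "(LINT x|lborel. f' x) = 0"
proof -
  \<comment> \<open>The shifts have length at most \<open>norm e\<close>, so beyond radius
    \<open>r'\<close> both points of each difference quotient lie outside the support. The quotients
    are thus dominated by a constant on one fixed ball.\<close>
  define r' where "r' = max r 0 + norm e"
  have [measurable]: "f \<in> borel_measurable borel"
    using continuous_lipschitz_on_balls[OF f] by (rule borel_measurable_continuous_onI)
  obtain L where L: "L-lipschitz_on (cball 0 (r' + norm e)) f" using f lipschitz_on_ballsD by blast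
  have L0: "L \<ge> 0" by (rule lipschitz_on_nonneg[OF L])
  define t where "t n = inverse (real (Suc n))" for n
  have t: "t n > 0" "t n \<le> 1" for n
    by (auto simp: t_def divide_simps)
  have t0: "t \<longlonglongrightarrow> 0" unfolding t_def by (rule LIMSEQ_inverse_real_of_nat)
  define s where "s n x = (f (x + t n *\<^sub>R e) - f x) / t n" for n x
  have [measurable]: "s n \<in> borel_measurable borel" for n unfolding s_def by measurable
  define w where "w x = indicator (cball 0 r') x *\<^sub>R (L * norm e)" for x :: 'a
  have w: "integrable lborel w"
    unfolding w_def
    by (intro integrable_scaleR_left integrable_real_indicator) (auto simp: emeasure_cball_less_top)
  have lim: "AE x in lborel. (\<lambda>n. s n x) \<longlonglongrightarrow> f' x"
    using d
  proof eventually_elim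
    case (elim x)
    then have "((\<lambda>h. (f (x + h *\<^sub>R e) - f x) / h) \<longlongrightarrow> f' x) (at 0)"
      by (simp add: has_field_derivative_iff)
    moreover have "filterlim t (at 0) sequentially"
      using t0 t(1) by (auto simp: filterlim_at less_imp_neq[symmetric])
    ultimately show ?case unfolding s_def by (rule filterlim_compose)
  qed
  have bd: "norm (s n x) \<le> w x" for n x
  proof (cases "norm x \<le> r'")
    case True
    have te: "norm (t n *\<^sub>R e) \<le> norm e" using t[of n] by (simp add: mult_left_le_one_le)
    have "norm (x + t n *\<^sub>R e) \<le> r' + norm e"
      using norm_triangle_ineq[of x "t n *\<^sub>R e"] True te by linarith
    moreover have "norm x \<le> r' + norm e" using True by (simp add: add_increasing2)
    ultimately have "dist (f (x + t n *\<^sub>R e)) (f x) \<le> L * dist (x + t n *\<^sub>R e) x"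
      by (intro lipschitz_onD[OF L]) auto
    then have "\<bar>f (x + t n *\<^sub>R e) - f x\<bar> \<le> L * norm e * t n"
      using t[of n] by (simp add: dist_norm mult_ac)
    then show ?thesis using True t[of n] by (simp add: s_def w_def field_simps)
  next
    case False
    have te: "norm (t n *\<^sub>R e) \<le> norm e" using t[of n] by (simp add: mult_left_le_one_le)
    have "norm (x + t n *\<^sub>R e) > r"
      using norm_triangle_ineq4[of "x + t n *\<^sub>R e" "t n *\<^sub>R e"] False te by (simp add: r'_def)
    moreover have "norm x > r" using False norm_ge_zero[of e] unfolding r'_def by linarith
    ultimately show ?thesis using supp L0 by (simp add: s_def w_def)
  qed
  have bd': "AE x in lborel. norm (s n x) \<le> w x" for n using bd by simp
  have fi: "integrable lborel f"
  proof -
    obtain B where B: "B \<ge> 0" "\<And>x. norm x \<le> r \<Longrightarrow> norm (f x) \<le> B"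
      using bounded_lipschitz_on_balls[OF f] by blast
    have "integrable lborel (\<lambda>x. indicator (cball 0 r) x *\<^sub>R B :: real)"
      by (intro integrable_scaleR_left integrable_real_indicator) (auto simp: emeasure_cball_less_top)
    then show ?thesis
    proof (rule Bochner_Integration.integrable_bound)
      show "AE x in lborel. norm (f x) \<le> norm (indicator (cball 0 r) x *\<^sub>R B :: real)"
        using B supp by (intro always_eventually allI) (auto simp: indicator_def not_le)
    qed simp
  qed
  have fi': "integrable lborel (\<lambda>x. f (x + a))" for a
  proof -
    have "integrable (distr lborel borel ((+) a)) f" using fi by (simp add: lborel_distr_plus)
    then show ?thesis by (subst (asm) integrable_distr_eq) (simp_all add: add.commute)
  qed
  have "(LINT x|lborel. s n x) = 0" for n
    unfolding s_def by (simp add: fi fi' integral_lborel_translate)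
  then have "(\<lambda>n. LINT x|lborel. s n x) \<longlonglongrightarrow> 0" by simp
  moreover have "(\<lambda>n. LINT x|lborel. s n x) \<longlonglongrightarrow> (LINT x|lborel. f' x)"
    by (rule integral_dominated_convergence[OF _ _ w lim bd']) auto
  ultimately show "(LINT x|lborel. f' x) = 0" using LIMSEQ_unique by blast
  show "integrable lborel f'"
    by (rule integrable_dominated_convergence[OF _ _ w lim bd']) auto
qed

section \<open>Polar coordinates\<close>

lemma pred_in_ball[measurable (raw)]:
  fixes g :: "'b \<Rightarrow> 'a::euclidean_space"
  assumes [measurable]: "g \<in> borel_measurable M"
  shows "Measurable.pred M (\<lambda>x. g x \<in> ball c r)"
  unfolding mem_ball by measurable

lemma pred_in_greaterThan[measurable (raw)]:
  fixes f g :: "'b \<Rightarrow> real"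
  assumes [measurable]: "f \<in> borel_measurable M" "g \<in> borel_measurable M"
  shows "Measurable.pred M (\<lambda>x. f x \<in> {g x<..})"
  unfolding greaterThan_iff by measurable

lemma nn_integral_lborel_scale:
  fixes f :: "'a::euclidean_space \<Rightarrow> ennreal"
  assumes [measurable]: "f \<in> borel_measurable borel" and c: "c > 0"
  shows "(\<integral>\<^sup>+x. f x \<partial>lborel) = ennreal (c ^ DIM('a)) * (\<integral>\<^sup>+x. f (c *\<^sub>R x) \<partial>lborel)"
  using c by (subst lborel_affine[of c 0])
    (simp_all add: nn_integral_density nn_integral_distr nn_integral_cmult)

lemma DERIV_inverse_power:
  fixes u :: real
  assumes "u > 0"
  shows "((\<lambda>u. 1 / u ^ n) has_real_derivative - (real n / u ^ (n + 1))) (at u)"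
proof -
  have "((\<lambda>u. u powr (- real n)) has_real_derivative - real n * u powr (- real n - 1)) (at u)"
    using assms by (rule has_real_derivative_powr)
  moreover have "\<forall>\<^sub>F v in nhds u. v powr (- real n) = 1 / v ^ n"
    using eventually_nhds_in_open[of "{0<..}" u] assms
    by (auto elim!: eventually_mono simp: powr_minus_divide powr_realpow)
  moreover have "- real n * u powr (- real n - 1) = - (real n / u ^ (n + 1))"
  proof -
    have "- real n - 1 = - real (n + 1)" by simp
    then have "u powr (- real n - 1) = 1 / u ^ (n + 1)"
      using assms by (simp only: powr_minus_divide powr_realpow)
    then show ?thesis by simp
  qed
  ultimately show ?thesis using DERIV_cong_ev by fastforce
qed

text \<open>For nonzero y the weights D |y|^D / t^(D + 1) over t > |y| therefore have total mass 1.
  In \<open>nn_integral_polar\<close> this inserts an additional radial variable without changing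
  the integral.\<close>

lemma nn_integral_power_tail:
  fixes D :: nat
  assumes a: "a > 0" and D: "D > 0"
  shows "(\<integral>\<^sup>+t. ennreal (D / t ^ (D + 1)) * indicator {a<..} t \<partial>lborel) = ennreal (1 / a ^ D)"
proof -
  have "(\<integral>\<^sup>+t. ennreal (D / t ^ (D + 1)) * indicator {a<..} t \<partial>lborel)
      = (\<integral>\<^sup>+t. ennreal (D / t ^ (D + 1)) * indicator {a..} t \<partial>lborel)"
  proof (rule nn_integral_cong_AE)
    show "AE t in lborel. ennreal (D / t ^ (D + 1)) * indicator {a<..} t = ennreal (D / t ^ (D + 1)) * indicator {a..} t"
      using AE_lborel_singleton[of a] by eventually_elim (auto simp: indicator_def)
  qed
  also have "\<dots> = ennreal (0 - (- 1 / a ^ D))"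
  proof (rule nn_integral_FTC_atLeast)
    show "((\<lambda>t. - 1 / t ^ D) has_real_derivative real D / t ^ (D + 1)) (at t)" if "a \<le> t" for t
    proof -
      have "t > 0" using that a by simp
      from DERIV_minus[OF DERIV_inverse_power[OF this, of D]] show ?thesis by simp
    qed
    show "((\<lambda>t::real. - 1 / t ^ D) \<longlongrightarrow> 0) at_top"
    proof -
      have "filterlim (\<lambda>t::real. t ^ D) at_top at_top"
        using D by (intro filterlim_pow_at_top filterlim_ident)
      then have "filterlim (\<lambda>t::real. t ^ D) at_infinity at_top"
        by (rule filterlim_at_top_imp_at_infinity)
      then show ?thesis by (rule tendsto_divide_0[OF tendsto_const])
    qed
  qed (use a in auto)
  finally show ?thesis by simp
qed

text \<open>The unit ball carries the angular variable, so that no surface measure is needed; the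
  formula follows from Tonelli's theorem and scaling in each variable.\<close>

lemma nn_integral_polar:
  fixes f :: "'a::euclidean_space \<Rightarrow> ennreal"
  assumes [measurable]: "f \<in> borel_measurable borel"
  shows "(\<integral>\<^sup>+x. f x \<partial>lborel) = (\<integral>\<^sup>+s. \<integral>\<^sup>+z.
      ennreal (indicator {0<..} s * indicator (ball 0 1) z * (real DIM('a) * s ^ (DIM('a) - 1))) * f ((s / norm z) *\<^sub>R z)
      \<partial>lborel \<partial>lborel)"
proof -
  define D where "D = DIM('a)"
  have D: "D > 0" by (simp add: D_def)
  have sD: "s * s ^ (D - 1) = s ^ D" for s :: real using D by (cases D) auto
  \<comment> \<open>Three forms of one double integral: s = t |z| at fixed z turns \<open>F\<close>
    into \<open>G\<close>, and y = t z at fixed t turns \<open>G\<close> into \<open>H\<close>,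
    whose integral over t is \<open>f y\<close>.\<close>
  define F where "F s z = ennreal (indicator {0<..} s * indicator (ball 0 1) z * (real D * s ^ (D - 1))) * f ((s / norm z) *\<^sub>R z)" for s :: real and z :: 'a
  define G where "G t z = ennreal (indicator {0<..} t * indicator (ball 0 1) z * (D * t ^ (D - 1) * norm z ^ D)) * f (t *\<^sub>R z)" for t :: real and z :: 'a
  define H where "H t y = ennreal (indicator {norm y<..} t * (D / t ^ (D + 1) * norm y ^ D)) * f y" for t :: real and y :: 'a
  have absorb: "ennreal a * (ennreal b * c) = ennreal (a * b) * c" if "a \<ge> 0" for a b and c :: ennreal
    using that by (simp only: ennreal_mult' mult.assoc)
  have FG: "(\<integral>\<^sup>+s. F s z \<partial>lborel) = (\<integral>\<^sup>+t. G t z \<partial>lborel)" if z: "z \<noteq> 0" for z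
  proof -
    have "(\<integral>\<^sup>+s. F s z \<partial>lborel) = ennreal (norm z) * (\<integral>\<^sup>+t. F (norm z * t) z \<partial>lborel)"
      unfolding F_def using z by (subst nn_integral_real_affine[where c = "norm z" and t = 0]) auto
    also have "\<dots> = (\<integral>\<^sup>+t. ennreal (norm z) * F (norm z * t) z \<partial>lborel)"
      unfolding F_def by (rule nn_integral_cmult[symmetric]) simp
    also have "\<dots> = (\<integral>\<^sup>+t. G t z \<partial>lborel)"
    proof (rule nn_integral_cong)
      fix t :: real
      have e: "norm z * t / norm z = t" using z by simp
      have "norm z * (indicator {0<..} (norm z * t) * indicator (ball 0 1) z * (D * (norm z * t) ^ (D - 1)))
        = indicator {0<..} t * indicator (ball 0 1) z * (D * t ^ (D - 1) * norm z ^ D)"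
        using z sD[of "norm z"] by (auto simp: indicator_def power_mult_distrib zero_less_mult_iff algebra_simps)
      then show "ennreal (norm z) * F (norm z * t) z = G t z"
        by (simp only: F_def G_def e absorb[OF norm_ge_zero])
    qed
    finally show ?thesis .
  qed
  have GH: "(\<integral>\<^sup>+z. G t z \<partial>lborel) = (\<integral>\<^sup>+y. H t y \<partial>lborel)" for t
  proof (cases "t > 0")
    case False
    then have "indicator {0<..} t = (0::real)" "\<And>y::'a. indicator {norm y<..} t = (0::real)"
      by (auto simp: indicator_def) (smt (verit) norm_ge_zero)
    then show ?thesis by (simp add: G_def H_def)
  next
    case t: True
    have "(\<integral>\<^sup>+y. H t y \<partial>lborel) = ennreal (t ^ D) * (\<integral>\<^sup>+z. H t (t *\<^sub>R z) \<partial>lborel)"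
      unfolding D_def H_def using t by (intro nn_integral_lborel_scale) auto
    also have "\<dots> = (\<integral>\<^sup>+z. ennreal (t ^ D) * H t (t *\<^sub>R z) \<partial>lborel)"
      unfolding H_def by (rule nn_integral_cmult[symmetric]) simp
    also have "\<dots> = (\<integral>\<^sup>+z. G t z \<partial>lborel)"
    proof (rule nn_integral_cong)
      fix z :: 'a
      have "t ^ D * (indicator {norm (t *\<^sub>R z)<..} t * (D / t ^ (D + 1) * norm (t *\<^sub>R z) ^ D))
        = indicator {0<..} t * indicator (ball 0 1) z * (D * t ^ (D - 1) * norm z ^ D)"
        using t sD[of t] by (auto simp: indicator_def power_mult_distrib field_simps)
      then show "ennreal (t ^ D) * H t (t *\<^sub>R z) = G t z"
        using t by (simp only: G_def H_def absorb zero_le_power less_imp_le)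
    qed
    finally show ?thesis by simp
  qed
  have Hf: "(\<integral>\<^sup>+t. H t y \<partial>lborel) = f y" if y: "y \<noteq> 0" for y
  proof -
    have "(\<integral>\<^sup>+t. H t y \<partial>lborel)
      = (\<integral>\<^sup>+t. (ennreal (norm y ^ D) * f y) * (ennreal (D / t ^ (D + 1)) * indicator {norm y<..} t) \<partial>lborel)"
    proof (rule nn_integral_cong)
      fix t :: real
      have "ennreal (D / t ^ (D + 1) * norm y ^ D) = ennreal (norm y ^ D) * ennreal (D / t ^ (D + 1))"
        by (subst mult.commute, rule ennreal_mult') simp
      then show "H t y = (ennreal (norm y ^ D) * f y) * (ennreal (D / t ^ (D + 1)) * indicator {norm y<..} t)"
        unfolding H_def
        by (cases "norm y < t") (simp_all only: indicator_simps greaterThan_iff mult_1_left mult_1_right mult_ac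
            mult_zero_left mult_zero_right ennreal_0 not_less not_le simp_thms)
    qed
    also have "\<dots> = (ennreal (norm y ^ D) * f y) * ennreal (1 / norm y ^ D)"
      using y D by (subst nn_integral_cmult, simp, subst nn_integral_power_tail) simp_all
    also have "\<dots> = ennreal (norm y ^ D * (1 / norm y ^ D)) * f y"
      by (simp only: ennreal_mult'' mult_ac zero_le_divide_1_iff zero_le_power norm_ge_zero)
    finally show ?thesis using y by simp
  qed
  have "(\<integral>\<^sup>+s. \<integral>\<^sup>+z. F s z \<partial>lborel \<partial>lborel) = (\<integral>\<^sup>+z. \<integral>\<^sup>+s. F s z \<partial>lborel \<partial>lborel)"
    unfolding F_def by (rule lborel_pair.Fubini') simp
  also have "\<dots> = (\<integral>\<^sup>+z. \<integral>\<^sup>+t. G t z \<partial>lborel \<partial>lborel)"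
    by (rule nn_integral_cong_AE, rule AE_mp[OF AE_lborel_singleton[of "0::'a"]], rule AE_I2, rule impI, rule FG)
  also have "\<dots> = (\<integral>\<^sup>+t. \<integral>\<^sup>+z. G t z \<partial>lborel \<partial>lborel)"
    unfolding G_def by (rule lborel_pair.Fubini') simp
  also have "\<dots> = (\<integral>\<^sup>+y. \<integral>\<^sup>+t. H t y \<partial>lborel \<partial>lborel)"
    unfolding GH unfolding H_def by (rule lborel_pair.Fubini') simp
  also have "\<dots> = (\<integral>\<^sup>+y. f y \<partial>lborel)"
    by (rule nn_integral_cong_AE, rule AE_mp[OF AE_lborel_singleton[of "0::'a"]], rule AE_I2, rule impI, rule Hf)
  finally show ?thesis by (simp add: F_def D_def)
qed

definition polar_density :: "real \<times> 'a::euclidean_space \<Rightarrow> real" where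
  "polar_density = (\<lambda>(s, z). indicator {0<..} s * indicator (ball 0 1) z * (real DIM('a) * s ^ (DIM('a) - 1)))"

lemma polar_density_measurable[measurable]: "polar_density \<in> borel_measurable (borel \<Otimes>\<^sub>M borel)"
  unfolding polar_density_def by measurable

lemma polar_density_nonneg: "polar_density sz \<ge> 0"
  by (auto simp: polar_density_def indicator_def split: prod.split)

text \<open>An equality of measures extends the formula from nonnegative to signed integrable
  functions, through the transfer rules for images and densities.\<close>

lemma lborel_polar:
  "(lborel :: 'a::euclidean_space measure) =
    distr (density (lborel \<Otimes>\<^sub>M lborel) (\<lambda>sz. ennreal (polar_density sz)))
      borel (\<lambda>(s, z). (s / norm z) *\<^sub>R z)"
proof (rule measure_eqI)
  fix A :: "'a set" assume "A \<in> sets lborel"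
  then have [measurable]: "A \<in> sets borel" by simp
  have "emeasure lborel A = (\<integral>\<^sup>+x. indicator A x \<partial>lborel)" by simp
  also have "\<dots> = (\<integral>\<^sup>+s. \<integral>\<^sup>+z. ennreal (polar_density (s, z)) * indicator A ((s / norm z) *\<^sub>R z) \<partial>lborel \<partial>lborel)"
    by (subst nn_integral_polar) (simp_all add: polar_density_def)
  also have "\<dots> = (\<integral>\<^sup>+sz. ennreal (polar_density sz) * indicator A ((\<lambda>(s, z). (s / norm z) *\<^sub>R z) sz) \<partial>(lborel \<Otimes>\<^sub>M lborel))"
    by (subst lborel.nn_integral_fst[symmetric]) simp_all
  also have "\<dots> = (\<integral>\<^sup>+sz. indicator A ((\<lambda>(s, z). (s / norm z) *\<^sub>R z) sz) \<partial>(density (lborel \<Otimes>\<^sub>M lborel) (\<lambda>sz. ennreal (polar_density sz))))"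
    by (subst nn_integral_density) simp_all
  also have "\<dots> = (\<integral>\<^sup>+x. indicator A x \<partial>distr (density (lborel \<Otimes>\<^sub>M lborel) (\<lambda>sz. ennreal (polar_density sz)))
      borel (\<lambda>(s, z). (s / norm z) *\<^sub>R z))"
    by (subst nn_integral_distr) simp_all
  finally show "emeasure lborel A = emeasure (distr (density (lborel \<Otimes>\<^sub>M lborel) (\<lambda>sz. ennreal (polar_density sz)))
      borel (\<lambda>(s, z). (s / norm z) *\<^sub>R z)) A" by simp
qed simp

lemma
  fixes f :: "'a::euclidean_space \<Rightarrow> real"
  assumes "integrable lborel f"
  shows integrable_polar: "integrable (lborel \<Otimes>\<^sub>M lborel) (\<lambda>(s, z). polar_density (s, z) * f ((s / norm z) *\<^sub>R z))"
    and integral_polar: "(LINT x|lborel. f x) =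
      (LINT s|lborel. LINT z|lborel. polar_density (s, z) * f ((s / norm z) *\<^sub>R z))"
proof -
  have [measurable]: "f \<in> borel_measurable borel" using assms by auto
  have "integrable (density (lborel \<Otimes>\<^sub>M lborel) (\<lambda>sz. ennreal (polar_density sz))) (\<lambda>sz. f ((\<lambda>(s, z). (s / norm z) *\<^sub>R z) sz))"
    using assms by (subst (asm) lborel_polar) (simp add: integrable_distr_eq)
  then have I: "integrable (lborel \<Otimes>\<^sub>M lborel) (\<lambda>sz. polar_density sz *\<^sub>R f ((\<lambda>(s, z). (s / norm z) *\<^sub>R z) sz))"
    by (subst (asm) integrable_density) (simp_all add: polar_density_nonneg)
  then show I': "integrable (lborel \<Otimes>\<^sub>M lborel) (\<lambda>(s, z). polar_density (s, z) * f ((s / norm z) *\<^sub>R z))"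
    by (simp add: case_prod_unfold)
  have "(LINT x|lborel. f x) = (LINT sz|(lborel \<Otimes>\<^sub>M lborel). polar_density sz *\<^sub>R f ((\<lambda>(s, z). (s / norm z) *\<^sub>R z) sz))"
    by (subst lborel_polar) (simp add: integral_distr integral_density polar_density_nonneg)
  also have "\<dots> = (LINT sz|(lborel \<Otimes>\<^sub>M lborel). (\<lambda>(s, z). polar_density (s, z) * f ((s / norm z) *\<^sub>R z)) sz)"
    by (simp add: case_prod_unfold)
  also have "\<dots> = (LINT s|lborel. LINT z|lborel. polar_density (s, z) * f ((s / norm z) *\<^sub>R z))"
    using lborel_pair.integral_fst'[OF I'] by simp
  finally show "(LINT x|lborel. f x) = \<dots>" .
qed

text \<open>The area of the unit sphere is expressed through the volume of the ball, which is the
  only angular measure in use.\<close>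

definition sphere_area :: "'a::euclidean_space itself \<Rightarrow> real" where
  "sphere_area T = real DIM('a) * measure lborel (ball (0::'a) 1)"

lemma sphere_area_pos: "sphere_area TYPE('a::euclidean_space) > 0"
  by (simp add: sphere_area_def content_ball)

lemma nn_integral_radial:
  fixes h :: "real \<Rightarrow> ennreal"
  assumes [measurable]: "h \<in> borel_measurable borel"
  shows "(\<integral>\<^sup>+x. h (norm (x::'a::euclidean_space)) \<partial>lborel) =
    (\<integral>\<^sup>+s. ennreal (indicator {0<..} s * (sphere_area TYPE('a) * s ^ (DIM('a) - 1))) * h s \<partial>lborel)"
proof -
  have "(\<integral>\<^sup>+x. h (norm (x::'a)) \<partial>lborel) = (\<integral>\<^sup>+s. \<integral>\<^sup>+z.
      ennreal (indicator {0<..} s * indicator (ball 0 1) z * (real DIM('a) * s ^ (DIM('a) - 1))) * h (norm ((s / norm z) *\<^sub>R (z::'a)))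
      \<partial>lborel \<partial>lborel)"
    by (subst nn_integral_polar) simp_all
  also have "\<dots> = (\<integral>\<^sup>+s. \<integral>\<^sup>+z.
      (ennreal (indicator {0<..} s * (real DIM('a) * s ^ (DIM('a) - 1))) * h s) * indicator (ball (0::'a) 1) z
      \<partial>lborel \<partial>lborel)"
  proof (rule nn_integral_cong, rule nn_integral_cong_AE, rule AE_mp[OF AE_lborel_singleton[of 0]], rule AE_I2, rule impI)
    fix s :: real and z :: 'a assume "z \<noteq> 0"
    then show "ennreal (indicator {0<..} s * indicator (ball 0 1) z * (real DIM('a) * s ^ (DIM('a) - 1))) * h (norm ((s / norm z) *\<^sub>R (z::'a)))
      = (ennreal (indicator {0<..} s * (real DIM('a) * s ^ (DIM('a) - 1))) * h s) * indicator (ball (0::'a) 1) z"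
      by (auto simp: indicator_def)
  qed
  also have "\<dots> = (\<integral>\<^sup>+s. ennreal (indicator {0<..} s * (sphere_area TYPE('a) * s ^ (DIM('a) - 1))) * h s \<partial>lborel)"
  proof (rule nn_integral_cong)
    fix s :: real
    have "(\<integral>\<^sup>+z. (ennreal (indicator {0<..} s * (real DIM('a) * s ^ (DIM('a) - 1))) * h s) * indicator (ball (0::'a) 1) z \<partial>lborel)
      = (ennreal (indicator {0<..} s * (real DIM('a) * s ^ (DIM('a) - 1))) * h s) * emeasure lborel (ball (0::'a) 1)"
      by (simp add: nn_integral_cmult)
    also have "emeasure lborel (ball (0::'a) 1) = ennreal (measure lborel (ball (0::'a) 1))"
      using emeasure_bounded_finite[OF bounded_ball, of "0::'a" 1]
      by (intro emeasure_eq_ennreal_measure) (simp only: infinity_ennreal_def less_top)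
    finally show "(\<integral>\<^sup>+z. (ennreal (indicator {0<..} s * (real DIM('a) * s ^ (DIM('a) - 1))) * h s) * indicator (ball (0::'a) 1) z \<partial>lborel)
      = ennreal (indicator {0<..} s * (sphere_area TYPE('a) * s ^ (DIM('a) - 1))) * h s"
      using ennreal_mult''[of "measure lborel (ball (0::'a) 1)" "indicator {0<..} s * (real DIM('a) * s ^ (DIM('a) - 1))"]
      by (simp add: sphere_area_def mult_ac)
  qed
  finally show ?thesis .
qed

lemma integrable_radial_iff:
  fixes h :: "real \<Rightarrow> real"
  assumes [measurable]: "h \<in> borel_measurable borel"
  shows "integrable lborel (\<lambda>x::'a::euclidean_space. h (norm x)) \<longleftrightarrow>
    integrable lborel (\<lambda>s. indicator {0<..} s * (s ^ (DIM('a) - 1) * h s))"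
proof -
  have c: "sphere_area TYPE('a) > 0" by (rule sphere_area_pos)
  have "integrable lborel (\<lambda>x::'a. h (norm x)) \<longleftrightarrow> (\<integral>\<^sup>+x. ennreal \<bar>h (norm (x::'a))\<bar> \<partial>lborel) < \<infinity>"
    by (simp add: integrable_iff_bounded)
  also have "(\<integral>\<^sup>+x. ennreal \<bar>h (norm (x::'a))\<bar> \<partial>lborel)
    = (\<integral>\<^sup>+s. ennreal (indicator {0<..} s * (sphere_area TYPE('a) * s ^ (DIM('a) - 1))) * ennreal \<bar>h s\<bar> \<partial>lborel)"
    by (subst nn_integral_radial) simp_all
  also have "\<dots> = (\<integral>\<^sup>+s. ennreal (norm (sphere_area TYPE('a) * (indicator {0<..} s * (s ^ (DIM('a) - 1) * h s)))) \<partial>lborel)"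
    by (intro nn_integral_cong) (use c in \<open>auto simp: indicator_def abs_mult mult_ac simp flip: ennreal_mult''\<close>)
  also have "\<dots> < \<infinity> \<longleftrightarrow> integrable lborel (\<lambda>s. sphere_area TYPE('a) * (indicator {0<..} s * (s ^ (DIM('a) - 1) * h s)))"
    by (simp only: integrable_iff_bounded) simp
  also have "\<dots> \<longleftrightarrow> integrable lborel (\<lambda>s. indicator {0<..} s * (s ^ (DIM('a) - 1) * h s))"
    using c by (subst integrable_mult_left_iff) auto
  finally show ?thesis .
qed

lemma integral_radial:
  fixes h :: "real \<Rightarrow> real"
  assumes [measurable]: "h \<in> borel_measurable borel" and "integrable lborel (\<lambda>x::'a::euclidean_space. h (norm x))"
  shows "(LINT x|lborel. h (norm (x::'a))) =
    sphere_area TYPE('a) * (LINT s|lborel. indicator {0<..} s * (s ^ (DIM('a) - 1) * h s))"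
proof -
  have "(LINT x|lborel. h (norm (x::'a))) =
    (LINT s|lborel. LINT z|lborel. polar_density (s, z) * h (norm ((s / norm z) *\<^sub>R (z::'a))))"
    by (rule integral_polar[OF assms(2)])
  also have "\<dots> = (LINT s|lborel. LINT z|lborel. (indicator {0<..} s * (real DIM('a) * s ^ (DIM('a) - 1) * h s)) * indicator (ball (0::'a) 1) z)"
  proof (rule Bochner_Integration.integral_cong[OF refl])
    fix s :: real
    show "(LINT z|lborel. polar_density (s, z) * h (norm ((s / norm z) *\<^sub>R (z::'a))))
      = (LINT z|lborel. (indicator {0<..} s * (real DIM('a) * s ^ (DIM('a) - 1) * h s)) * indicator (ball (0::'a) 1) z)"
    proof (cases "s > 0")
      case True
      have "AE z in lborel. polar_density (s, z) * h (norm ((s / norm z) *\<^sub>R (z::'a)))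
        = (indicator {0<..} s * (real DIM('a) * s ^ (DIM('a) - 1) * h s)) * indicator (ball (0::'a) 1) z"
        using AE_lborel_singleton[of "0::'a"]
        by eventually_elim (use True in \<open>simp add: polar_density_def\<close>)
      then show ?thesis by (intro integral_cong_AE) simp_all
    qed (simp add: polar_density_def)
  qed
  also have "\<dots> = sphere_area TYPE('a) * (LINT s|lborel. indicator {0<..} s * (s ^ (DIM('a) - 1) * h s))"
    by (subst integral_mult_right_zero[symmetric], intro Bochner_Integration.integral_cong refl)
      (simp add: sphere_area_def)
  finally show ?thesis .
qed

text \<open>Polar coordinates turn the volume of a union of spheres into a weighted integral over
  their radii. The exceptional radii are first enclosed in a Borel null set.\<close>

lemma AE_radial:
  fixes P :: "real \<Rightarrow> bool"
  assumes "AE s in lborel. s > 0 \<longrightarrow> P s"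
  shows "AE x in lborel. x \<noteq> 0 \<longrightarrow> P (norm (x::'a::euclidean_space))"
proof -
  obtain N where N: "{s. \<not> (s > 0 \<longrightarrow> P s)} \<subseteq> N" "N \<in> null_sets lborel"
    using assms by (auto elim!: AE_E2 AE_E simp: null_setsI)
  then have [measurable]: "N \<in> sets borel" by auto
  have "AE s in lborel. s \<notin> N" using N(2) by (rule AE_not_in)
  have "(\<integral>\<^sup>+x. indicator N (norm (x::'a)) \<partial>lborel) =
    (\<integral>\<^sup>+s. ennreal (indicator {0<..} s * (sphere_area TYPE('a) * s ^ (DIM('a) - 1))) * indicator N s \<partial>lborel)"
    by (rule nn_integral_radial) simp
  also have "\<dots> = 0"
    using \<open>AE s in lborel. s \<notin> N\<close> by (subst nn_integral_0_iff_AE) (auto elim!: eventually_mono)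
  finally have "AE x in lborel. indicator N (norm (x::'a)) = (0::ennreal)"
    by (subst (asm) nn_integral_0_iff_AE) simp_all
  then show ?thesis
  proof eventually_elim
    case (elim x)
    then have "norm x \<notin> N" by (simp add: indicator_def split: if_splits)
    then have "norm x > 0 \<Longrightarrow> P (norm x)" using N(1) by blast
    then show ?case by simp
  qed
qed

section \<open>Indefinite integrals\<close>

text \<open>Absolute continuity in integral form: the density \<open>f\<close> is only integrable,
  so no pointwise derivative of \<open>F\<close> is recorded. Half-open intervals make increments
  add up without overlap.\<close>

definition primitive_on :: "real \<Rightarrow> real \<Rightarrow> (real \<Rightarrow> real) \<Rightarrow> (real \<Rightarrow> real) \<Rightarrow> bool" where
  "primitive_on a b F f \<longleftrightarrow> set_integrable lborel {a..b} f \<and>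
    (\<forall>r r'. a \<le> r \<and> r \<le> r' \<and> r' \<le> b \<longrightarrow> F r' - F r = (LINT s:{r<..r'}|lborel. f s))"

lemma primitive_onD:
  "primitive_on a b F f \<Longrightarrow> a \<le> r \<Longrightarrow> r \<le> r' \<Longrightarrow> r' \<le> b \<Longrightarrow> F r' - F r = (LINT s:{r<..r'}|lborel. f s)"
  by (simp add: primitive_on_def)

lemma primitive_on_integrable: "primitive_on a b F f \<Longrightarrow> set_integrable lborel {a..b} f"
  by (simp add: primitive_on_def)

lemma set_integrable_Ioc: "set_integrable lborel {a..b} f \<Longrightarrow> a \<le> r \<Longrightarrow> r' \<le> b \<Longrightarrow> set_integrable lborel {r<..r'} f"
  for f :: "real \<Rightarrow> real"
  by (rule set_integrable_subset) auto

lemma set_integral_Ioc_combine: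
  fixes f :: "real \<Rightarrow> real"
  assumes "set_integrable lborel {a..b} f" "a \<le> r" "r \<le> s" "s \<le> t" "t \<le> b"
  shows "(LINT x:{r<..t}|lborel. f x) = (LINT x:{r<..s}|lborel. f x) + (LINT x:{s<..t}|lborel. f x)"
proof -
  have "{r<..t} = {r<..s} \<union> {s<..t}" using assms by auto
  moreover have "(LINT x:{r<..s} \<union> {s<..t}|lborel. f x) = (LINT x:{r<..s}|lborel. f x) + (LINT x:{s<..t}|lborel. f x)"
    using assms by (intro set_integral_Un set_integrable_Ioc[OF assms(1)]) auto
  ultimately show ?thesis by simp
qed

text \<open>Bisection adds the local errors up to e times the integral of \<open>k\<close> over the
  whole interval, and e is arbitrary. Measuring the error by \<open>k\<close> instead of by length
  admits unbounded densities.\<close>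

lemma increments_equal_integral:
  fixes H h k :: "real \<Rightarrow> real"
  assumes ab: "a \<le> b" and h: "set_integrable lborel {a..b} h" and k: "set_integrable lborel {a..b} k"
    and k0: "\<And>s. k s \<ge> 0"
    and small: "\<And>e x. e > 0 \<Longrightarrow> a \<le> x \<Longrightarrow> x \<le> b \<Longrightarrow> \<exists>d>0. \<forall>r r'. a \<le> r \<and> r \<le> x \<and> x \<le> r' \<and> r' \<le> b \<and> r' - r < d \<longrightarrow>
      \<bar>H r' - H r - (LINT s:{r<..r'}|lborel. h s)\<bar> \<le> e * (LINT s:{r<..r'}|lborel. k s)"
  shows "H b - H a = (LINT s:{a<..b}|lborel. h s)"
proof -
  let ?K = "LINT s:{a<..b}|lborel. k s"
  have "?K \<ge> 0"
    unfolding set_lebesgue_integral_def by (intro integral_nonneg_AE AE_I2) (simp add: k0)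
  have bound: "\<bar>H b - H a - (LINT s:{a<..b}|lborel. h s)\<bar> \<le> e * ?K" if e: "e > 0" for e
  proof -
    define P where "P r r' \<longleftrightarrow> (a \<le> r \<and> r' \<le> b \<longrightarrow>
      \<bar>H r' - H r - (LINT s:{r<..r'}|lborel. h s)\<bar> \<le> e * (LINT s:{r<..r'}|lborel. k s))" for r r'
    have "P a b"
      using ab
    proof (induction rule: Bolzano)
      case (trans r s t)
      show ?case
        unfolding P_def
      proof
        assume rt: "a \<le> r \<and> t \<le> b"
        have "(LINT x:{r<..t}|lborel. h x) = (LINT x:{r<..s}|lborel. h x) + (LINT x:{s<..t}|lborel. h x)"
          "(LINT x:{r<..t}|lborel. k x) = (LINT x:{r<..s}|lborel. k x) + (LINT x:{s<..t}|lborel. k x)"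
          using rt trans by (auto intro!: set_integral_Ioc_combine[OF h] set_integral_Ioc_combine[OF k])
        moreover have "\<bar>H s - H r - (LINT x:{r<..s}|lborel. h x)\<bar> \<le> e * (LINT x:{r<..s}|lborel. k x)"
          "\<bar>H t - H s - (LINT x:{s<..t}|lborel. h x)\<bar> \<le> e * (LINT x:{s<..t}|lborel. k x)"
          using trans rt by (auto simp: P_def)
        ultimately show "\<bar>H t - H r - (LINT s:{r<..t}|lborel. h s)\<bar> \<le> e * (LINT s:{r<..t}|lborel. k s)"
          by (simp add: distrib_left)
      qed
    next
      case (local x)
      then obtain d where "d > 0" "\<And>r r'. a \<le> r \<and> r \<le> x \<and> x \<le> r' \<and> r' \<le> b \<and> r' - r < d \<Longrightarrow>
        \<bar>H r' - H r - (LINT s:{r<..r'}|lborel. h s)\<bar> \<le> e * (LINT s:{r<..r'}|lborel. k s)"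
        using small[OF e] by blast
      then show ?case unfolding P_def by (intro exI[of _ d]) blast
    qed
    then show ?thesis by (simp add: P_def)
  qed
  have "\<bar>H b - H a - (LINT s:{a<..b}|lborel. h s)\<bar> \<le> 0 + e" if "e > 0" for e
  proof -
    \<comment> \<open>The added 1 covers the case that \<open>?K\<close> is 0.\<close>
    have "e / (?K + 1) > 0" using \<open>?K \<ge> 0\<close> that by simp
    note bound[OF this]
    also have "e / (?K + 1) * ?K \<le> e" using \<open>?K \<ge> 0\<close> that by (simp add: field_simps)
    finally show ?thesis by simp
  qed
  then have "\<bar>H b - H a - (LINT s:{a<..b}|lborel. h s)\<bar> \<le> 0" by (rule field_le_epsilon)
  then show ?thesis by simp
qed

lemma primitive_on_continuous:
  assumes "primitive_on a b F f"
  shows "continuous_on {a..b} F"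
proof -
  have f: "set_integrable lborel {a..b} f" using assms by (rule primitive_on_integrable)
  have "f integrable_on {a..b}" using f by (rule set_borel_integral_eq_integral)
  then have c: "continuous_on {a..b} (\<lambda>x. F a + integral {a..x} f)"
    by (intro continuous_intros indefinite_integral_continuous_1)
  have "F a + integral {a..x} f = F x" if x: "x \<in> {a..b}" for x
  proof -
    have "F x - F a = (LINT s:{a<..x}|lborel. f s)"
      using x by (intro primitive_onD[OF assms]) auto
    also have "\<dots> = (LINT s:{a..x}|lborel. f s)"
      by (rule set_integral_discrete_difference[of "{a}"]) auto
    also have "\<dots> = integral {a..x} f"
      using x by (intro set_borel_integral_eq_integral set_integrable_subset[OF f]) auto
    finally show ?thesis by simp
  qed
  with c show ?thesis by (metis (no_types, lifting) continuous_on_cong)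
qed

lemma set_integrable_mult_continuous:
  fixes f g :: "real \<Rightarrow> real"
  assumes f: "set_integrable lborel {a..b} f" and g: "continuous_on {a..b} g"
  shows "set_integrable lborel {a..b} (\<lambda>s. f s * g s)"
proof -
  have "compact (g ` {a..b})" using g by (intro compact_continuous_image) auto
  then obtain B where B: "\<And>s. s \<in> {a..b} \<Longrightarrow> \<bar>g s\<bar> \<le> B"
    using compact_imp_bounded[of "g ` {a..b}"] by (metis bounded_iff image_eqI real_norm_def)
  have 1: "(\<lambda>s. indicator {a..b} s *\<^sub>R f s) \<in> borel_measurable lborel"
    using f unfolding set_integrable_def by auto
  have "(\<lambda>s. indicator {a..b} s *\<^sub>R g s) \<in> borel_measurable borel"
    using g by (intro borel_measurable_continuous_on_indicator) auto
  then have 2: "(\<lambda>s. indicator {a..b} s *\<^sub>R g s) \<in> borel_measurable lborel" by simp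
  have "integrable lborel (\<lambda>s. B * (indicator {a..b} s *\<^sub>R f s))"
    using f unfolding set_integrable_def by (intro integrable_mult_right) auto
  then have "integrable lborel (\<lambda>s. (indicator {a..b} s *\<^sub>R f s) * (indicator {a..b} s *\<^sub>R g s))"
  proof (rule Bochner_Integration.integrable_bound)
    show "AE s in lborel. norm ((indicator {a..b} s *\<^sub>R f s) * (indicator {a..b} s *\<^sub>R g s))
      \<le> norm (B * (indicator {a..b} s *\<^sub>R f s))"
    proof (intro AE_I2)
      fix s :: real
      show "norm ((indicator {a..b} s *\<^sub>R f s) * (indicator {a..b} s *\<^sub>R g s))
        \<le> norm (B * (indicator {a..b} s *\<^sub>R f s))"
        using B[of s] mult_mono[of "\<bar>g s\<bar>" "\<bar>B\<bar>" "\<bar>f s\<bar>" "\<bar>f s\<bar>"]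
        by (auto simp: indicator_def abs_mult mult.commute)
    qed
  qed (rule borel_measurable_times[OF 1 2])
  moreover have "(\<lambda>s. (indicator {a..b} s *\<^sub>R f s) * (indicator {a..b} s *\<^sub>R g s)) = (\<lambda>s. indicator {a..b} s *\<^sub>R (f s * g s))"
    by (auto simp: indicator_def)
  ultimately show ?thesis by (simp add: set_integrable_def)
qed

lemma set_integral_abs_bound:
  fixes f k :: "real \<Rightarrow> real"
  assumes "set_integrable lborel A f" "set_integrable lborel A k"
    and "\<And>s. s \<in> A \<Longrightarrow> \<bar>f s\<bar> \<le> k s"
  shows "\<bar>LINT s:A|lborel. f s\<bar> \<le> (LINT s:A|lborel. k s)"
  using assms unfolding set_lebesgue_integral_def set_integrable_def
  by (intro integral_abs_bound[THEN order_trans] integral_mono) (auto simp: indicator_def)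

lemma set_integral_mult_right': "(LINT x:A|M. c * f x) = c * (LINT x:A|M. f x)" for f :: "'a \<Rightarrow> real"
  by simp

lemma primitive_onI:
  assumes "set_integrable lborel {a..b} h"
    and "\<And>r r'. a \<le> r \<Longrightarrow> r \<le> r' \<Longrightarrow> r' \<le> b \<Longrightarrow> H r' - H r = (LINT s:{r<..r'}|lborel. h s)"
  shows "primitive_on a b H h"
  using assms by (auto simp: primitive_on_def)

lemma continuous_on_IccD:
  fixes F :: "real \<Rightarrow> real"
  assumes "continuous_on {a..b} F" "a \<le> x" "x \<le> b" "e > 0"
  shows "\<exists>d>0. \<forall>t. a \<le> t \<and> t \<le> b \<and> \<bar>t - x\<bar> < d \<longrightarrow> \<bar>F t - F x\<bar> < e"
  using assms unfolding continuous_on_iff dist_real_def by (metis atLeastAtMost_iff)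

text \<open>Over a short interval the increment of the product differs from the integral by terms (G
  r' - G s) f and (F r - F s) g. Continuity makes both differences at most e, which is the local
  criterion with k = |f| + |g|.\<close>

lemma primitive_on_mult:
  assumes F: "primitive_on a b F f" and G: "primitive_on a b G g"
  shows "primitive_on a b (\<lambda>s. F s * G s) (\<lambda>s. f s * G s + g s * F s)"
proof (rule primitive_onI)
  note cF = primitive_on_continuous[OF F] and cG = primitive_on_continuous[OF G]
  note iF = primitive_on_integrable[OF F] and iG = primitive_on_integrable[OF G]
  show int: "set_integrable lborel {a..b} (\<lambda>s. f s * G s + g s * F s)"
    by (intro set_integral_add set_integrable_mult_continuous iF iG cF cG)
  fix c d assume cd: "a \<le> c" "c \<le> d" "d \<le> b"
  show "F d * G d - F c * G c = (LINT s:{c<..d}|lborel. f s * G s + g s * F s)"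
  proof (rule increments_equal_integral[OF cd(2), where k = "\<lambda>s. \<bar>f s\<bar> + \<bar>g s\<bar>"])
    show "set_integrable lborel {c..d} (\<lambda>s. f s * G s + g s * F s)"
      by (rule set_integrable_subset[OF int]) (use cd in auto)
    show "set_integrable lborel {c..d} (\<lambda>s. \<bar>f s\<bar> + \<bar>g s\<bar>)"
      by (rule set_integrable_subset[of _ "{a..b}"]) (use cd in \<open>auto intro!: set_integrable_abs iF iG\<close>)
    fix e x :: real assume e: "e > 0" and x: "c \<le> x" "x \<le> d"
    have e2: "e / 2 > 0" using e by simp
    obtain d1 where d1: "d1 > 0" "\<And>t. a \<le> t \<and> t \<le> b \<and> \<bar>t - x\<bar> < d1 \<Longrightarrow> \<bar>F t - F x\<bar> < e / 2"
      using continuous_on_IccD[OF cF _ _ e2] x cd by (meson order_trans)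
    obtain d2 where d2: "d2 > 0" "\<And>t. a \<le> t \<and> t \<le> b \<and> \<bar>t - x\<bar> < d2 \<Longrightarrow> \<bar>G t - G x\<bar> < e / 2"
      using continuous_on_IccD[OF cG _ _ e2] x cd by (meson order_trans)
    show "\<exists>D>0. \<forall>r r'. c \<le> r \<and> r \<le> x \<and> x \<le> r' \<and> r' \<le> d \<and> r' - r < D \<longrightarrow>
      \<bar>F r' * G r' - F r * G r - (LINT s:{r<..r'}|lborel. f s * G s + g s * F s)\<bar> \<le> e * (LINT s:{r<..r'}|lborel. \<bar>f s\<bar> + \<bar>g s\<bar>)"
    proof (intro exI[of _ "min d1 d2"] conjI allI impI)
      fix r r' assume "c \<le> r \<and> r \<le> x \<and> x \<le> r' \<and> r' \<le> d \<and> r' - r < min d1 d2"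
      then have r: "a \<le> r" "r \<le> x" "x \<le> r'" "r' \<le> b" "r' - r < d1" "r' - r < d2" using cd by auto
      have osc: "\<bar>F s - F t\<bar> \<le> e" "\<bar>G s - G t\<bar> \<le> e" if "s \<in> {r..r'}" "t \<in> {r..r'}" for s t
      proof -
        have st: "a \<le> s \<and> s \<le> b \<and> \<bar>s - x\<bar> < min d1 d2" "a \<le> t \<and> t \<le> b \<and> \<bar>t - x\<bar> < min d1 d2"
          using r that by auto
        then show "\<bar>F s - F t\<bar> \<le> e" using d1(2)[of s] d1(2)[of t] by linarith
        show "\<bar>G s - G t\<bar> \<le> e" using st d2(2)[of s] d2(2)[of t] by linarith
      qed
      have f': "set_integrable lborel {r<..r'} f" and g': "set_integrable lborel {r<..r'} g"
        using r by (auto intro!: set_integrable_Ioc iF iG)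
      have fG: "set_integrable lborel {r<..r'} (\<lambda>s. f s * G s)" and gF: "set_integrable lborel {r<..r'} (\<lambda>s. g s * F s)"
        using r by (auto intro!: set_integrable_Ioc set_integrable_mult_continuous iF iG cF cG)
      have "F r' * G r' - F r * G r = G r' * (F r' - F r) + F r * (G r' - G r)" by (simp add: algebra_simps)
      also have "\<dots> = (LINT s:{r<..r'}|lborel. G r' * f s) + (LINT s:{r<..r'}|lborel. F r * g s)"
        using primitive_onD[OF F] primitive_onD[OF G] r by simp
      also have "\<dots> = (LINT s:{r<..r'}|lborel. G r' * f s + F r * g s)"
        using f' g' by (subst set_integral_add) auto
      finally have "F r' * G r' - F r * G r - (LINT s:{r<..r'}|lborel. f s * G s + g s * F s)
        = (LINT s:{r<..r'}|lborel. (G r' * f s + F r * g s) - (f s * G s + g s * F s))"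
        using f' g' fG gF by (subst set_integral_diff) auto
      also have "\<bar>\<dots>\<bar> \<le> (LINT s:{r<..r'}|lborel. e * (\<bar>f s\<bar> + \<bar>g s\<bar>))"
      proof (rule set_integral_abs_bound)
        show "set_integrable lborel {r<..r'} (\<lambda>s. (G r' * f s + F r * g s) - (f s * G s + g s * F s))"
          using f' g' fG gF by (intro set_integral_diff set_integral_add set_integrable_mult_right) auto
        show "set_integrable lborel {r<..r'} (\<lambda>s. e * (\<bar>f s\<bar> + \<bar>g s\<bar>))"
          using f' g' by (intro set_integral_add set_integrable_mult_right set_integrable_abs) auto
        fix s assume s: "s \<in> {r<..r'}"
        have "(G r' * f s + F r * g s) - (f s * G s + g s * F s) = (G r' - G s) * f s + (F r - F s) * g s"
          by (simp add: algebra_simps)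
        also have "\<bar>\<dots>\<bar> \<le> \<bar>G r' - G s\<bar> * \<bar>f s\<bar> + \<bar>F r - F s\<bar> * \<bar>g s\<bar>"
          by (metis abs_mult abs_triangle_ineq)
        also have "\<dots> \<le> e * \<bar>f s\<bar> + e * \<bar>g s\<bar>"
          using s r by (intro add_mono mult_right_mono osc) auto
        finally show "\<bar>(G r' * f s + F r * g s) - (f s * G s + g s * F s)\<bar> \<le> e * (\<bar>f s\<bar> + \<bar>g s\<bar>)"
          by (simp add: distrib_left)
      qed
      also have "\<dots> = e * (LINT s:{r<..r'}|lborel. \<bar>f s\<bar> + \<bar>g s\<bar>)" by (rule set_integral_mult_right')
      finally show "\<bar>F r' * G r' - F r * G r - (LINT s:{r<..r'}|lborel. f s * G s + g s * F s)\<bar>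
        \<le> e * (LINT s:{r<..r'}|lborel. \<bar>f s\<bar> + \<bar>g s\<bar>)" .
    qed (use d1 d2 in auto)
  qed simp
qed

text \<open>The endpoints may come in either order or coincide, because they will be values of a
  function that need not be monotone.\<close>

lemma MVT_between:
  fixes \<phi> \<phi>' :: "real \<Rightarrow> real"
  assumes S: "is_interval S" and d: "\<And>y. y \<in> S \<Longrightarrow> (\<phi> has_real_derivative \<phi>' y) (at y)"
    and u: "u \<in> S" and v: "v \<in> S"
  obtains \<xi> where "\<xi> \<in> S" "min u v \<le> \<xi>" "\<xi> \<le> max u v" "\<phi> v - \<phi> u = \<phi>' \<xi> * (v - u)"
proof (cases u v rule: linorder_cases)
  case less
  have "y \<in> S" if "u \<le> y" "y \<le> v" for y using S u v that by (meson is_interval_1)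
  then obtain z where "u < z" "z < v" "\<phi> v - \<phi> u = (v - u) * \<phi>' z"
    using MVT2[OF less, of \<phi> \<phi>'] d by auto
  then show ?thesis using \<open>\<And>y. u \<le> y \<Longrightarrow> y \<le> v \<Longrightarrow> y \<in> S\<close> less
    by (intro that[of z]) (auto simp: mult.commute)
next
  case equal
  then show ?thesis using u by (intro that[of u]) auto
next
  case greater
  have "y \<in> S" if "v \<le> y" "y \<le> u" for y using S u v that by (meson is_interval_1)
  then obtain z where "v < z" "z < u" "\<phi> u - \<phi> v = (u - v) * \<phi>' z"
    using MVT2[OF greater, of \<phi> \<phi>'] d by auto
  then show ?thesis using \<open>\<And>y. v \<le> y \<Longrightarrow> y \<le> u \<Longrightarrow> y \<in> S\<close> greater
    by (intro that[of z]) (auto simp: algebra_simps)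
qed

text \<open>The mean value theorem writes an increment of the composition as
  \<open>\<phi>' \<xi>\<close> times an increment of \<open>F\<close>, with \<open>\<xi>\<close>
  between two values of \<open>F\<close>. The local error is then governed by the oscillation of
  \<open>\<phi>'\<close>. The interval \<open>S\<close> keeps the values away from singularities of
  \<open>\<phi>\<close>.\<close>

lemma primitive_on_compose:
  assumes F: "primitive_on a b F f" and S: "is_interval S" and FS: "F ` {a..b} \<subseteq> S"
    and d: "\<And>y. y \<in> S \<Longrightarrow> (\<phi> has_real_derivative \<phi>' y) (at y)" and c: "continuous_on S \<phi>'"
  shows "primitive_on a b (\<lambda>s. \<phi> (F s)) (\<lambda>s. f s * \<phi>' (F s))"
proof (rule primitive_onI)
  note cF = primitive_on_continuous[OF F] and iF = primitive_on_integrable[OF F]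
  have cc: "continuous_on {a..b} (\<lambda>s. \<phi>' (F s))"
    using continuous_on_compose2[OF c cF FS] .
  show int: "set_integrable lborel {a..b} (\<lambda>s. f s * \<phi>' (F s))"
    by (intro set_integrable_mult_continuous iF cc)
  fix p q assume pq: "a \<le> p" "p \<le> q" "q \<le> b"
  show "\<phi> (F q) - \<phi> (F p) = (LINT s:{p<..q}|lborel. f s * \<phi>' (F s))"
  proof (rule increments_equal_integral[OF pq(2), where k = "\<lambda>s. \<bar>f s\<bar>"])
    show "set_integrable lborel {p..q} (\<lambda>s. f s * \<phi>' (F s))"
      by (rule set_integrable_subset[OF int]) (use pq in auto)
    show "set_integrable lborel {p..q} (\<lambda>s. \<bar>f s\<bar>)"
      by (rule set_integrable_subset[of _ "{a..b}"]) (use pq in \<open>auto intro!: set_integrable_abs iF\<close>)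
    fix e x :: real assume e: "e > 0" and x: "p \<le> x" "x \<le> q"
    have e2: "e / 2 > 0" using e by simp
    have "F x \<in> S" using FS x pq by auto
    then obtain \<delta> where \<delta>: "\<delta> > 0" "\<And>y. y \<in> S \<Longrightarrow> \<bar>y - F x\<bar> < \<delta> \<Longrightarrow> \<bar>\<phi>' y - \<phi>' (F x)\<bar> < e / 2"
      using c e2 unfolding continuous_on_iff dist_real_def by metis
    obtain D where D: "D > 0" "\<And>t. a \<le> t \<and> t \<le> b \<and> \<bar>t - x\<bar> < D \<Longrightarrow> \<bar>F t - F x\<bar> < \<delta>"
      using continuous_on_IccD[OF cF _ _ \<delta>(1)] x pq by (meson order_trans)
    show "\<exists>D>0. \<forall>r r'. p \<le> r \<and> r \<le> x \<and> x \<le> r' \<and> r' \<le> q \<and> r' - r < D \<longrightarrow>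
      \<bar>\<phi> (F r') - \<phi> (F r) - (LINT s:{r<..r'}|lborel. f s * \<phi>' (F s))\<bar> \<le> e * (LINT s:{r<..r'}|lborel. \<bar>f s\<bar>)"
    proof (intro exI[of _ D] conjI allI impI)
      fix r r' assume "p \<le> r \<and> r \<le> x \<and> x \<le> r' \<and> r' \<le> q \<and> r' - r < D"
      then have r: "a \<le> r" "r \<le> x" "x \<le> r'" "r' \<le> b" "r' - r < D" using pq by auto
      have Fs: "F s \<in> S" "\<bar>F s - F x\<bar> < \<delta>" if "s \<in> {r..r'}" for s
        using FS D(2)[of s] r that by auto
      have "F r \<in> S" "F r' \<in> S" using Fs r by auto
      then obtain \<xi> where \<xi>: "\<xi> \<in> S" "min (F r) (F r') \<le> \<xi>" "\<xi> \<le> max (F r) (F r')"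
        "\<phi> (F r') - \<phi> (F r) = \<phi>' \<xi> * (F r' - F r)"
        using MVT_between[OF S d] by blast
      have "\<bar>\<xi> - F x\<bar> < \<delta>" using \<xi> Fs(2)[of r] Fs(2)[of r'] r by (auto simp: min_def max_def split: if_splits)
      then have osc: "\<bar>\<phi>' \<xi> - \<phi>' (F s)\<bar> \<le> e" if "s \<in> {r..r'}" for s
        using \<delta>(2)[OF \<xi>(1)] \<delta>(2)[OF Fs[OF that]] by linarith
      have f': "set_integrable lborel {r<..r'} f"
        using r by (auto intro!: set_integrable_Ioc iF)
      have ff: "set_integrable lborel {r<..r'} (\<lambda>s. f s * \<phi>' (F s))"
        using r by (auto intro!: set_integrable_Ioc int)
      have "\<phi> (F r') - \<phi> (F r) - (LINT s:{r<..r'}|lborel. f s * \<phi>' (F s))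
        = (LINT s:{r<..r'}|lborel. \<phi>' \<xi> * f s) - (LINT s:{r<..r'}|lborel. f s * \<phi>' (F s))"
        using \<xi>(4) primitive_onD[OF F] r by simp
      also have "\<dots> = (LINT s:{r<..r'}|lborel. \<phi>' \<xi> * f s - f s * \<phi>' (F s))"
        using f' ff by (subst set_integral_diff) auto
      also have "\<bar>\<dots>\<bar> \<le> (LINT s:{r<..r'}|lborel. e * \<bar>f s\<bar>)"
      proof (rule set_integral_abs_bound)
        show "set_integrable lborel {r<..r'} (\<lambda>s. \<phi>' \<xi> * f s - f s * \<phi>' (F s))"
          using f' ff by (intro set_integral_diff set_integrable_mult_right) auto
        show "set_integrable lborel {r<..r'} (\<lambda>s. e * \<bar>f s\<bar>)"
          using f' by (intro set_integrable_mult_right set_integrable_abs) auto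
        fix s assume s: "s \<in> {r<..r'}"
        have "\<phi>' \<xi> * f s - f s * \<phi>' (F s) = (\<phi>' \<xi> - \<phi>' (F s)) * f s"
          by (simp add: algebra_simps)
        then have "\<bar>\<phi>' \<xi> * f s - f s * \<phi>' (F s)\<bar> = \<bar>\<phi>' \<xi> - \<phi>' (F s)\<bar> * \<bar>f s\<bar>" by (simp add: abs_mult)
        also have "\<dots> \<le> e * \<bar>f s\<bar>" using s by (intro mult_right_mono osc) auto
        finally show "\<bar>\<phi>' \<xi> * f s - f s * \<phi>' (F s)\<bar> \<le> e * \<bar>f s\<bar>" .
      qed
      also have "\<dots> = e * (LINT s:{r<..r'}|lborel. \<bar>f s\<bar>)" by (rule set_integral_mult_right')
      finally show "\<bar>\<phi> (F r') - \<phi> (F r) - (LINT s:{r<..r'}|lborel. f s * \<phi>' (F s))\<bar>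
        \<le> e * (LINT s:{r<..r'}|lborel. \<bar>f s\<bar>)" .
    qed (use D in auto)
  qed simp
qed

lemma primitive_on_deriv:
  fixes F f :: "real \<Rightarrow> real"
  assumes d: "\<And>x. a \<le> x \<Longrightarrow> x \<le> b \<Longrightarrow> (F has_real_derivative f x) (at x)"
    and c: "continuous_on {a..b} f"
  shows "primitive_on a b F f"
proof (rule primitive_onI)
  show "set_integrable lborel {a..b} f"
    unfolding set_integrable_def using c by (intro borel_integrable_compact) auto
  fix r r' assume r: "a \<le> r" "r \<le> r'" "r' \<le> b"
  have "F r' - F r = (LINT s:{r..r'}|lborel. f s)"
    unfolding set_lebesgue_integral_def
  proof (rule integral_FTC_Icc[OF r(2), symmetric])
    show "(F has_vector_derivative f x) (at x within {r..r'})" if "r \<le> x" "x \<le> r'" for x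
      using d[of x] r that
      by (auto simp: has_real_derivative_iff_has_vector_derivative[symmetric] intro: DERIV_subset)
    show "continuous_on {r..r'} f" using c by (rule continuous_on_subset) (use r in auto)
  qed
  also have "\<dots> = (LINT s:{r<..r'}|lborel. f s)"
    by (rule set_integral_discrete_difference[of "{r}"]) auto
  finally show "F r' - F r = (LINT s:{r<..r'}|lborel. f s)" .
qed

section \<open>Enclosed mass and the transformed field\<close>

lemma powr_minus_half: "y \<ge> 0 \<Longrightarrow> y powr (- (1/2)) = 1 / sqrt y"
  by (metis inverse_eq_divide powr_half_sqrt powr_minus)

text \<open>Here \<open>w\<close> is the mass per unit radius; for a density rho in space it will be
  4 pi s^2 rho.\<close>

locale mass_function =
  fixes w :: "real \<Rightarrow> real"
  assumes w_borel[measurable]: "w \<in> borel_measurable borel"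
    and w_integrable: "integrable lborel w"
    and w_nonneg: "\<And>s. w s \<ge> 0"
begin

definition mass :: "real \<Rightarrow> real" where
  "mass r = (LINT s:{0<..r}|lborel. w s)"

lemma w_set_integrable: "A \<in> sets borel \<Longrightarrow> set_integrable lborel A w"
  unfolding set_integrable_def using integrable_mult_indicator[OF _ w_integrable] by simp

lemma primitive_on_mass: "0 \<le> a \<Longrightarrow> primitive_on a b mass w"
proof (rule primitive_onI)
  show "set_integrable lborel {a..b} w" by (rule w_set_integrable) simp
  fix r r' assume "0 \<le> a" "a \<le> r" "r \<le> r'" "r' \<le> b"
  then show "mass r' - mass r = (LINT s:{r<..r'}|lborel. w s)"
    unfolding mass_def by (subst set_integral_Ioc_combine[of 0 r' w 0 r r']) (auto intro: w_set_integrable)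
qed

lemma mass_nonneg: "mass r \<ge> 0"
  unfolding mass_def set_lebesgue_integral_def by (intro integral_nonneg_AE AE_I2) (simp add: w_nonneg)

lemma mass_mono: "r \<le> r' \<Longrightarrow> mass r \<le> mass r'"
  unfolding mass_def set_lebesgue_integral_def
  using w_set_integrable unfolding set_integrable_def
  by (intro integral_mono) (auto split: split_indicator simp: w_nonneg)

definition total_mass :: real where "total_mass = (LINT s|lborel. w s)"

lemma mass_le_total: "mass r \<le> total_mass"
  unfolding mass_def set_lebesgue_integral_def total_mass_def
  using w_set_integrable w_integrable unfolding set_integrable_def
  by (intro integral_mono) (auto split: split_indicator simp: w_nonneg)

lemma total_mass_nonneg: "total_mass \<ge> 0"
  using mass_nonneg mass_le_total order_trans by blast

lemma mass_borel[measurable]: "mass \<in> borel_measurable borel"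
  by (rule borel_measurable_mono) (simp add: mono_def mass_mono)

lemma primitive_on_mass_powr:
  assumes e: "e > 0" and \<sigma>: "\<sigma> < 1" and a: "0 \<le> a"
  shows "primitive_on a b (\<lambda>s. (mass s + e) powr (1 - \<sigma>) / (1 - \<sigma>)) (\<lambda>s. w s * (mass s + e) powr (- \<sigma>))"
proof (rule primitive_on_compose[OF primitive_on_mass[OF a], where S = "{-e<..}"])
  show "((\<lambda>y. (y + e) powr (1 - \<sigma>) / (1 - \<sigma>)) has_real_derivative (y + e) powr (- \<sigma>)) (at y)"
    if "y \<in> {-e<..}" for y
  proof -
    have "y + e > 0" using that by simp
    then have "((\<lambda>y. (y + e) powr (1 - \<sigma>)) has_real_derivative
        (1 - \<sigma>) * (y + e) powr (1 - \<sigma> - of_nat 1) * 1) (at y)"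
      by (intro DERIV_fun_powr) (auto intro!: derivative_eq_intros)
    from DERIV_cdivide[OF this, of "1 - \<sigma>"] show ?thesis using \<sigma> by simp
  qed
  show "continuous_on {-e<..} (\<lambda>y. (y + e) powr (- \<sigma>))"
    by (intro continuous_intros) auto
  show "mass ` {a..b} \<subseteq> {-e<..}"
    using mass_nonneg e by (auto intro: less_le_trans[of _ 0])
qed (rule is_interval_oi)

lemma integral_mass_powr_shift:
  assumes "e > 0" "\<sigma> < 1" "0 \<le> r"
  shows "set_integrable lborel {0<..r} (\<lambda>s. w s * (mass s + e) powr (- \<sigma>))"
    "(LINT s:{0<..r}|lborel. w s * (mass s + e) powr (- \<sigma>)) \<le> (mass r + e) powr (1 - \<sigma>) / (1 - \<sigma>)"
proof -
  note p = primitive_on_mass_powr[OF assms(1,2) order_refl, of r]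
  show "set_integrable lborel {0<..r} (\<lambda>s. w s * (mass s + e) powr (- \<sigma>))"
    by (rule set_integrable_Ioc[OF primitive_on_integrable[OF p]]) auto
  have "(LINT s:{0<..r}|lborel. w s * (mass s + e) powr (- \<sigma>))
    = (mass r + e) powr (1 - \<sigma>) / (1 - \<sigma>) - (mass 0 + e) powr (1 - \<sigma>) / (1 - \<sigma>)"
    using primitive_onD[OF p, of 0 r] assms by simp
  also have "\<dots> \<le> (mass r + e) powr (1 - \<sigma>) / (1 - \<sigma>)" using assms by simp
  finally show "(LINT s:{0<..r}|lborel. w s * (mass s + e) powr (- \<sigma>)) \<le> (mass r + e) powr (1 - \<sigma>) / (1 - \<sigma>)" .
qed

text \<open>Formally the integrand is the derivative of mass^(1 - \<sigma>) / (1 - \<sigma>). The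
  shift by \<open>e n\<close> makes this rigorous where the mass vanishes, and Fatou's lemma removes
  the shift.\<close>

lemma nn_integral_mass_powr:
  assumes \<sigma>: "\<sigma> < 1" and r: "0 \<le> r"
  shows "(\<integral>\<^sup>+s. ennreal (indicator {0<..r} s * (w s * mass s powr (- \<sigma>))) \<partial>lborel)
    \<le> ennreal (mass r powr (1 - \<sigma>) / (1 - \<sigma>))"
proof -
  define e where "e n = inverse (real (Suc n))" for n
  have e: "e n > 0" for n by (simp add: e_def)
  have e0: "e \<longlonglongrightarrow> 0" unfolding e_def by (rule LIMSEQ_inverse_real_of_nat)
  define u where "u n s = ennreal (indicator {0<..r} s * (w s * (mass s + e n) powr (- \<sigma>)))" for n s
  have [measurable]: "u n \<in> borel_measurable borel" for n unfolding u_def by measurable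
  have "(\<integral>\<^sup>+s. ennreal (indicator {0<..r} s * (w s * mass s powr (- \<sigma>))) \<partial>lborel)
    \<le> (\<integral>\<^sup>+s. liminf (\<lambda>n. u n s) \<partial>lborel)"
  proof (rule nn_integral_mono)
    fix s
    show "ennreal (indicator {0<..r} s * (w s * mass s powr (- \<sigma>))) \<le> liminf (\<lambda>n. u n s)"
    \<comment> \<open>Where the mass is 0 the left side is 0, because \<open>0 powr x\<close> is 0;
      elsewhere the shifted integrands converge.\<close>
    proof (cases "mass s = 0")
      case False
      have "(\<lambda>n. u n s) \<longlonglongrightarrow> ennreal (indicator {0<..r} s * (w s * (mass s + 0) powr (- \<sigma>)))"
        unfolding u_def using False by (intro tendsto_intros tendsto_ennrealI e0) auto
      then show ?thesis by (simp add: lim_imp_Liminf)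
    qed simp
  qed
  also have "\<dots> \<le> liminf (\<lambda>n. \<integral>\<^sup>+s. u n s \<partial>lborel)"
    by (rule nn_integral_liminf) simp
  also have "\<dots> \<le> liminf (\<lambda>n. ennreal ((mass r + e n) powr (1 - \<sigma>) / (1 - \<sigma>)))"
  proof (rule Liminf_mono, rule always_eventually, rule allI)
    fix n
    have "(\<integral>\<^sup>+s. u n s \<partial>lborel) = ennreal (LINT s:{0<..r}|lborel. w s * (mass s + e n) powr (- \<sigma>))"
      unfolding u_def set_lebesgue_integral_def
      using integral_mass_powr_shift(1)[OF e \<sigma> r, of n]
      by (subst nn_integral_eq_integral) (auto simp: set_integrable_def w_nonneg)
    also have "\<dots> \<le> ennreal ((mass r + e n) powr (1 - \<sigma>) / (1 - \<sigma>))"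
      by (intro ennreal_leI integral_mass_powr_shift(2) e \<sigma> r)
    finally show "(\<integral>\<^sup>+s. u n s \<partial>lborel) \<le> ennreal ((mass r + e n) powr (1 - \<sigma>) / (1 - \<sigma>))" .
  qed
  also have "\<dots> = ennreal ((mass r + 0) powr (1 - \<sigma>) / (1 - \<sigma>))"
  proof (rule lim_imp_Liminf)
    show "(\<lambda>n. ennreal ((mass r + e n) powr (1 - \<sigma>) / (1 - \<sigma>))) \<longlonglongrightarrow>
      ennreal ((mass r + 0) powr (1 - \<sigma>) / (1 - \<sigma>))"
    proof -
      have "(\<lambda>n. (mass r + e n) powr (1 - \<sigma>)) \<longlonglongrightarrow> (mass r + 0) powr (1 - \<sigma>)"
      proof (rule tendsto_powr2)
        show "\<forall>\<^sub>F n in sequentially. 0 \<le> mass r + e n"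
          using mass_nonneg[of r] e by (intro always_eventually allI add_nonneg_nonneg) (auto simp: less_imp_le)
        show "(\<lambda>n. mass r + e n) \<longlonglongrightarrow> mass r + 0" by (intro tendsto_intros e0)
      qed (use \<sigma> in auto)
      then show ?thesis using \<sigma> by (intro tendsto_ennrealI tendsto_divide tendsto_const) auto
    qed
  qed simp
  finally show ?thesis by simp
qed

lemma mass_powr_integrable:
  assumes \<sigma>: "\<sigma> < 1" and r: "0 \<le> r"
  shows "set_integrable lborel {0<..r} (\<lambda>s. w s * mass s powr (- \<sigma>))"
    "(LINT s:{0<..r}|lborel. w s * mass s powr (- \<sigma>)) \<le> mass r powr (1 - \<sigma>) / (1 - \<sigma>)"
proof -
  have nn: "(\<integral>\<^sup>+s. ennreal (indicator {0<..r} s *\<^sub>R (w s * mass s powr (- \<sigma>))) \<partial>lborel)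
    \<le> ennreal (mass r powr (1 - \<sigma>) / (1 - \<sigma>))"
    using nn_integral_mass_powr[OF assms] by simp
  have I: "integrable lborel (\<lambda>s. indicator {0<..r} s *\<^sub>R (w s * mass s powr (- \<sigma>)))"
  proof (rule integrableI_nonneg)
    show "(\<integral>\<^sup>+s. ennreal (indicator {0<..r} s *\<^sub>R (w s * mass s powr (- \<sigma>))) \<partial>lborel) < \<infinity>"
      using nn by (rule order.strict_trans1) simp
  qed (auto simp: w_nonneg)
  then show "set_integrable lborel {0<..r} (\<lambda>s. w s * mass s powr (- \<sigma>))"
    by (simp add: set_integrable_def)
  have "ennreal (LINT s:{0<..r}|lborel. w s * mass s powr (- \<sigma>)) \<le> ennreal (mass r powr (1 - \<sigma>) / (1 - \<sigma>))"
    using nn unfolding set_lebesgue_integral_def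
    by (subst (asm) nn_integral_eq_integral[OF I]) (auto simp: w_nonneg)
  then show "(LINT s:{0<..r}|lborel. w s * mass s powr (- \<sigma>)) \<le> mass r powr (1 - \<sigma>) / (1 - \<sigma>)"
    using \<sigma> by (subst (asm) ennreal_le_iff) auto
qed

text \<open>On the radii of zero mass the shifted integrand with exponent 1/2 is
  \<open>w s / sqrt e\<close>, while its integral stays bounded as e tends to 0. So \<open>w\<close>
  has integral of order sqrt e there, that is 0. This settles the radii where \<open>\<mu>'\<close>
  would be evaluated at its singularity.\<close>

lemma AE_density_eq_0: "AE s in lborel. 0 < s \<longrightarrow> mass s = 0 \<longrightarrow> w s = 0"
proof -
  have *: "AE s in lborel. s \<in> {0<..r} \<longrightarrow> mass s = 0 \<longrightarrow> w s = 0" if r: "0 \<le> r" for r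
  proof -
    define v where "v s = indicator {0<..r} s * (if mass s = 0 then w s else 0)" for s
    have v0: "v s \<ge> 0" for s by (simp add: v_def w_nonneg)
    have [measurable]: "v \<in> borel_measurable borel" unfolding v_def by measurable
    have v: "integrable lborel v"
      by (rule Bochner_Integration.integrable_bound[OF w_integrable])
        (auto simp: v_def w_nonneg split: split_indicator)
    have bd: "(LINT s|lborel. v s) \<le> sqrt e * (2 * sqrt (total_mass + 1))" if e: "0 < e" "e \<le> 1" for e
    proof -
      have "e powr (- (1/2)) * (LINT s|lborel. v s) = (LINT s|lborel. e powr (- (1/2)) * v s)"
        by simp
      also have "\<dots> \<le> (LINT s:{0<..r}|lborel. w s * (mass s + e) powr (- (1/2)))"
        unfolding set_lebesgue_integral_def
      proof (rule integral_mono)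
        show "integrable lborel (\<lambda>s. indicator {0<..r} s *\<^sub>R (w s * (mass s + e) powr (- (1/2))))"
          using integral_mass_powr_shift(1)[OF e(1) _ r, of "1/2"] by (simp add: set_integrable_def)
        show "integrable lborel (\<lambda>s. e powr (- (1/2)) * v s)" using v by (rule integrable_mult_right)
      qed (auto simp: v_def w_nonneg split: split_indicator)
      also have "\<dots> \<le> (mass r + e) powr (1 - 1/2) / (1 - 1/2)"
        by (rule integral_mass_powr_shift(2)) (use e r in auto)
      also have "\<dots> = 2 * sqrt (mass r + e)"
        using mass_nonneg[of r] e by (simp add: powr_half_sqrt)
      also have "\<dots> \<le> 2 * sqrt (total_mass + 1)"
        using mass_le_total[of r] e by simp
      finally have *: "e powr (- (1/2)) * (LINT s|lborel. v s) \<le> 2 * sqrt (total_mass + 1)" .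
      have "e powr (- (1/2)) = 1 / sqrt e"
        using e by (intro powr_minus_half) simp
      with * have "(LINT s|lborel. v s) / sqrt e \<le> 2 * sqrt (total_mass + 1)" by simp
      then show ?thesis using e by (simp add: pos_divide_le_eq mult.commute)
    qed
    have "(\<lambda>n. sqrt (inverse (real (Suc n))) * (2 * sqrt (total_mass + 1))) \<longlonglongrightarrow> sqrt 0 * (2 * sqrt (total_mass + 1))"
      by (intro tendsto_intros LIMSEQ_inverse_real_of_nat)
    moreover have "(LINT s|lborel. v s) \<le> sqrt (inverse (real (Suc n))) * (2 * sqrt (total_mass + 1))" for n
      by (rule bd) (auto simp: divide_simps)
    ultimately have "(LINT s|lborel. v s) \<le> sqrt 0 * (2 * sqrt (total_mass + 1))"
      by (intro LIMSEQ_le_const) auto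
    then have "(LINT s|lborel. v s) = 0"
      by (intro antisym Bochner_Integration.integral_nonneg) (simp_all add: v0)
    then have "AE s in lborel. v s = 0"
      using integral_nonneg_eq_0_iff_AE[OF v] v0 by auto
    then show ?thesis by eventually_elim (auto simp: v_def)
  qed
  have "AE s in lborel. \<forall>n::nat. s \<in> {0<..real n} \<longrightarrow> mass s = 0 \<longrightarrow> w s = 0"
    by (subst AE_all_countable, intro allI * of_nat_0_le_iff)
  then show ?thesis
  proof eventually_elim
    case (elim s)
    obtain n :: nat where "s \<le> real n" using real_arch_simple by blast
    with elim show ?case by auto
  qed
qed

end

section \<open>The radial profile of the transformed field and its derivative\<close>

locale radial_flow = mass_function +
  fixes \<mu> \<mu>' :: "real \<Rightarrow> real" and L :: real
  assumes \<mu>_borel[measurable]: "\<mu> \<in> borel_measurable borel" "\<mu>' \<in> borel_measurable borel"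
    and \<mu>_deriv: "\<And>y. y > 0 \<Longrightarrow> (\<mu> has_real_derivative \<mu>' y) (at y)"
    and \<mu>'_cont: "continuous_on {0<..} \<mu>'"
    and \<mu>_bound: "\<And>y. y \<ge> 0 \<Longrightarrow> \<bar>\<mu> y\<bar> \<le> L * sqrt y"
    and \<mu>'_bound: "\<And>y. y \<ge> 0 \<Longrightarrow> \<bar>\<mu>' y\<bar> \<le> L / sqrt y"
begin

definition field :: "real \<Rightarrow> real" where "field s = mass s / s ^ 2"

definition profile :: "real \<Rightarrow> real" where "profile s = \<mu> (field s) / s"

text \<open>The formal derivative of \<open>profile\<close> by the chain and quotient rules, with
  \<open>w\<close> standing for the derivative of \<open>mass\<close>.\<close>

definition profile' :: "real \<Rightarrow> real" where
  "profile' s = (w s / s ^ 2 - 2 * mass s / s ^ 3) * \<mu>' (field s) / s - \<mu> (field s) / s ^ 2"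

lemma L_nonneg: "L \<ge> 0"
  using \<mu>_bound[of 1] by simp

text \<open>At 0 the bound on \<open>\<mu>'\<close> reads L / 0, which is 0. The derivative of
  \<open>\<mu>\<close> itself is only postulated at positive arguments.\<close>

lemma \<mu>_0: "\<mu> 0 = 0" and \<mu>'_0: "\<mu>' 0 = 0"
  using \<mu>_bound[of 0] \<mu>'_bound[of 0] by auto

lemma field_borel[measurable]: "field \<in> borel_measurable borel"
  unfolding field_def by measurable

lemma profile_borel[measurable]: "profile \<in> borel_measurable borel" "profile' \<in> borel_measurable borel"
  unfolding profile_def profile'_def by measurable

lemma field_nonneg: "field s \<ge> 0"
  by (simp add: field_def mass_nonneg)

lemma sqrt_field: "s > 0 \<Longrightarrow> sqrt (field s) = sqrt (mass s) / s"
  by (simp add: field_def real_sqrt_divide)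

lemma profile_bound: "s > 0 \<Longrightarrow> \<bar>profile s\<bar> \<le> L * sqrt (mass s) / s ^ 2"
  using \<mu>_bound[OF field_nonneg, of s]
  by (simp add: profile_def sqrt_field field_simps power2_eq_square)

text \<open>For positive mass \<open>\<mu>'\<close> is at most L / sqrt (field s) = L s / sqrt (mass
  s), and increasing the argument by \<open>e\<close> only improves this. So one bound dominates all
  the shifted derivatives. At zero mass either the first factor vanishes or \<open>\<mu>'\<close> is
  taken at 0.\<close>

lemma flow_term_bound:
  assumes s: "s > 0" and e: "e \<ge> 0" and w0: "mass s = 0 \<Longrightarrow> w s = 0 \<or> e = 0"
  shows "\<bar>(w s / s ^ 2 - 2 * mass s / s ^ 3) * \<mu>' (field s + e)\<bar>
    \<le> L * (w s * mass s powr (- (1/2)) / s + 2 * sqrt (mass s) / s ^ 2)"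
proof (cases "mass s = 0")
  case True
  then show ?thesis using w0[OF True] by (auto simp: field_def \<mu>'_0)
next
  case False
  then have M: "mass s > 0" using mass_nonneg[of s] by simp
  have f: "field s > 0" using M s by (simp add: field_def)
  have "\<bar>\<mu>' (field s + e)\<bar> \<le> L / sqrt (field s + e)"
    by (rule \<mu>'_bound) (use f e in auto)
  also have "\<dots> \<le> L / sqrt (field s)"
    using f e L_nonneg by (intro divide_left_mono) auto
  also have "\<dots> = L * s / sqrt (mass s)" using s by (simp add: sqrt_field)
  finally have 1: "\<bar>\<mu>' (field s + e)\<bar> \<le> L * s / sqrt (mass s)" .
  have 2: "\<bar>w s / s ^ 2 - 2 * mass s / s ^ 3\<bar> \<le> w s / s ^ 2 + 2 * mass s / s ^ 3"
    using s M w_nonneg[of s] by (intro abs_leI) (auto simp: add_nonneg_nonneg)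
  have "\<bar>(w s / s ^ 2 - 2 * mass s / s ^ 3) * \<mu>' (field s + e)\<bar>
    \<le> (w s / s ^ 2 + 2 * mass s / s ^ 3) * (L * s / sqrt (mass s))"
    unfolding abs_mult using 1 2 by (intro mult_mono) auto
  also have "\<dots> = L * (w s / sqrt (mass s) / s + 2 * (mass s / sqrt (mass s)) / s ^ 2)"
    using s M by (simp add: field_simps power2_eq_square power3_eq_cube)
  also have "mass s / sqrt (mass s) = sqrt (mass s)" using M by (simp add: real_div_sqrt)
  also have "w s / sqrt (mass s) = w s * mass s powr (- (1/2))"
    using powr_minus_half[of "mass s"] M by simp
  finally show ?thesis .
qed

lemma profile'_bound:
  assumes s: "s > 0"
  shows "\<bar>profile' s\<bar> \<le> L * (w s * mass s powr (- (1/2)) / s ^ 2 + 3 * sqrt (mass s) / s ^ 3)"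
proof -
  have "\<bar>profile' s\<bar> \<le> \<bar>(w s / s ^ 2 - 2 * mass s / s ^ 3) * \<mu>' (field s + 0)\<bar> / s + \<bar>\<mu> (field s)\<bar> / s ^ 2"
    unfolding profile'_def using s by (intro order_trans[OF abs_triangle_ineq4]) (simp add: abs_mult)
  also have "\<dots> \<le> L * (w s * mass s powr (- (1/2)) / s + 2 * sqrt (mass s) / s ^ 2) / s + L * (sqrt (mass s) / s) / s ^ 2"
    using \<mu>_bound[OF field_nonneg, of s] s
    by (intro add_mono divide_right_mono flow_term_bound) (auto simp: sqrt_field)
  also have "\<dots> = L * (w s * mass s powr (- (1/2)) / s ^ 2 + 3 * sqrt (mass s) / s ^ 3)"
    using s by (simp add: field_simps power2_eq_square power3_eq_cube)
  finally show ?thesis .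
qed

text \<open>Since \<open>\<mu>\<close> is not Lipschitz at the origin, the chain rule is applied to a shift by \<open>e\<close>; this
  also covers the radii with vanishing mass.\<close>

lemma primitive_on_profile_shift:
  assumes e: "e > 0" and a: "a > 0"
  shows "primitive_on a b (\<lambda>s. \<mu> (field s + e) / s)
    (\<lambda>s. (w s / s ^ 2 - 2 * mass s / s ^ 3) * \<mu>' (field s + e) / s - \<mu> (field s + e) / s ^ 2)"
proof -
  have inv: "primitive_on a b (\<lambda>s. 1 / s) (\<lambda>s. - (1 / s ^ 2))"
    by (rule primitive_on_deriv)
      (use a in \<open>auto intro!: derivative_eq_intros continuous_intros simp: power2_eq_square field_simps\<close>)
  have inv2: "primitive_on a b (\<lambda>s. 1 / s ^ 2) (\<lambda>s. - (2 / s ^ 3))"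
    by (rule primitive_on_deriv)
      (use a in \<open>auto intro!: derivative_eq_intros continuous_intros simp: power2_eq_square power3_eq_cube field_simps\<close>)
  have f: "primitive_on a b field (\<lambda>s. w s / s ^ 2 - 2 * mass s / s ^ 3)"
    using primitive_on_mult[OF primitive_on_mass inv2] a unfolding field_def by simp
  have "primitive_on a b (\<lambda>s. \<mu> (field s + e)) (\<lambda>s. (w s / s ^ 2 - 2 * mass s / s ^ 3) * \<mu>' (field s + e))"
  proof (rule primitive_on_compose[OF f, where S = "{-e<..}"])
    show "field ` {a..b} \<subseteq> {-e<..}"
      using field_nonneg e by (auto intro: less_le_trans[of _ 0])
    show "((\<lambda>y. \<mu> (y + e)) has_real_derivative \<mu>' (y + e)) (at y)" if "y \<in> {-e<..}" for y
    proof -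
      have "y + e > 0" using that by simp
      from DERIV_shift[THEN iffD1, OF \<mu>_deriv[OF this]] show ?thesis .
    qed
    show "continuous_on {-e<..} (\<lambda>y. \<mu>' (y + e))"
      by (rule continuous_on_compose2[OF \<mu>'_cont]) (auto intro!: continuous_intros)
  qed (rule is_interval_oi)
  from primitive_on_mult[OF this inv] show ?thesis by simp
qed

text \<open>The shift is removed by dominated convergence. The majorant is integrable by
  \<open>mass_powr_integrable\<close> with exponent 1/2, and \<open>AE_density_eq_0\<close> gives
  convergence at radii of zero mass.\<close>

lemma primitive_on_profile:
  assumes a: "a > 0" and ab: "a \<le> b"
  shows "primitive_on a b profile profile'"
proof -
  define e where "e n = inverse (real (Suc n))" for n
  have e: "e n > 0" "e n \<le> 1" for n by (auto simp: e_def field_simps)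
  have e0: "e \<longlonglongrightarrow> 0" unfolding e_def by (rule LIMSEQ_inverse_real_of_nat)
  define h where "h n s = (w s / s ^ 2 - 2 * mass s / s ^ 3) * \<mu>' (field s + e n) / s - \<mu> (field s + e n) / s ^ 2" for n s
  have [measurable]: "h n \<in> borel_measurable borel" for n unfolding h_def by measurable
  \<comment> \<open>A majorant of all \<open>h n\<close> on the interval: \<open>s\<close> is at
    least \<open>a\<close>, the mass at most \<open>total_mass\<close>, and \<open>e n\<close> at
    most 1.\<close>
  define k where "k s = L * (w s * mass s powr (- (1/2))) / a ^ 2 + (2 * L * sqrt total_mass / a ^ 3 + L * sqrt (total_mass / a ^ 2 + 1) / a ^ 2)" for s
  have k: "set_integrable lborel {a..b} k"
  proof -
    have "set_integrable lborel {a..b} (\<lambda>s. w s * mass s powr (- (1/2)))"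
      by (rule set_integrable_subset[OF mass_powr_integrable(1)[of "1/2" b]]) (use a ab in auto)
    moreover have "set_integrable lborel {a..b} (\<lambda>s. c)" for c :: real
      unfolding set_integrable_def by (intro borel_integrable_compact) auto
    ultimately show ?thesis unfolding k_def by (intro set_integral_add) auto
  qed
  \<comment> \<open>At zero field the square-root bound provides the continuity of
    \<open>\<mu>\<close>; at positive field differentiability does.\<close>
  have \<mu>_lim: "(\<lambda>n. \<mu> (field s + e n)) \<longlonglongrightarrow> \<mu> (field s)" for s
  proof (cases "field s = 0")
    case True
    have "(\<lambda>n. L * sqrt (e n)) \<longlonglongrightarrow> L * sqrt 0" by (intro tendsto_intros e0)
    moreover have "\<bar>\<mu> (e n)\<bar> \<le> L * sqrt (e n)" for n using e by (intro \<mu>_bound) (simp add: less_imp_le)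
    ultimately have "(\<lambda>n. \<mu> (e n)) \<longlonglongrightarrow> 0"
      by (intro Lim_null_comparison[of "\<lambda>n. \<mu> (e n)" "\<lambda>n. L * sqrt (e n)"]) auto
    then show ?thesis using True by (simp add: \<mu>_0)
  next
    case False
    then have "isCont \<mu> (field s)" using field_nonneg[of s] by (intro DERIV_isCont[OF \<mu>_deriv]) auto
    moreover have "(\<lambda>n. field s + e n) \<longlonglongrightarrow> field s + 0" by (intro tendsto_intros e0)
    ultimately show ?thesis by (intro isCont_tendsto_compose[of "field s" \<mu>]) auto
  qed
  have lim: "AE s in lborel. s > 0 \<longrightarrow> (\<lambda>n. h n s) \<longlonglongrightarrow> profile' s"
    using AE_density_eq_0
  proof eventually_elim
    case (elim s)
    show ?case
    proof
      assume s: "s > 0"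
      have lim1: "(\<lambda>n. (w s / s ^ 2 - 2 * mass s / s ^ 3) * \<mu>' (field s + e n)) \<longlonglongrightarrow> (w s / s ^ 2 - 2 * mass s / s ^ 3) * \<mu>' (field s)"
      proof (cases "mass s = 0")
        case True
        then show ?thesis using elim s by simp
      next
        case False
        then have "field s > 0" using s mass_nonneg[of s] by (simp add: field_def)
        then have "isCont \<mu>' (field s)"
          using \<mu>'_cont by (simp add: continuous_on_eq_continuous_at)
        moreover have "(\<lambda>n. field s + e n) \<longlonglongrightarrow> field s + 0" by (intro tendsto_intros e0)
        ultimately have "(\<lambda>n. \<mu>' (field s + e n)) \<longlonglongrightarrow> \<mu>' (field s)"
          by (intro isCont_tendsto_compose[of "field s" \<mu>']) auto
        then show ?thesis by (intro tendsto_intros)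
      qed
      show "(\<lambda>n. h n s) \<longlonglongrightarrow> profile' s"
        unfolding h_def profile'_def
        using s by (intro tendsto_diff tendsto_divide tendsto_const \<mu>_lim lim1) auto
    qed
  qed
  have bd: "AE s in lborel. s \<in> {a..b} \<longrightarrow> norm (h n s) \<le> k s" for n
    using AE_density_eq_0
  proof eventually_elim
    case (elim s)
    show ?case
    proof
      assume sab: "s \<in> {a..b}"
      then have s: "s > 0" "s \<ge> a" using a by auto
      have M: "mass s \<ge> 0" "mass s \<le> total_mass" by (rule mass_nonneg, rule mass_le_total)
      have f: "field s \<le> total_mass / a ^ 2"
        unfolding field_def using M a s by (intro frac_le power_mono) auto
      have "\<bar>h n s\<bar> \<le> \<bar>(w s / s ^ 2 - 2 * mass s / s ^ 3) * \<mu>' (field s + e n)\<bar> / s + \<bar>\<mu> (field s + e n)\<bar> / s ^ 2"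
        unfolding h_def using s by (intro order_trans[OF abs_triangle_ineq4]) (simp add: abs_mult)
      also have "\<dots> \<le> L * (w s * mass s powr (- (1/2)) / s + 2 * sqrt (mass s) / s ^ 2) / s + L * sqrt (field s + e n) / s ^ 2"
        using s e[of n] field_nonneg[of s] elim
        by (intro add_mono divide_right_mono flow_term_bound \<mu>_bound) auto
      also have "\<dots> = L * (w s * mass s powr (- (1/2))) / s ^ 2 + (2 * L * sqrt (mass s) / s ^ 3 + L * sqrt (field s + e n) / s ^ 2)"
        using s by (simp add: field_simps power2_eq_square power3_eq_cube)
      also have "\<dots> \<le> k s"
        unfolding k_def using s a M L_nonneg f e[of n] field_nonneg[of s] w_nonneg[of s]
        by (intro add_mono frac_le mult_left_mono mult_nonneg_nonneg power_mono real_sqrt_le_mono) auto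
      finally show "norm (h n s) \<le> k s" by simp
    qed
  qed
  show ?thesis
  proof (rule primitive_onI)
    show "set_integrable lborel {a..b} profile'"
      unfolding set_integrable_def
    proof (rule integrable_dominated_convergence[where w = "\<lambda>s. indicator {a..b} s *\<^sub>R k s" and s = "\<lambda>n s. indicator {a..b} s *\<^sub>R h n s"])
      show "AE s in lborel. (\<lambda>n. indicator {a..b} s *\<^sub>R h n s) \<longlonglongrightarrow> indicator {a..b} s *\<^sub>R profile' s"
        using lim by eventually_elim (use a in \<open>auto simp: indicator_def\<close>)
      show "AE s in lborel. norm (indicator {a..b} s *\<^sub>R h n s) \<le> indicator {a..b} s *\<^sub>R k s" for n
        using bd[of n] by eventually_elim (auto simp: indicator_def)
    qed (use k in \<open>auto simp: set_integrable_def\<close>)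
    fix r r' assume r: "a \<le> r" "r \<le> r'" "r' \<le> b"
    have "(\<lambda>n. LINT s:{r<..r'}|lborel. h n s) \<longlonglongrightarrow> (LINT s:{r<..r'}|lborel. profile' s)"
      unfolding set_lebesgue_integral_def
    proof (rule integral_dominated_convergence[where w = "\<lambda>s. indicator {r<..r'} s *\<^sub>R k s"])
      show "AE s in lborel. (\<lambda>n. indicator {r<..r'} s *\<^sub>R h n s) \<longlonglongrightarrow> indicator {r<..r'} s *\<^sub>R profile' s"
        using lim by eventually_elim (use a r in \<open>auto simp: indicator_def\<close>)
      show "AE s in lborel. norm (indicator {r<..r'} s *\<^sub>R h n s) \<le> indicator {r<..r'} s *\<^sub>R k s" for n
        using bd[of n] by eventually_elim (use r in \<open>auto simp: indicator_def\<close>)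
    qed (use set_integrable_Ioc[OF k r(1,3)] in \<open>auto simp: set_integrable_def\<close>)
    moreover have "(LINT s:{r<..r'}|lborel. h n s) = \<mu> (field r' + e n) / r' - \<mu> (field r + e n) / r" for n
      unfolding h_def using primitive_onD[OF primitive_on_profile_shift[OF e(1) a] r] by simp
    moreover have "(\<lambda>n. \<mu> (field r' + e n) / r' - \<mu> (field r + e n) / r) \<longlonglongrightarrow> profile r' - profile r"
      unfolding profile_def using a r by (intro tendsto_intros \<mu>_lim) auto
    ultimately show "profile r' - profile r = (LINT s:{r<..r'}|lborel. profile' s)"
      using LIMSEQ_unique by simp
  qed
qed

text \<open>The weight s^3 is the growth of the volume of balls. This is the integrability at the
  origin that Fubini's theorem requires in \<open>radial_integral_by_parts\<close>.\<close>

lemma profile'_cube_integrable: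
  assumes b: "b \<ge> 0"
  shows "set_integrable lborel {0<..b} (\<lambda>s. s ^ 3 * profile' s)"
proof -
  have c: "set_integrable lborel {0<..b} (\<lambda>s. c)" for c :: real
  proof (rule set_integrable_subset[of _ "{0..b}"])
    show "set_integrable lborel {0..b} (\<lambda>s. c)"
      unfolding set_integrable_def by (intro borel_integrable_compact) auto
  qed auto
  have "set_integrable lborel {0<..b} (\<lambda>s. (L * b) * (w s * mass s powr (- (1/2))) + L * (3 * sqrt total_mass))"
    using mass_powr_integrable(1)[of "1/2" b] b c by (intro set_integral_add set_integrable_mult_right) auto
  then show ?thesis
  proof (rule set_integrable_bound)
    show "set_borel_measurable lborel {0<..b} (\<lambda>s. s ^ 3 * profile' s)"
      by (simp add: set_borel_measurable_def)
    show "AE s in lborel. s \<in> {0<..b} \<longrightarrow> norm (s ^ 3 * profile' s)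
      \<le> norm ((L * b) * (w s * mass s powr (- (1/2))) + L * (3 * sqrt total_mass))"
    proof (intro AE_I2 impI)
      fix s assume s: "s \<in> {0<..b}"
      then have s0: "s > 0" by simp
      have "norm (s ^ 3 * profile' s) = s ^ 3 * \<bar>profile' s\<bar>" using s0 by (simp add: abs_mult)
      also have "\<dots> \<le> s ^ 3 * (L * (w s * mass s powr (- (1/2)) / s ^ 2 + 3 * sqrt (mass s) / s ^ 3))"
        using s0 by (intro mult_left_mono profile'_bound) auto
      also have "\<dots> = (L * s) * (w s * mass s powr (- (1/2))) + L * (3 * sqrt (mass s))"
        using s0 by (simp add: field_simps power2_eq_square power3_eq_cube)
      also have "\<dots> \<le> (L * b) * (w s * mass s powr (- (1/2))) + L * (3 * sqrt total_mass)"
        using s L_nonneg w_nonneg[of s] mass_le_total[of s]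
        by (intro add_mono mult_right_mono mult_left_mono real_sqrt_le_mono) auto
      finally show "norm (s ^ 3 * profile' s)
        \<le> norm ((L * b) * (w s * mass s powr (- (1/2))) + L * (3 * sqrt total_mass))" by simp
    qed
  qed
qed

end

section \<open>Integration by parts for radial functions\<close>

lemma AE_norm_neq: "AE x in lborel. norm (x::'a::euclidean_space) \<noteq> c"
proof -
  have "negligible (sphere (0::'a) c)" by (rule negligible_sphere)
  moreover have "sphere (0::'a) c \<in> sets borel" by simp
  ultimately have "sphere (0::'a) c \<in> null_sets lborel"
    by (simp add: negligible_iff_null_sets null_sets_completion_iff)
  from AE_not_in[OF this] show ?thesis by simp
qed

lemma has_real_derivative_norm_line:
  fixes x e :: "'a::euclidean_space"
  assumes "x \<noteq> 0"
  shows "((\<lambda>t. norm (x + t *\<^sub>R e)) has_real_derivative (e \<bullet> x) / norm x) (at 0)"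
proof -
  have 1: "((\<lambda>t. x + t *\<^sub>R e) has_derivative (\<lambda>t. t *\<^sub>R e)) (at 0)"
    by (auto intro!: derivative_eq_intros)
  have "(norm has_derivative (\<lambda>h. h \<bullet> sgn x)) (at (x + 0 *\<^sub>R e))"
    using has_derivative_norm[OF assms] by simp
  from has_derivative_compose[OF 1 this]
  have "((\<lambda>t. norm (x + t *\<^sub>R e)) has_derivative (\<lambda>t. (t *\<^sub>R e) \<bullet> sgn x)) (at 0)" .
  then show ?thesis
    unfolding has_field_derivative_def
    by (rule has_derivative_eq_rhs) (simp add: fun_eq_iff sgn_div_norm field_simps)
qed

text \<open>A Lipschitz substitute for the indicator of the ball of radius \<open>s\<close>; its
  slope turns integrals over spheres into averages over a shell of width \<open>h\<close>.\<close>

definition ramp :: "real \<Rightarrow> real \<Rightarrow> real \<Rightarrow> real" where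
  "ramp s h t = max 0 (min 1 ((s + h - t) / h))"

lemma ramp_lipschitz: "h > 0 \<Longrightarrow> (1 / h)-lipschitz_on UNIV (ramp s h)"
proof (rule lipschitz_onI)
  fix x y :: real assume h: "h > 0"
  have "\<bar>ramp s h x - ramp s h y\<bar> \<le> \<bar>(s + h - x) / h - (s + h - y) / h\<bar>"
    unfolding ramp_def by (simp add: max_def min_def)
  also have "(s + h - x) / h - (s + h - y) / h = (y - x) / h" by (simp add: diff_divide_distrib)
  finally show "dist (ramp s h x) (ramp s h y) \<le> 1 / h * dist x y"
    using h by (simp add: dist_real_def abs_minus_commute)
qed simp

lemma ramp_borel[measurable]: "ramp s h \<in> borel_measurable borel"
  unfolding ramp_def by measurable

lemma ramp_bounds: "0 \<le> ramp s h t" "ramp s h t \<le> 1"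
  by (auto simp: ramp_def)

lemma ramp_eq_0: "h > 0 \<Longrightarrow> s + h \<le> t \<Longrightarrow> ramp s h t = 0"
  using divide_nonpos_pos[of "s + h - t" h] by (simp add: ramp_def)

lemma ramp_eq_1: "h > 0 \<Longrightarrow> t \<le> s \<Longrightarrow> ramp s h t = 1"
  by (simp add: ramp_def min_def field_simps)

lemma ramp_between: "h > 0 \<Longrightarrow> s \<le> t \<Longrightarrow> t \<le> s + h \<Longrightarrow> ramp s h t = (s + h - t) / h"
  by (simp add: ramp_def min_def max_def field_simps)

lemma ramp_has_derivative:
  assumes h: "h > 0" and t: "t \<noteq> s" "t \<noteq> s + h"
  shows "(ramp s h has_real_derivative - indicator {s<..<s + h} t / h) (at t)"
proof -
  consider "t < s" | "s < t" "t < s + h" | "s + h < t" using t by linarith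
  then show ?thesis
  proof cases
    case 1
    have "((\<lambda>t. 1) has_real_derivative 0) (at t)" by simp
    moreover have "\<forall>\<^sub>F x in nhds t. (\<lambda>t. 1) x = ramp s h x"
      using eventually_nhds_in_open[of "{..<s}" t] 1
      by (auto elim!: eventually_mono simp: ramp_eq_1[OF h])
    ultimately have "(ramp s h has_real_derivative 0) (at t)"
      using DERIV_cong_ev by fastforce
    then show ?thesis using 1 by simp
  next
    case 2
    have "((\<lambda>t. (s + h - t) / h) has_real_derivative - (1 / h)) (at t)"
      using h by (auto intro!: derivative_eq_intros)
    moreover have "\<forall>\<^sub>F x in nhds t. (s + h - x) / h = ramp s h x"
      using eventually_nhds_in_open[of "{s<..<s + h}" t] 2
      by (auto elim!: eventually_mono simp: ramp_between[OF h])
    ultimately have "(ramp s h has_real_derivative - (1 / h)) (at t)"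
      using DERIV_cong_ev by fastforce
    then show ?thesis using 2 by simp
  next
    case 3
    have "((\<lambda>t. 0) has_real_derivative 0) (at t)" by simp
    moreover have "\<forall>\<^sub>F x in nhds t. (\<lambda>t. 0) x = ramp s h x"
      using eventually_nhds_in_open[of "{s + h<..}" t] 3
      by (auto elim!: eventually_mono simp: ramp_eq_0[OF h])
    ultimately have "(ramp s h has_real_derivative 0) (at t)"
      using DERIV_cong_ev by fastforce
    then show ?thesis using 3 by simp
  qed
qed

text \<open>Along a line, both factors are differentiable off two spheres and the origin.\<close>

lemma integral_ramp_parts:
  fixes \<psi> \<psi>' :: "'a::euclidean_space \<Rightarrow> real"
  assumes \<psi>: "lipschitz_on_balls \<psi>"
    and d: "AE x in lborel. ((\<lambda>t. \<psi> (x + t *\<^sub>R e)) has_real_derivative \<psi>' x) (at 0)"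
    and [measurable]: "\<psi>' \<in> borel_measurable borel"
    and h: "h > 0"
  shows "(LINT x|lborel. \<psi>' x * ramp s h (norm x) - \<psi> x * (indicator {s<..<s + h} (norm x) / h * ((e \<bullet> x) / norm x))) = 0"
proof -
  have lip: "lipschitz_on_balls (\<lambda>x. \<psi> x * ramp s h (norm x))"
    using lipschitz_on_balls_norm_diff[of "0::'a"]
    by (intro lipschitz_on_balls_mult \<psi> lipschitz_on_balls_compose[OF ramp_lipschitz[OF h]]) simp
  have [measurable]: "\<psi> \<in> borel_measurable borel"
    by (rule borel_measurable_continuous_onI[OF continuous_lipschitz_on_balls[OF \<psi>]])
  have supp: "\<psi> x * ramp s h (norm x) = 0" if "norm x > s + h" for x
    using that by (simp add: ramp_eq_0[OF h])
  have "AE x in lborel. ((\<lambda>t. \<psi> (x + t *\<^sub>R e) * ramp s h (norm (x + t *\<^sub>R e))) has_real_derivative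
    \<psi>' x * ramp s h (norm x) - \<psi> x * (indicator {s<..<s + h} (norm x) / h * ((e \<bullet> x) / norm x))) (at 0)"
    using d AE_norm_neq[of 0] AE_norm_neq[of s] AE_norm_neq[of "s + h"]
  proof eventually_elim
    case (elim x)
    have "((\<lambda>t. ramp s h (norm (x + t *\<^sub>R e))) has_real_derivative
      (- indicator {s<..<s + h} (norm x) / h) * ((e \<bullet> x) / norm x)) (at 0)"
      using elim ramp_has_derivative[OF h, of "norm (x + 0 *\<^sub>R e)" s]
      by (intro DERIV_chain2[of "ramp s h"] has_real_derivative_norm_line) auto
    from DERIV_mult[OF elim(1) this] show ?case
      by (simp add: algebra_simps)
  qed
  note * = integral_deriv_eq_0[OF lip supp this]
  show ?thesis by (rule *(2)) simp_all
qed

lemma integrable_bounded_support: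
  fixes f :: "'a::euclidean_space \<Rightarrow> real"
  assumes "f \<in> borel_measurable borel" "\<And>x. norm x \<le> r \<Longrightarrow> \<bar>f x\<bar> \<le> B" "\<And>x. norm x > r \<Longrightarrow> f x = 0"
  shows "integrable lborel f"
proof (rule Bochner_Integration.integrable_bound)
  show "integrable lborel (\<lambda>x::'a. indicator (cball 0 r) x *\<^sub>R B)"
    by (intro integrable_scaleR_left integrable_real_indicator) (auto simp: emeasure_cball_less_top)
  show "AE x in lborel. norm (f x) \<le> norm (indicator (cball 0 r) x *\<^sub>R B)"
    using assms(2,3) by (intro AE_I2) (force simp: indicator_def)
qed (use assms in simp)

text \<open>Extended by 0, the function has integral 0 over every half-line. Half-lines are stable
  under intersection and generate the Borel sets, so the integral over every Borel set is 0.\<close>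

lemma AE_eq_0_if_interval_integrals_0:
  fixes f :: "real \<Rightarrow> real"
  assumes f: "set_integrable lborel {a..b} f"
    and z: "\<And>r r'. a \<le> r \<Longrightarrow> r \<le> r' \<Longrightarrow> r' \<le> b \<Longrightarrow> (LINT s:{r<..r'}|lborel. f s) = 0"
  shows "AE s in lborel. s \<in> {a<..b} \<longrightarrow> f s = 0"
proof -
  define g where "g s = indicator {a<..b} s *\<^sub>R f s" for s
  have gi: "integrable lborel g"
    using set_integrable_Ioc[OF f, of a b] by (simp add: g_def[abs_def] set_integrable_def)
  have gA: "set_integrable lborel A g" if "A \<in> sets borel" for A
    using that integrable_mult_indicator[OF _ gi] by (simp add: set_integrable_def)
  have "(LINT s:A|lborel. g s) = 0" if "A \<in> sets lborel" for A
  proof -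
    have "Int_stable (range (\<lambda>x::real. {..x}))" by (auto simp: Int_stable_def)
    moreover have "range (\<lambda>x::real. {..x}) \<subseteq> Pow UNIV" by simp
    moreover have "A \<in> sigma_sets UNIV (range (\<lambda>x::real. {..x}))"
      using that by (simp add: borel_eq_atMost)
    ultimately show ?thesis
    proof (induction rule: sigma_sets_induct_disjoint)
      case (basic A)
      then obtain x where A: "A = {..x}" by auto
      have "(LINT s:A|lborel. g s) = (LINT s:{a<..min x b}|lborel. f s)"
        unfolding set_lebesgue_integral_def A g_def
        by (intro Bochner_Integration.integral_cong) (auto simp: indicator_def)
      also have "\<dots> = 0"
      proof (cases "a \<le> min x b")
        case True
        then show ?thesis by (intro z) auto
      next
        case False
        then have "{a<..min x b} = {}" by auto
        then show ?thesis by (simp only: set_lebesgue_integral_def) simp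
      qed
      finally show ?case .
    next
      case empty
      then show ?case by (simp add: set_lebesgue_integral_def)
    next
      case (compl A)
      then have [measurable]: "A \<in> sets borel" by (simp add: borel_eq_atMost)
      have tot: "(LINT s|lborel. g s) = 0"
      proof (cases "a \<le> b")
        case True
        then show ?thesis using z[of a b] by (simp add: g_def set_lebesgue_integral_def)
      qed (simp add: g_def)
      have "(LINT s|lborel. g s) = (LINT s:(A \<union> (UNIV - A))|lborel. g s)"
        by (simp add: set_lebesgue_integral_def)
      also have "\<dots> = (LINT s:A|lborel. g s) + (LINT s:(UNIV - A)|lborel. g s)"
        by (intro set_integral_Un gA) auto
      finally show ?case using tot compl by simp
    next
      case (union A)
      then have m: "A i \<in> sets borel" for i using union(2) by (auto simp: borel_eq_atMost)
      have "(LINT s:(\<Union>i. A i)|lborel. g s) = (\<Sum>i. LINT s:A i|lborel. g s)"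
        using union(1) m by (intro lebesgue_integral_countable_add gA) (auto simp: disjoint_family_on_def)
      then show ?case using union by simp
    qed
  qed
  then have "AE s in lborel. g s = 0" by (intro sigma_finite_measure.density_zero[OF lborel.sigma_finite_measure_axioms] gi) auto
  then show ?thesis by eventually_elim (auto simp: g_def)
qed

text \<open>Integrability is only available away from 0, so the positive half-line is exhausted by
  the intervals from 1 / (n + 1) to n.\<close>

lemma AE_eq_if_interval_integrals_eq:
  fixes f g :: "real \<Rightarrow> real"
  assumes f: "\<And>a b. 0 < a \<Longrightarrow> set_integrable lborel {a..b} f"
    and g: "\<And>a b. 0 < a \<Longrightarrow> set_integrable lborel {a..b} g"
    and eq: "\<And>a b. 0 < a \<Longrightarrow> a < b \<Longrightarrow> (LINT t:{a<..b}|lborel. f t) = (LINT t:{a<..b}|lborel. g t)"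
  shows "AE t in lborel. 0 < t \<longrightarrow> f t = g t"
proof -
  have "AE t in lborel. t \<in> {1 / real (Suc n)<..real n} \<longrightarrow> f t - g t = 0" for n
  proof (rule AE_eq_0_if_interval_integrals_0)
    show "set_integrable lborel {1 / real (Suc n)..real n} (\<lambda>t. f t - g t)"
      by (intro set_integral_diff f g) auto
    fix r r' :: real assume r: "1 / real (Suc n) \<le> r" "r \<le> r'" "r' \<le> real n"
    have r0: "0 < r" using r by (meson less_le_trans of_nat_0_less_iff zero_less_Suc zero_less_divide_1_iff)
    have "(LINT t:{r<..r'}|lborel. f t - g t) = (LINT t:{r<..r'}|lborel. f t) - (LINT t:{r<..r'}|lborel. g t)"
      using r0 by (intro set_integral_diff set_integrable_Ioc[OF f[of r r']] set_integrable_Ioc[OF g[of r r']]) auto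
    then show "(LINT t:{r<..r'}|lborel. f t - g t) = 0"
      using eq[OF r0, of r'] r(2) by (cases "r = r'") (auto simp: set_lebesgue_integral_def)
  qed
  then have "AE t in lborel. \<forall>n. t \<in> {1 / real (Suc n)<..real n} \<longrightarrow> f t - g t = 0"
    by (subst AE_all_countable) blast
  then show ?thesis
  proof eventually_elim
    case (elim t)
    show ?case
    proof
      assume t: "0 < t"
      obtain n1 where n1: "t \<le> real n1" using real_arch_simple by blast
      obtain n2 where n2: "inverse (real (Suc n2)) < t" using reals_Archimedean[OF t] by blast
      define n where "n = max n1 n2"
      have "1 / real (Suc n) \<le> 1 / real (Suc n2)" unfolding n_def by (intro divide_left_mono) auto
      then have "1 / real (Suc n) < t" using n2 by (simp add: inverse_eq_divide)
      moreover have "t \<le> real n" using n1 by (simp add: n_def)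
      ultimately show "f t = g t" using elim by fastforce
    qed
  qed
qed

text \<open>The layer-cake representation: a ramp is the average of the indicators of the half-lines
  up to u, with u between s and s + h.\<close>

lemma ramp_layers:
  assumes h: "h > 0"
  shows "(LINT u|lborel. indicator {s<..s + h} u * indicator {..u} t) = h * ramp s h t"
proof -
  \<comment> \<open>For \<open>t \<le> s\<close> the closed interval contains the point
    \<open>s\<close>, which the half-open one excludes; removing this point does not affect the
    integral.\<close>
  have "(LINT u|lborel. indicator {s<..s + h} u * indicator {..u} t)
    = (LINT u|lborel. indicator ({max s t..s + h} - (if t \<le> s then {s} else {})) u :: real)"
    by (intro Bochner_Integration.integral_cong) (auto simp: indicator_def)
  also have "\<dots> = (LINT u|lborel. indicator {max s t..s + h} u)"
    by (rule integral_discrete_difference[of "{s}"]) (auto simp: indicator_def)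
  also have "\<dots> = h * ramp s h t"
  proof (cases "t \<le> s")
    case True
    then show ?thesis using h by (simp add: ramp_eq_1 max_def)
  next
    case False
    then show ?thesis
      using h by (cases "t \<le> s + h") (simp_all add: ramp_between ramp_eq_0 max_def)
  qed
  finally show ?thesis .
qed

text \<open>Layers combined with Fubini's theorem. Identities tested against ramps thereby become
  identities for integrals over balls, averaged in the radius.\<close>

lemma
  fixes w :: "'a::euclidean_space \<Rightarrow> real"
  assumes w: "integrable lborel w" and h: "h > 0"
  shows set_integrable_ball_integral: "set_integrable lborel {s<..s + h} (\<lambda>u. LINT x|lborel. w x * indicator {..u} (norm x))"
    and integral_ramp: "h * (LINT x|lborel. w x * ramp s h (norm x)) =
      (LINT u:{s<..s + h}|lborel. LINT x|lborel. w x * indicator {..u} (norm x))"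
proof -
  have [measurable]: "w \<in> borel_measurable borel" using w by simp
  define F where "F = (\<lambda>(u, x). indicator {s<..s + h} u * (w x * indicator {..u} (norm x)))"
  have [measurable]: "F \<in> borel_measurable (borel \<Otimes>\<^sub>M borel)"
  proof -
    have "(\<lambda>(u, x). indicator {s<..s + h} u * (w x * (if norm x \<le> u then 1 else 0))) \<in> borel_measurable (borel \<Otimes>\<^sub>M borel)"
      by measurable
    also have "(\<lambda>(u, x). indicator {s<..s + h} u * (w x * (if norm x \<le> u then 1 else 0))) = F"
      by (auto simp: F_def fun_eq_iff indicator_def)
    finally show ?thesis .
  qed
  have [measurable]: "(\<lambda>(u, x). norm (F (u, x))) \<in> borel_measurable (lborel \<Otimes>\<^sub>M lborel)"
    by (simp add: case_prod_beta')
  have iw: "integrable lborel (\<lambda>x. w x * indicator {..u} (norm x))" for u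
    by (rule Bochner_Integration.integrable_bound[OF w]) (auto simp: indicator_def)
  have I: "integrable (lborel \<Otimes>\<^sub>M lborel) F"
  proof (rule lborel_pair.Fubini_integrable)
    show "integrable lborel (\<lambda>u. LINT x|lborel. norm (F (u, x)))"
    proof (rule Bochner_Integration.integrable_bound)
      show "integrable lborel (\<lambda>u. indicator {s<..s + h} u *\<^sub>R (LINT x|lborel. \<bar>w x\<bar>))"
        using h by (intro integrable_scaleR_left integrable_real_indicator) (auto simp: less_top)
      show "(\<lambda>u. LINT x|lborel. norm (F (u, x))) \<in> borel_measurable lborel"
        by (rule lborel.borel_measurable_lebesgue_integral) simp
      have "(LINT x|lborel. norm (F (u, x))) \<le> indicator {s<..s + h} u *\<^sub>R (LINT x|lborel. \<bar>w x\<bar>)" for u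
      proof -
        have "(LINT x|lborel. norm (F (u, x))) \<le> (LINT x|lborel. indicator {s<..s + h} u * \<bar>w x\<bar>)"
          using iw[of u] w by (intro integral_mono integrable_norm integrable_mult_right integrable_abs)
            (auto simp: F_def indicator_def)
        then show ?thesis by simp
      qed
      then show "AE u in lborel. norm (LINT x|lborel. norm (F (u, x))) \<le> norm (indicator {s<..s + h} u *\<^sub>R (LINT x|lborel. \<bar>w x\<bar>))"
        by (intro AE_I2) (subst real_norm_def, subst abs_of_nonneg, auto intro: integral_nonneg_AE order_trans[OF _ abs_ge_self])
    qed
    show "AE u in lborel. integrable lborel (\<lambda>x. F (u, x))"
      unfolding F_def prod.case by (intro AE_I2 integrable_mult_right iw)
  qed simp
  have inner: "(LINT x|lborel. F (u, x)) = indicator {s<..s + h} u *\<^sub>R (LINT x|lborel. w x * indicator {..u} (norm x))" for u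
    by (simp add: F_def)
  show "set_integrable lborel {s<..s + h} (\<lambda>u. LINT x|lborel. w x * indicator {..u} (norm x))"
    using lborel_pair.integrable_fst'[OF I] unfolding inner set_integrable_def .
  have "(LINT u:{s<..s + h}|lborel. LINT x|lborel. w x * indicator {..u} (norm x)) = (LINT x|lborel. LINT u|lborel. F (u, x))"
    unfolding set_lebesgue_integral_def inner[symmetric]
    by (rule lborel_pair.Fubini_integral[symmetric]) (use I in simp)
  also have "\<dots> = (LINT x|lborel. w x * (LINT u|lborel. indicator {s<..s + h} u * indicator {..u} (norm x)))"
    unfolding integral_mult_right_zero[symmetric] by (simp add: F_def mult_ac)
  also have "\<dots> = (LINT x|lborel. h * (w x * ramp s h (norm x)))" by (simp only: ramp_layers[OF h] mult.left_commute)
  finally show "h * (LINT x|lborel. w x * ramp s h (norm x)) =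
      (LINT u:{s<..s + h}|lborel. LINT x|lborel. w x * indicator {..u} (norm x))" by simp
qed

text \<open>The flux of the vector field \<open>\<psi>\<close> e through the sphere of radius
  \<open>s\<close>. The factor (e \<bullet> z) / |z| is the normal component of e, and integrating
  over z in the unit ball with \<open>polar_density\<close> replaces the surface integral.\<close>

definition sphere_flux :: "'a::euclidean_space \<Rightarrow> ('a \<Rightarrow> real) \<Rightarrow> real \<Rightarrow> real" where
  "sphere_flux e \<psi> s = (LINT z|lborel. polar_density (s, z) * ((e \<bullet> z) / norm z * \<psi> ((s / norm z) *\<^sub>R z)))"

lemma sphere_flux_borel[measurable]:
  assumes [measurable]: "\<psi> \<in> borel_measurable borel"
  shows "sphere_flux e \<psi> \<in> borel_measurable borel"
proof -
  have "(\<lambda>(s, z). polar_density (s, z) * ((e \<bullet> z) / norm z * \<psi> ((s / norm z) *\<^sub>R z))) \<in> borel_measurable (borel \<Otimes>\<^sub>M lborel)"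
    by measurable
  then show ?thesis
    unfolding sphere_flux_def[abs_def] by (intro lborel.borel_measurable_lebesgue_integral) simp
qed

lemma abs_inner_div_norm: "\<bar>(e \<bullet> z) / norm z\<bar> \<le> norm e"
  using Cauchy_Schwarz_ineq2[of e z] by (cases "z = 0") (simp_all add: field_simps)

text \<open>The divergence theorem on almost every ball. Integrating by parts against a ramp and
  passing to polar coordinates yields an average of fluxes over a shell;
  \<open>integral_ramp\<close> expresses the other side as the average of ball integrals. Equality
  of all averages gives equality at almost every radius.\<close>

lemma AE_ball_deriv_eq_flux:
  fixes \<psi> \<psi>' :: "'a::euclidean_space \<Rightarrow> real"
  assumes \<psi>: "lipschitz_on_balls \<psi>" and B: "\<And>x. \<bar>\<psi> x\<bar> \<le> B"
    and d: "\<And>x. ((\<lambda>t. \<psi> (x + t *\<^sub>R e)) has_real_derivative \<psi>' x) (at 0)"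
    and \<psi>': "integrable lborel \<psi>'"
  shows "AE s in lborel. 0 < s \<longrightarrow> (LINT x|lborel. \<psi>' x * indicator {..s} (norm x)) = sphere_flux e \<psi> s"
proof -
  have [measurable]: "\<psi> \<in> borel_measurable borel" "\<psi>' \<in> borel_measurable borel"
    using borel_measurable_continuous_onI[OF continuous_lipschitz_on_balls[OF \<psi>]] \<psi>' by auto
  have main: "h * (LINT x|lborel. \<psi>' x * ramp s h (norm x)) = (LINT t:{s<..<s + h}|lborel. sphere_flux e \<psi> t)
    \<and> set_integrable lborel {s<..<s + h} (sphere_flux e \<psi>)" if h: "h > 0" for s h
  proof -
    define F where "F x = \<psi> x * (indicator {s<..<s + h} (norm x) / h * ((e \<bullet> x) / norm x))" for x
    have [measurable]: "F \<in> borel_measurable borel" unfolding F_def by measurable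
    have F: "integrable lborel F"
    proof (rule integrable_bounded_support[of _ "s + h" "B * (1 / h * norm e)"])
      fix x :: 'a
      have "\<bar>indicator {s<..<s + h} (norm x) / h\<bar> \<le> 1 / h" using h by (simp add: indicator_def)
      then show "\<bar>F x\<bar> \<le> B * (1 / h * norm e)"
        unfolding F_def abs_mult[of "\<psi> x"] abs_mult[of "indicator {s<..<s + h} (norm x) / h"]
        using order_trans[OF abs_ge_zero B[of x]] h by (intro mult_mono B abs_inner_div_norm) auto
    qed (auto simp: F_def indicator_def)
    have "integrable lborel (\<lambda>x. \<psi>' x * ramp s h (norm x))"
      by (rule Bochner_Integration.integrable_bound[OF \<psi>'])
        (auto simp: abs_mult ramp_bounds intro!: mult_left_le)
    with integral_ramp_parts[OF \<psi> AE_I2[OF d] _ h, of s] F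
    have eq: "(LINT x|lborel. \<psi>' x * ramp s h (norm x)) = (LINT x|lborel. F x)"
      unfolding F_def by (simp add: Bochner_Integration.integral_diff)
    have inner: "(LINT z|lborel. polar_density (t, z) * F ((t / norm z) *\<^sub>R z))
      = indicator {s<..<s + h} t *\<^sub>R sphere_flux e \<psi> t / h" for t
    proof -
      have "(LINT z|lborel. polar_density (t, z) * F ((t / norm z) *\<^sub>R z))
        = (LINT z|lborel. (indicator {s<..<s + h} t / h) * (polar_density (t, z) * ((e \<bullet> z) / norm z * \<psi> ((t / norm z) *\<^sub>R z))))"
      proof (rule integral_cong_AE)
        show "AE z in lborel. polar_density (t, z) * F ((t / norm z) *\<^sub>R z)
          = (indicator {s<..<s + h} t / h) * (polar_density (t, z) * ((e \<bullet> z) / norm z * \<psi> ((t / norm z) *\<^sub>R z)))"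
          using AE_norm_neq[of 0]
        proof eventually_elim
          case (elim z)
          show ?case
          proof (cases "t > 0")
            case True
            then show ?thesis using elim by (simp add: F_def)
          qed (simp add: polar_density_def)
        qed
      qed (simp_all add: F_def)
      also have "\<dots> = (indicator {s<..<s + h} t / h) * sphere_flux e \<psi> t"
        unfolding sphere_flux_def by (rule integral_mult_right_zero)
      finally show ?thesis by simp
    qed
    have "integrable lborel (\<lambda>t. LINT z|lborel. polar_density (t, z) * F ((t / norm z) *\<^sub>R z))"
      using lborel_pair.integrable_fst'[OF integrable_polar[OF F]] by simp
    then have "integrable lborel (\<lambda>t. h * (indicator {s<..<s + h} t *\<^sub>R sphere_flux e \<psi> t / h))"
      unfolding inner by (rule integrable_mult_right)
    then have "set_integrable lborel {s<..<s + h} (sphere_flux e \<psi>)"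
      using h by (simp add: set_integrable_def)
    moreover have "(LINT x|lborel. F x) = (LINT t|lborel. indicator {s<..<s + h} t *\<^sub>R sphere_flux e \<psi> t / h)"
      using integral_polar[OF F] unfolding inner .
    ultimately show ?thesis using h by (simp add: eq set_lebesgue_integral_def)
  qed
  show ?thesis
  proof (rule AE_eq_if_interval_integrals_eq)
    fix a b :: real assume a: "0 < a"
    \<comment> \<open>A shell starting at a / 2 with this width contains the closed interval from
      \<open>a\<close> to \<open>b\<close>.\<close>
    define h where "h = \<bar>b\<bar> + 1"
    have "set_integrable lborel {a / 2<..a / 2 + h} (\<lambda>s. LINT x|lborel. \<psi>' x * indicator {..s} (norm x))"
      by (intro set_integrable_ball_integral \<psi>') (simp add: h_def)
    then show "set_integrable lborel {a..b} (\<lambda>s. LINT x|lborel. \<psi>' x * indicator {..s} (norm x))"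
      by (rule set_integrable_subset) (use a in \<open>auto simp: h_def\<close>)
    have "set_integrable lborel {a / 2<..<a / 2 + h} (sphere_flux e \<psi>)"
      using main[of h "a / 2"] by (simp add: h_def)
    then show "set_integrable lborel {a..b} (sphere_flux e \<psi>)"
      by (rule set_integrable_subset) (use a in \<open>auto simp: h_def\<close>)
    assume ab: "a < b"
    have "(LINT t:{a<..b}|lborel. sphere_flux e \<psi> t) = (LINT t:{a<..<a + (b - a)}|lborel. sphere_flux e \<psi> t)"
      by (rule set_integral_discrete_difference[of "{b}"]) auto
    also have "\<dots> = (b - a) * (LINT x|lborel. \<psi>' x * ramp a (b - a) (norm x))"
      using main[of "b - a" a] ab by simp
    also have "\<dots> = (LINT t:{a<..b}|lborel. LINT x|lborel. \<psi>' x * indicator {..t} (norm x))"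
      using integral_ramp[OF \<psi>', of "b - a" a] ab by simp
    finally show "(LINT t:{a<..b}|lborel. LINT x|lborel. \<psi>' x * indicator {..t} (norm x)) = (LINT t:{a<..b}|lborel. sphere_flux e \<psi> t)" ..
  qed
qed

text \<open>Writing \<open>g r\<close> as \<open>g b\<close> minus the integral of \<open>g'\<close> and exchanging integrals reduces the claim
  to the divergence theorem on balls.\<close>

lemma radial_integral_by_parts:
  fixes \<psi> \<psi>' :: "'a::euclidean_space \<Rightarrow> real" and g g' :: "real \<Rightarrow> real"
  assumes \<psi>: "lipschitz_on_balls \<psi>" and linear: "\<And>x. \<bar>\<psi> x\<bar> \<le> B * norm x"
    and d: "\<And>x. ((\<lambda>t. \<psi> (x + t *\<^sub>R e)) has_real_derivative \<psi>' x) (at 0)"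
    and [measurable]: "\<psi>' \<in> borel_measurable borel" and B': "\<And>x. \<bar>\<psi>' x\<bar> \<le> B'"
    and b: "b > 0" and supp: "\<And>x. norm x \<ge> b \<Longrightarrow> \<psi> x = 0" "\<And>x. norm x \<ge> b \<Longrightarrow> \<psi>' x = 0"
    and [measurable]: "g \<in> borel_measurable borel" "g' \<in> borel_measurable borel"
    and g: "\<And>a. 0 < a \<Longrightarrow> a \<le> b \<Longrightarrow> primitive_on a b g g'"
    and g': "set_integrable lborel {0<..b} (\<lambda>s. s ^ DIM('a) * g' s)"
  shows "(LINT x|lborel. g (norm x) * \<psi>' x) = - (LINT x|lborel. g' (norm x) * ((e \<bullet> x) / norm x) * \<psi> x)"
proof -
  have [measurable]: "\<psi> \<in> borel_measurable borel"
    by (rule borel_measurable_continuous_onI[OF continuous_lipschitz_on_balls[OF \<psi>]])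
  have B: "B \<ge> 0"
  proof -
    obtain i :: 'a where "i \<in> Basis" using nonempty_Basis by blast
    then show ?thesis using linear[of i] by simp
  qed
  have B'0: "B' \<ge> 0" using B'[of 0] by simp
  have bounded: "\<bar>\<psi> x\<bar> \<le> B * b" for x
  proof (cases "norm x \<ge> b")
    case False
    then have "B * norm x \<le> B * b" using B by (intro mult_left_mono) auto
    then show ?thesis using linear[of x] by simp
  qed (use supp B b in simp)
  define A where "A s = (LINT x|lborel. \<psi>' x * indicator {..s} (norm x))" for s
  have i\<psi>': "integrable lborel \<psi>'"
    by (rule integrable_bounded_support[of _ b B']) (use B' supp in auto)
  have A: "AE s in lborel. 0 < s \<longrightarrow> A s = sphere_flux e \<psi> s"
    unfolding A_def by (rule AE_ball_deriv_eq_flux[OF \<psi> bounded d i\<psi>'])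
  define c where "c = B' * measure lborel (ball (0::'a) 1)"
  have c: "(LINT x|lborel. \<bar>\<psi>' x\<bar> * indicator {..s} (norm x)) \<le> c * s ^ DIM('a)" if s: "s > 0" for s
  proof -
    have "(LINT x|lborel. \<bar>\<psi>' x\<bar> * indicator {..s} (norm x)) \<le> (LINT x|lborel. B' * indicator (cball (0::'a) s) x)"
    proof (rule integral_mono)
      show "integrable lborel (\<lambda>x. \<bar>\<psi>' x\<bar> * indicator {..s} (norm x))"
        by (rule integrable_bounded_support[of _ s B']) (use B' in \<open>auto simp: indicator_def\<close>)
      show "integrable lborel (\<lambda>x. B' * indicator (cball (0::'a) s) x)"
        by (intro integrable_mult_right integrable_real_indicator) (auto simp: emeasure_cball_less_top)
      show "\<bar>\<psi>' x\<bar> * indicator {..s} (norm x) \<le> B' * indicator (cball (0::'a) s) x" for x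
        using B'[of x] by (auto simp: indicator_def)
    qed
    also have "\<dots> = c * s ^ DIM('a)"
      using s by (simp add: c_def content_cball content_ball)
    finally show ?thesis .
  qed
  have c0: "c \<ge> 0" using B'0 by (simp add: c_def)
  \<comment> \<open>For nonzero x, integration over s gives (g b - g |x|) times
    \<open>\<psi>' x\<close>; integration over x gives \<open>g' s\<close> times a ball integral,
    hence a flux.\<close>
  define F where "F = (\<lambda>(s, x). (indicator {..s} (norm x) * indicator {0<..b} s * g' s) * \<psi>' x)"
  have [measurable]: "F \<in> borel_measurable (borel \<Otimes>\<^sub>M borel)"
  proof -
    have "(\<lambda>(s, x). ((if norm x \<le> s then 1 else 0) * indicator {0<..b} s * g' s) * \<psi>' x) \<in> borel_measurable (borel \<Otimes>\<^sub>M borel)"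
      by measurable
    also have "(\<lambda>(s, x). ((if norm x \<le> s then 1 else 0) * indicator {0<..b} s * g' s) * \<psi>' x) = F"
      by (auto simp: F_def fun_eq_iff indicator_def)
    finally show ?thesis .
  qed
  have [measurable]: "(\<lambda>(s, x). norm (F (s, x))) \<in> borel_measurable (lborel \<Otimes>\<^sub>M lborel)"
    by (simp add: case_prod_beta')
  have I: "integrable (lborel \<Otimes>\<^sub>M lborel) F"
  proof (rule lborel_pair.Fubini_integrable)
    show "F \<in> borel_measurable (lborel \<Otimes>\<^sub>M lborel)" by simp
    have "integrable lborel (\<lambda>s. c * (indicator {0<..b} s *\<^sub>R (s ^ DIM('a) * g' s)))"
      using g' unfolding set_integrable_def by (rule integrable_mult_right)
    then show "integrable lborel (\<lambda>s. LINT x|lborel. norm (F (s, x)))"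
    proof (rule Bochner_Integration.integrable_bound)
      show "(\<lambda>s. LINT x|lborel. norm (F (s, x))) \<in> borel_measurable lborel"
        by (rule lborel.borel_measurable_lebesgue_integral) simp
      show "AE s in lborel. norm (LINT x|lborel. norm (F (s, x))) \<le> norm (c * (indicator {0<..b} s *\<^sub>R (s ^ DIM('a) * g' s)))"
      proof (rule AE_I2)
        fix s
        have "(LINT x|lborel. norm (F (s, x))) = (LINT x|lborel. (indicator {0<..b} s * \<bar>g' s\<bar>) * (\<bar>\<psi>' x\<bar> * indicator {..s} (norm x)))"
          by (intro Bochner_Integration.integral_cong) (auto simp: F_def abs_mult indicator_def)
        also have "\<dots> = (indicator {0<..b} s * \<bar>g' s\<bar>) * (LINT x|lborel. \<bar>\<psi>' x\<bar> * indicator {..s} (norm x))"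
          by simp
        also have "\<dots> \<le> (indicator {0<..b} s * \<bar>g' s\<bar>) * (c * s ^ DIM('a))"
          by (cases "s > 0") (auto intro!: mult_left_mono c)
        also have "\<dots> = norm (c * (indicator {0<..b} s *\<^sub>R (s ^ DIM('a) * g' s)))"
          using c0 by (auto simp: indicator_def abs_mult power_abs)
        finally show "norm (LINT x|lborel. norm (F (s, x))) \<le> norm (c * (indicator {0<..b} s *\<^sub>R (s ^ DIM('a) * g' s)))"
          by (subst real_norm_def, subst abs_of_nonneg) (auto intro: integral_nonneg_AE)
      qed
    qed
    show "AE s in lborel. integrable lborel (\<lambda>x. F (s, x))"
    proof (rule AE_I2)
      fix s
      have "integrable lborel (\<lambda>x. \<psi>' x * indicator {..s} (norm x))"
        by (rule integrable_bounded_support[of _ s B']) (use B' B'0 in \<open>auto simp: indicator_def\<close>)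
      then have "integrable lborel (\<lambda>x. (indicator {0<..b} s * g' s) * (\<psi>' x * indicator {..s} (norm x)))"
        by (rule integrable_mult_right)
      then show "integrable lborel (\<lambda>x. F (s, x))" by (simp add: F_def mult_ac)
    qed
  qed
  have swap: "(LINT x|lborel. LINT s|lborel. F (s, x)) = (LINT s|lborel. LINT x|lborel. F (s, x))"
    by (rule lborel_pair.Fubini_integral) (use I in simp)
  have I2: "integrable lborel (\<lambda>x. LINT s|lborel. F (s, x))"
    using lborel_pair.integrable_snd[of "\<lambda>s x. F (s, x)"] I by simp
  have rep: "g (norm x) * \<psi>' x = g b * \<psi>' x - (LINT s|lborel. F (s, x))" if x: "x \<noteq> 0" for x
  proof (cases "norm x \<ge> b")
    case True
    then show ?thesis using supp by (simp add: F_def)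
  next
    case False
    have "(LINT s|lborel. F (s, x)) = (LINT s|lborel. (indicator {norm x..b} s *\<^sub>R g' s) * \<psi>' x)"
    proof (rule Bochner_Integration.integral_cong[OF refl])
      fix s
      have "indicator {..s} (norm x) * indicator {0<..b} s = (indicator {norm x..b} s :: real)"
        using less_le_trans[of 0 "norm x" s] x by (auto simp: indicator_def)
      then show "F (s, x) = (indicator {norm x..b} s *\<^sub>R g' s) * \<psi>' x" by (simp add: F_def)
    qed
    also have "\<dots> = (LINT s:{norm x..b}|lborel. g' s) * \<psi>' x"
      by (simp add: set_lebesgue_integral_def)
    also have "(LINT s:{norm x..b}|lborel. g' s) = (LINT s:{norm x<..b}|lborel. g' s)"
      by (rule set_integral_discrete_difference[of "{norm x}"]) auto
    also have "\<dots> = g b - g (norm x)"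
      using primitive_onD[OF g, of "norm x" "norm x" b] False x by simp
    finally show ?thesis by (simp add: algebra_simps)
  qed
  \<comment> \<open>The integral of a derivative of a compactly supported function is 0, so the
    boundary value \<open>g b\<close> drops out.\<close>
  have "(LINT x|lborel. \<psi>' x) = 0"
    using integral_deriv_eq_0(2)[OF \<psi>, of b e \<psi>'] supp d by simp
  have [measurable]: "(\<lambda>x. LINT s|lborel. F (s, x)) \<in> borel_measurable borel" using I2 by simp
  have "(LINT x|lborel. g (norm x) * \<psi>' x) = (LINT x|lborel. g b * \<psi>' x - (LINT s|lborel. F (s, x)))"
  proof (rule integral_cong_AE)
    show "AE x in lborel. g (norm x) * \<psi>' x = g b * \<psi>' x - (LINT s|lborel. F (s, x))"
      using AE_norm_neq[of 0] by eventually_elim (simp add: rep)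
  qed simp_all
  also have "\<dots> = g b * (LINT x|lborel. \<psi>' x) - (LINT x|lborel. LINT s|lborel. F (s, x))"
    using i\<psi>' I2 by (subst Bochner_Integration.integral_diff) auto
  also have "\<dots> = - (LINT s|lborel. LINT x|lborel. F (s, x))"
    by (simp add: \<open>(LINT x|lborel. \<psi>' x) = 0\<close> swap)
  also have "(LINT s|lborel. LINT x|lborel. F (s, x)) = (LINT s|lborel. indicator {0<..b} s * g' s * sphere_flux e \<psi> s)"
  proof (rule integral_cong_AE)
    show "AE s in lborel. (LINT x|lborel. F (s, x)) = indicator {0<..b} s * g' s * sphere_flux e \<psi> s"
      using A
    proof eventually_elim
      case (elim s)
      have "(LINT x|lborel. F (s, x)) = (LINT x|lborel. (indicator {0<..b} s * g' s) * (\<psi>' x * indicator {..s} (norm x)))"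
        by (simp add: F_def mult_ac)
      also have "\<dots> = indicator {0<..b} s * g' s * A s" by (simp add: A_def)
      finally show ?case using elim by (simp add: indicator_def)
    qed
    show "(\<lambda>s. LINT x|lborel. F (s, x)) \<in> borel_measurable lborel"
      using lborel_pair.integrable_fst'[OF I] by (rule borel_measurable_integrable)
    show "(\<lambda>s. indicator {0<..b} s * g' s * sphere_flux e \<psi> s) \<in> borel_measurable lborel"
      by simp
  qed
  also have "\<dots> = (LINT x|lborel. g' (norm x) * ((e \<bullet> x) / norm x) * \<psi> x)"
  proof -
    \<comment> \<open>The linear bound on \<open>\<psi>\<close> contributes one factor s; with the
      polar weight s^(D - 1) this is the weight s^D under which \<open>g'\<close> is
      integrable.\<close>
    have "integrable lborel (\<lambda>s. indicator {0<..} s * (s ^ (DIM('a) - 1) * (indicator {..b} s * (s * g' s))))"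
    proof -
      have p: "s ^ (DIM('a) - 1) * (s * c) = s ^ DIM('a) * c" for s c :: real
        using power_Suc2[of s "DIM('a) - 1"] by (simp add: mult.assoc[symmetric])
      have "indicator {0<..} s * (s ^ (DIM('a) - 1) * (indicator {..b} s * (s * g' s)))
        = indicator {0<..b} s *\<^sub>R (s ^ DIM('a) * g' s)" for s
        using p[of s "g' s"] by (auto simp: indicator_def)
      then show ?thesis using g' by (simp only: set_integrable_def)
    qed
    then have "integrable lborel (\<lambda>x::'a. indicator {..b} (norm x) * (norm x * g' (norm x)))"
      by (subst integrable_radial_iff[of "\<lambda>s. indicator {..b} s * (s * g' s)"]) simp_all
    then have "integrable lborel (\<lambda>x::'a. norm e * B * (indicator {..b} (norm x) * (norm x * g' (norm x))))"
      by (rule integrable_mult_right)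
    then have Q: "integrable lborel (\<lambda>x. g' (norm x) * ((e \<bullet> x) / norm x) * \<psi> x)"
    proof (rule Bochner_Integration.integrable_bound)
      show "AE x in lborel. norm (g' (norm x) * ((e \<bullet> x) / norm x) * \<psi> x)
        \<le> norm (norm e * B * (indicator {..b} (norm x) * (norm x * g' (norm x))))"
      proof (rule AE_I2)
        fix x :: 'a
        have "\<bar>\<psi> x\<bar> \<le> B * norm x * indicator {..b} (norm x)"
          using linear[of x] supp(1)[of x] by (auto simp: indicator_def)
        then have "norm (g' (norm x) * ((e \<bullet> x) / norm x) * \<psi> x)
          \<le> \<bar>g' (norm x)\<bar> * norm e * (B * norm x * indicator {..b} (norm x))"
          unfolding real_norm_def abs_mult by (intro mult_mono order_refl abs_inner_div_norm) auto
        then show "norm (g' (norm x) * ((e \<bullet> x) / norm x) * \<psi> x)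
          \<le> norm (norm e * B * (indicator {..b} (norm x) * (norm x * g' (norm x))))"
          using B by (simp add: abs_mult mult_ac)
      qed
    qed simp
    have "(LINT z|lborel. polar_density (s, z) * (g' (norm ((s / norm z) *\<^sub>R z)) * ((e \<bullet> ((s / norm z) *\<^sub>R z)) / norm ((s / norm z) *\<^sub>R z)) * \<psi> ((s / norm z) *\<^sub>R z)))
      = indicator {0<..b} s * g' s * sphere_flux e \<psi> s" for s
    proof -
      have "(LINT z|lborel. polar_density (s, z) * (g' (norm ((s / norm z) *\<^sub>R z)) * ((e \<bullet> ((s / norm z) *\<^sub>R z)) / norm ((s / norm z) *\<^sub>R z)) * \<psi> ((s / norm z) *\<^sub>R z)))
        = (LINT z|lborel. (indicator {0<..b} s * g' s) * (polar_density (s, z) * ((e \<bullet> z) / norm z * \<psi> ((s / norm z) *\<^sub>R z))))"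
      proof (rule integral_cong_AE)
        show "AE z in lborel. polar_density (s, z) * (g' (norm ((s / norm z) *\<^sub>R z)) * ((e \<bullet> ((s / norm z) *\<^sub>R z)) / norm ((s / norm z) *\<^sub>R z)) * \<psi> ((s / norm z) *\<^sub>R z))
          = (indicator {0<..b} s * g' s) * (polar_density (s, z) * ((e \<bullet> z) / norm z * \<psi> ((s / norm z) *\<^sub>R z)))"
          using AE_norm_neq[of 0]
        proof eventually_elim
          case (elim z)
          consider "s \<le> 0" | "0 < s" "s \<le> b" | "b < s" by linarith
          then show ?case
          proof cases
            case 3
            then have "\<psi> ((s / norm z) *\<^sub>R z) = 0" using elim b by (intro supp) simp
            then show ?thesis by simp
          qed (use elim in \<open>auto simp: polar_density_def\<close>)
        qed
      qed simp_all
      also have "\<dots> = (indicator {0<..b} s * g' s) * sphere_flux e \<psi> s"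
        unfolding sphere_flux_def by (rule integral_mult_right_zero)
      finally show ?thesis .
    qed
    then show ?thesis using integral_polar[OF Q] by simp
  qed
  finally show ?thesis .
qed

section \<open>The kernel of the Newtonian field\<close>

definition cut_power :: "nat \<Rightarrow> real \<Rightarrow> real \<Rightarrow> real" where
  "cut_power n d t = 1 / max t d ^ n"

lemma cut_power_borel[measurable]: "cut_power n d \<in> borel_measurable borel"
  unfolding cut_power_def by measurable

lemma cut_power_lipschitz:
  assumes d: "d > 0"
  shows "(real n / d ^ (n + 1))-lipschitz_on UNIV (cut_power n d)"
proof (rule lipschitz_onI)
  fix x y :: real
  obtain \<xi> where \<xi>: "\<xi> \<in> {d..}"
    "1 / max y d ^ n - 1 / max x d ^ n = - (real n / \<xi> ^ (n + 1)) * (max y d - max x d)"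
  proof (rule MVT_between[of "{d..}" "\<lambda>u. 1 / u ^ n" "\<lambda>u. - (real n / u ^ (n + 1))" "max x d" "max y d"])
    show "((\<lambda>u. 1 / u ^ n) has_real_derivative - (real n / u ^ (n + 1))) (at u)" if "u \<in> {d..}" for u
      using that d by (intro DERIV_inverse_power) simp
  qed (auto simp: is_interval_ci)
  have "dist (cut_power n d x) (cut_power n d y) = \<bar>1 / max y d ^ n - 1 / max x d ^ n\<bar>"
    by (simp add: cut_power_def dist_real_def)
  also have "\<dots> = (real n / \<xi> ^ (n + 1)) * \<bar>max y d - max x d\<bar>"
    unfolding \<xi>(2) abs_mult using \<xi>(1) d by simp
  also have "\<dots> \<le> (real n / d ^ (n + 1)) * dist x y"
    using \<xi>(1) d by (intro mult_mono divide_left_mono power_mono) (auto simp: dist_real_def max_def)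
  finally show "dist (cut_power n d x) (cut_power n d y) \<le> real n / d ^ (n + 1) * dist x y" .
qed (use d in simp)

lemma cut_power_has_derivative:
  assumes d: "d > 0" and t: "t \<noteq> d"
  shows "(cut_power n d has_real_derivative (if t < d then 0 else - (real n / t ^ (n + 1)))) (at t)"
proof (cases "t < d")
  case True
  have "((\<lambda>t. 1 / d ^ n) has_real_derivative 0) (at t)" by simp
  moreover have "\<forall>\<^sub>F x in nhds t. 1 / d ^ n = cut_power n d x"
    using eventually_nhds_in_open[of "{..<d}" t] True
    by (auto elim!: eventually_mono simp: cut_power_def max_def)
  ultimately show ?thesis using DERIV_cong_ev True by fastforce
next
  case False
  then have "t > d" using t by simp
  then have "((\<lambda>u. 1 / u ^ n) has_real_derivative - (real n / t ^ (n + 1))) (at t)"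
    using d by (intro DERIV_inverse_power) simp
  moreover have "\<forall>\<^sub>F x in nhds t. 1 / x ^ n = cut_power n d x"
    using eventually_nhds_in_open[of "{d<..}" t] \<open>t > d\<close>
    by (auto elim!: eventually_mono simp: cut_power_def max_def)
  ultimately show ?thesis using DERIV_cong_ev False by fastforce
qed

lemma integrable_inverse_norm_power:
  "integrable lborel (\<lambda>x::'a::euclidean_space. indicator {..r} (norm x) / norm x ^ (DIM('a) - 1))"
proof -
  have "set_integrable lborel {0<..max r 0} (\<lambda>s. 1::real)"
    unfolding set_integrable_def by (intro integrable_scaleR_left integrable_real_indicator) (auto simp: less_top)
  then have "integrable lborel (\<lambda>s. indicator {0<..} s * (s ^ (DIM('a) - 1) * (indicator {..r} s / s ^ (DIM('a) - 1))))"
    unfolding set_integrable_def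
    by (rule Bochner_Integration.integrable_cong[THEN iffD1, rotated 2]) (auto simp: indicator_def)
  then show ?thesis
    by (subst integrable_radial_iff[of "\<lambda>s. indicator {..r} s / s ^ (DIM('a) - 1)"]) simp_all
qed

text \<open>The vector field \<open>x / \<bar>x\<bar>\<^sup>n\<close> has divergence concentrated at the origin; it is
  regularised by replacing \<open>\<bar>x\<bar>\<close> in the denominator by \<open>max \<bar>x\<bar> d\<close>.\<close>

lemma cut_power_gradient:
  fixes \<Phi> :: "'a::euclidean_space \<Rightarrow> real" and G :: "'a \<Rightarrow> 'a"
  assumes \<Phi>: "lipschitz_on_balls \<Phi>" and supp: "\<And>x. norm x > R \<Longrightarrow> \<Phi> x = 0"
    and G: "AE x in lborel. \<forall>e\<in>Basis. ((\<lambda>t. \<Phi> (x + t *\<^sub>R e)) has_real_derivative (G x \<bullet> e)) (at 0)"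
    and [measurable]: "G \<in> borel_measurable borel"
    and GL: "\<And>x. norm (G x) \<le> L" and Gsupp: "\<And>x. norm x > R \<Longrightarrow> G x = 0"
    and d: "d > 0"
  shows "(LINT x|lborel. cut_power DIM('a) d (norm x) * (x \<bullet> G x)) =
    - (real DIM('a) / d ^ DIM('a) * (LINT x|lborel. indicator {..<d} (norm x) * \<Phi> x))"
proof -
  define n where "n = DIM('a)"
  define k where "k = cut_power n d"
  have kp: "0 \<le> k t" "k t \<le> 1 / d ^ n" for t
    using d by (auto simp: k_def cut_power_def intro!: divide_left_mono power_mono)
  have [measurable]: "k \<in> borel_measurable borel" by (simp add: k_def)
  define k' where "k' t = (if t < d then 0 else - (real n / t ^ (n + 1)))" for t
  have [measurable]: "k' \<in> borel_measurable borel" unfolding k'_def by measurable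
  have [measurable]: "\<Phi> \<in> borel_measurable borel"
    by (rule borel_measurable_continuous_onI[OF continuous_lipschitz_on_balls[OF \<Phi>]])
  define D where "D e x = k (norm x) * \<Phi> x + (x \<bullet> e) * (k' (norm x) * ((e \<bullet> x) / norm x) * \<Phi> x + (G x \<bullet> e) * k (norm x))" for e x
  have [measurable]: "D e \<in> borel_measurable borel" for e unfolding D_def by measurable
  have D: "integrable lborel (D e)" "(LINT x|lborel. D e x) = 0" if e: "e \<in> Basis" for e
  proof -
    have "lipschitz_on_balls (\<lambda>x. norm (x::'a))" using lipschitz_on_balls_norm_diff[of "0::'a"] by simp
    then have lip: "lipschitz_on_balls (\<lambda>x. (x \<bullet> e) * (k (norm x) * \<Phi> x))"
      unfolding k_def
      by (intro lipschitz_on_balls_mult lipschitz_on_balls_inner \<Phi> lipschitz_on_balls_compose[OF cut_power_lipschitz[OF d]])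
    have s: "(x \<bullet> e) * (k (norm x) * \<Phi> x) = 0" if "norm x > R" for x using supp[OF that] by simp
    have "AE x in lborel. ((\<lambda>t. ((x + t *\<^sub>R e) \<bullet> e) * (k (norm (x + t *\<^sub>R e)) * \<Phi> (x + t *\<^sub>R e))) has_real_derivative D e x) (at 0)"
      using G AE_norm_neq[of 0] AE_norm_neq[of d]
    proof eventually_elim
      case (elim x)
      have 1: "((\<lambda>t. (x + t *\<^sub>R e) \<bullet> e) has_real_derivative 1) (at 0)"
        using e by (auto intro!: derivative_eq_intros simp: inner_add_left)
      have 2: "((\<lambda>t. k (norm (x + t *\<^sub>R e))) has_real_derivative k' (norm x) * ((e \<bullet> x) / norm x)) (at 0)"
        using elim cut_power_has_derivative[OF d, of "norm (x + 0 *\<^sub>R e)" n]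
        unfolding k_def k'_def by (intro DERIV_chain2[of "cut_power n d"] has_real_derivative_norm_line) auto
      have 3: "((\<lambda>t. \<Phi> (x + t *\<^sub>R e)) has_real_derivative (G x \<bullet> e)) (at 0)" using elim e by blast
      from DERIV_mult[OF 1 DERIV_mult[OF 2 3]] show ?case
        by (rule DERIV_cong) (simp add: D_def algebra_simps)
    qed
    note * = integral_deriv_eq_0[OF lip s this]
    show "integrable lborel (D e)" "(LINT x|lborel. D e x) = 0" by (rule *; simp)+
  qed
  have iG: "integrable lborel (\<lambda>x. k (norm x) * (x \<bullet> G x))"
  proof (rule integrable_bounded_support[of _ R "1 / d ^ n * (\<bar>R\<bar> * L)"])
    fix x :: 'a assume x: "norm x \<le> R"
    have "\<bar>x \<bullet> G x\<bar> \<le> norm x * norm (G x)" by (rule Cauchy_Schwarz_ineq2)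
    also have "\<dots> \<le> \<bar>R\<bar> * L" using x GL[of x] by (intro mult_mono) auto
    finally show "\<bar>k (norm x) * (x \<bullet> G x)\<bar> \<le> 1 / d ^ n * (\<bar>R\<bar> * L)"
      unfolding abs_mult using kp[of "norm x"] d by (intro mult_mono) auto
  qed (simp_all add: Gsupp)
  have i\<Phi>: "integrable lborel (\<lambda>x. real n / d ^ n * (indicator {..<d} (norm x) * \<Phi> x))"
  proof -
    obtain B where B: "B \<ge> 0" "\<And>x. norm x \<le> R \<Longrightarrow> norm (\<Phi> x) \<le> B"
      using bounded_lipschitz_on_balls[OF \<Phi>] by blast
    show ?thesis
      by (intro integrable_mult_right integrable_bounded_support[of _ R B])
        (use B supp in \<open>auto simp: indicator_def\<close>)
  qed
  have "0 = (\<Sum>e\<in>Basis. LINT x|lborel. D e x)" using D(2) by simp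
  also have "\<dots> = (LINT x|lborel. (\<Sum>e\<in>Basis. D e x))" using D(1) by (subst Bochner_Integration.integral_sum) auto
  also have "\<dots> = (LINT x|lborel. real n / d ^ n * (indicator {..<d} (norm x) * \<Phi> x) + k (norm x) * (x \<bullet> G x))"
  proof (rule integral_cong_AE)
    show "AE x in lborel. (\<Sum>e\<in>Basis. D e x) = real n / d ^ n * (indicator {..<d} (norm x) * \<Phi> x) + k (norm x) * (x \<bullet> G x)"
      using AE_norm_neq[of 0] AE_norm_neq[of d]
    proof eventually_elim
      case (elim x)
      then have x: "norm x > 0" by simp
      have "(\<Sum>e\<in>Basis. D e x) = real n * (k (norm x) * \<Phi> x) + (\<Sum>e\<in>Basis. (x \<bullet> e) * (x \<bullet> e)) * (k' (norm x) / norm x * \<Phi> x)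
        + (\<Sum>e\<in>Basis. (x \<bullet> e) * (G x \<bullet> e)) * k (norm x)"
        by (simp add: D_def sum.distrib n_def sum_distrib_right sum_distrib_left distrib_left mult_ac inner_commute)
      also have "(\<Sum>e\<in>Basis. (x \<bullet> e) * (x \<bullet> e)) = norm x ^ 2"
        by (simp add: euclidean_inner[symmetric] power2_norm_eq_inner)
      also have "(\<Sum>e\<in>Basis. (x \<bullet> e) * (G x \<bullet> e)) = x \<bullet> G x" by (simp add: euclidean_inner[symmetric])
      \<comment> \<open>Beyond radius \<open>d\<close> the radial derivative of the kernel cancels
        the sum of the n diagonal terms, so the divergence lives on the ball of radius
        \<open>d\<close>.\<close>
      also have "real n * (k (norm x) * \<Phi> x) + norm x ^ 2 * (k' (norm x) / norm x * \<Phi> x) = real n / d ^ n * (indicator {..<d} (norm x) * \<Phi> x)"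
        using elim x by (auto simp: k_def k'_def cut_power_def max_def field_simps power2_eq_square)
      finally show ?case by (simp add: mult.commute)
    qed
  qed simp_all
  also have "\<dots> = (LINT x|lborel. real n / d ^ n * (indicator {..<d} (norm x) * \<Phi> x)) + (LINT x|lborel. k (norm x) * (x \<bullet> G x))"
    using iG i\<Phi> by (rule Bochner_Integration.integral_add[rotated])
  finally show ?thesis by (simp add: n_def k_def)
qed

text \<open>As the regularisation radius tends to 0, the right side of
  \<open>cut_power_gradient\<close> becomes a multiple of the mean of \<open>\<Phi>\<close> over
  shrinking balls, hence of \<open>\<Phi> 0\<close>. The left side is dominated by a multiple of 1 /
  |x|^(D - 1), which is locally integrable.\<close>

lemma integral_kernel_gradient:
  fixes \<Phi> :: "'a::euclidean_space \<Rightarrow> real" and G :: "'a \<Rightarrow> 'a"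
  assumes \<Phi>: "lipschitz_on_balls \<Phi>" and supp: "\<And>x. norm x > R \<Longrightarrow> \<Phi> x = 0"
    and G: "AE x in lborel. \<forall>e\<in>Basis. ((\<lambda>t. \<Phi> (x + t *\<^sub>R e)) has_real_derivative (G x \<bullet> e)) (at 0)"
    and [measurable]: "G \<in> borel_measurable borel"
    and GL: "\<And>x. norm (G x) \<le> L" and Gsupp: "\<And>x. norm x > R \<Longrightarrow> G x = 0"
  shows "(LINT x|lborel. (x \<bullet> G x) / norm x ^ DIM('a)) = - sphere_area TYPE('a) * \<Phi> 0"
proof -
  define n where "n = DIM('a)"
  have n: "n > 0" by (simp add: n_def)
  have [measurable]: "\<Phi> \<in> borel_measurable borel"
    by (rule borel_measurable_continuous_onI[OF continuous_lipschitz_on_balls[OF \<Phi>]])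
  define d where "d m = inverse (real (Suc m))" for m
  have d: "d m > 0" "d m \<le> 1" for m by (auto simp: d_def divide_simps)
  have d0: "d \<longlonglongrightarrow> 0" unfolding d_def by (rule LIMSEQ_inverse_real_of_nat)
  obtain K where K: "K-lipschitz_on (cball 0 1) \<Phi>" using \<Phi> lipschitz_on_ballsD by blast
  have K0: "K \<ge> 0" by (rule lipschitz_on_nonneg[OF K])
  have "(\<lambda>m. LINT x|lborel. cut_power n (d m) (norm x) * (x \<bullet> G x)) \<longlonglongrightarrow> (LINT x|lborel. (x \<bullet> G x) / norm x ^ n)"
  proof (rule integral_dominated_convergence[where w = "\<lambda>x. L * (indicator {..R} (norm x) / norm x ^ (n - 1))"])
    show "integrable lborel (\<lambda>x::'a. L * (indicator {..R} (norm x) / norm x ^ (n - 1)))"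
      unfolding n_def by (intro integrable_mult_right integrable_inverse_norm_power)
    show "AE x in lborel. (\<lambda>m. cut_power n (d m) (norm x) * (x \<bullet> G x)) \<longlonglongrightarrow> (x \<bullet> G x) / norm x ^ n"
      using AE_norm_neq[of 0]
    proof eventually_elim
      case (elim x)
      then have "\<forall>\<^sub>F m in sequentially. d m < norm x" by (intro order_tendstoD(2)[OF d0]) simp
      then have "\<forall>\<^sub>F m in sequentially. cut_power n (d m) (norm x) * (x \<bullet> G x) = (x \<bullet> G x) / norm x ^ n"
        by eventually_elim (simp add: cut_power_def max_def)
      then show ?case by (rule tendsto_eventually)
    qed
    show "AE x in lborel. norm (cut_power n (d m) (norm x) * (x \<bullet> G x)) \<le> L * (indicator {..R} (norm x) / norm x ^ (n - 1))" for m
      using AE_norm_neq[of 0]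
    proof eventually_elim
      case (elim x)
      then have x: "norm x > 0" by simp
      show ?case
      proof (cases "norm x \<le> R")
        case True
        have "\<bar>x \<bullet> G x\<bar> \<le> norm x * norm (G x)" by (rule Cauchy_Schwarz_ineq2)
        also have "\<dots> \<le> norm x * L" using GL[of x] by (intro mult_left_mono) auto
        finally have 1: "\<bar>x \<bullet> G x\<bar> \<le> norm x * L" .
        have 2: "\<bar>cut_power n (d m) (norm x)\<bar> \<le> 1 / norm x ^ n"
          using x d(1)[of m] by (auto simp: cut_power_def intro!: divide_left_mono power_mono)
        have "norm (cut_power n (d m) (norm x) * (x \<bullet> G x)) \<le> 1 / norm x ^ n * (norm x * L)"
          unfolding real_norm_def abs_mult using 1 2 x by (intro mult_mono) auto
        also have "\<dots> = L * (1 / norm x ^ (n - 1))"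
          using x n by (cases n) (auto simp: field_simps)
        finally show ?thesis using True by simp
      qed (simp add: Gsupp)
    qed
  qed simp_all
  moreover have "(\<lambda>m. LINT x|lborel. cut_power n (d m) (norm x) * (x \<bullet> G x)) \<longlonglongrightarrow> - sphere_area TYPE('a) * \<Phi> 0"
  proof (rule LIM_zero_cancel, rule Lim_null_comparison)
    have mb: "(LINT x|lborel. indicator {..<d m} (norm (x::'a))) = measure lborel (ball (0::'a) 1) * d m ^ n" for m
    proof -
      have "(LINT x|lborel. indicator {..<d m} (norm (x::'a))) = (LINT x|lborel. indicator (ball (0::'a) (d m)) x :: real)"
        by (rule Bochner_Integration.integral_cong) (auto simp: indicator_def)
      then show ?thesis using d(1)[of m] by (simp add: content_ball n_def)
    qed
    have i1: "integrable lborel (\<lambda>x::'a. indicator {..<d m} (norm x) * c)" for m and c :: real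
      by (rule integrable_bounded_support[of _ "d m" "\<bar>c\<bar>"]) (auto simp: indicator_def)
    have i2: "integrable lborel (\<lambda>x. indicator {..<d m} (norm x) * \<Phi> x)" for m
    proof -
      obtain B where B: "B \<ge> 0" "\<And>x. norm x \<le> R \<Longrightarrow> norm (\<Phi> x) \<le> B"
        using bounded_lipschitz_on_balls[OF \<Phi>] by blast
      show ?thesis
        by (rule integrable_bounded_support[of _ R B])
          (use B supp in \<open>auto simp: indicator_def\<close>)
    qed
    show "\<forall>\<^sub>F m in sequentially. norm ((LINT x|lborel. cut_power n (d m) (norm x) * (x \<bullet> G x)) - (- sphere_area TYPE('a) * \<Phi> 0))
      \<le> sphere_area TYPE('a) * (K * d m)"
    proof (rule always_eventually, rule allI)
      fix m
      have "(LINT x|lborel. cut_power n (d m) (norm x) * (x \<bullet> G x)) - (- sphere_area TYPE('a) * \<Phi> 0)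
        = - (real n / d m ^ n) * ((LINT x|lborel. indicator {..<d m} (norm x) * \<Phi> x) - (LINT x|lborel. indicator {..<d m} (norm (x::'a)) * \<Phi> 0))"
        using cut_power_gradient[OF \<Phi> supp G _ GL Gsupp d(1)[of m]] d(1)[of m] n
        by (simp add: mb n_def[symmetric] sphere_area_def field_simps)
      also have "\<dots> = - (real n / d m ^ n) * (LINT x|lborel. indicator {..<d m} (norm x) * \<Phi> x - indicator {..<d m} (norm (x::'a)) * \<Phi> 0)"
        using i1 i2 by (subst Bochner_Integration.integral_diff) auto
      also have "norm \<dots> = (real n / d m ^ n) * \<bar>LINT x|lborel. indicator {..<d m} (norm x) * \<Phi> x - indicator {..<d m} (norm (x::'a)) * \<Phi> 0\<bar>"
        using d(1)[of m] by (simp add: abs_mult)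
      also have "\<dots> \<le> (real n / d m ^ n) * (LINT x|lborel. indicator {..<d m} (norm (x::'a)) * (K * d m))"
      proof (intro mult_left_mono order_trans[OF integral_abs_bound] integral_mono)
        show "integrable lborel (\<lambda>x. \<bar>indicator {..<d m} (norm x) * \<Phi> x - indicator {..<d m} (norm (x::'a)) * \<Phi> 0\<bar>)"
          using i1 i2 by (intro integrable_abs Bochner_Integration.integrable_diff) auto
        show "integrable lborel (\<lambda>x::'a. indicator {..<d m} (norm x) * (K * d m))" by (rule i1)
        fix x :: 'a
        show "\<bar>indicator {..<d m} (norm x) * \<Phi> x - indicator {..<d m} (norm x) * \<Phi> 0\<bar> \<le> indicator {..<d m} (norm x) * (K * d m)"
        proof (cases "norm x < d m")
          case True
          then have "dist (\<Phi> x) (\<Phi> 0) \<le> K * dist x 0"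
            using d(2)[of m] by (intro lipschitz_onD[OF K]) auto
          also have "\<dots> \<le> K * d m" using True K0 by (intro mult_left_mono) auto
          finally show ?thesis using True by (simp add: dist_real_def)
        qed simp
      qed (use d(1)[of m] in auto)
      also have "\<dots> = sphere_area TYPE('a) * (K * d m)"
        using d(1)[of m] by (simp add: mb sphere_area_def n_def)
      finally show "norm ((LINT x|lborel. cut_power n (d m) (norm x) * (x \<bullet> G x)) - (- sphere_area TYPE('a) * \<Phi> 0))
        \<le> sphere_area TYPE('a) * (K * d m)" .
    qed
    have "(\<lambda>m. sphere_area TYPE('a) * (K * d m)) \<longlonglongrightarrow> sphere_area TYPE('a) * (K * 0)"
      by (intro tendsto_intros d0)
    then show "(\<lambda>m. sphere_area TYPE('a) * (K * d m)) \<longlonglongrightarrow> 0" by simp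
  qed
  ultimately show ?thesis using LIMSEQ_unique n_def by blast
qed

section \<open>Reflections in hyperplanes and the invariance of Lebesgue measure\<close>

definition reflect :: "'a::euclidean_space \<Rightarrow> 'a \<Rightarrow> 'a" where
  "reflect v x = x - (2 * (x \<bullet> v) / (v \<bullet> v)) *\<^sub>R v"

lemma reflect_reflect: "reflect v (reflect v x) = x"
proof (cases "v = 0")
  case False
  then show ?thesis by (simp add: reflect_def inner_diff_left field_simps)
qed (simp add: reflect_def)

lemma linear_reflect: "linear (reflect v)"
proof (rule linearI)
  fix x y :: 'a and c :: real
  show "reflect v (x + y) = reflect v x + reflect v y"
    unfolding reflect_def inner_add_left distrib_left add_divide_distrib scaleR_add_left by simp
  show "reflect v (c *\<^sub>R x) = c *\<^sub>R reflect v x"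
    by (simp add: reflect_def scaleR_diff_right)
qed

lemma inner_reflect: "reflect v x \<bullet> reflect v y = x \<bullet> y"
proof (cases "v = 0")
  case False
  then show ?thesis
    by (simp add: reflect_def inner_diff_left inner_diff_right field_simps inner_commute)
qed (simp add: reflect_def)

lemma norm_reflect: "norm (reflect v x) = norm x"
  by (simp add: norm_eq_sqrt_inner inner_reflect)

lemma orthogonal_reflect: "orthogonal_transformation (reflect v)"
  by (simp add: orthogonal_transformation_def linear_reflect inner_reflect)

lemma reflect_fixed: "x \<bullet> v = 0 \<Longrightarrow> reflect v x = x"
  by (simp add: reflect_def)

text \<open>For equal norms the hyperplane orthogonal to x - y passes through the midpoint of x and
  y. If x = y, the mirror vector is 0 and the reflection is the identity.\<close>

lemma reflect_swap: "norm x = norm y \<Longrightarrow> reflect (x - y) x = y"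
proof (cases "x = y")
  case False
  assume "norm x = norm y"
  then have n: "x \<bullet> x = y \<bullet> y" by (simp add: norm_eq_sqrt_inner)
  have "(x - y) \<bullet> (x - y) = 2 * (x \<bullet> (x - y))"
    by (simp add: inner_diff_left inner_diff_right inner_commute n)
  moreover have "(x - y) \<bullet> (x - y) \<noteq> 0" using False by simp
  ultimately have "2 * (x \<bullet> (x - y)) / ((x - y) \<bullet> (x - y)) = 1" by (metis divide_self)
  then show ?thesis by (simp only: reflect_def scaleR_one) simp
qed (simp add: reflect_def)

lemma reflect_borel[measurable]: "reflect v \<in> borel_measurable borel"
  unfolding reflect_def by measurable

text \<open>Boxes determine the measure. A reflection is its own inverse, so the preimage of a box
  is its image under an orthogonal map, which has the same volume.\<close>

lemma lborel_distr_reflect: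
  fixes v :: "real^'n::{finite,wellorder}"
  shows "distr lborel borel (reflect v) = lborel"
proof (rule lborel_eqI[symmetric])
  fix l u :: "real^'n::_" assume lu: "\<And>b. b \<in> Basis \<Longrightarrow> l \<bullet> b \<le> u \<bullet> b"
  have im: "reflect v -` box l u = reflect v ` box l u"
    by (auto simp: image_iff reflect_reflect intro: reflect_reflect[symmetric])
  have m: "reflect v ` box l u \<in> sets borel"
    unfolding im[symmetric] using measurable_sets[OF reflect_borel, of "box l u" v] by simp
  have lm: "reflect v ` box l u \<in> lmeasurable"
    by (rule measurable_orthogonal_image[OF orthogonal_reflect]) simp
  have "emeasure (distr lborel borel (reflect v)) (box l u) = emeasure lborel (reflect v ` box l u)"
    by (subst emeasure_distr) (simp_all add: im)
  also have "\<dots> = emeasure lebesgue (reflect v ` box l u)" using m by simp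
  also have "\<dots> = ennreal (measure lebesgue (reflect v ` box l u))"
    by (rule emeasure_eq_ennreal_measure[OF fmeasurableD2[OF lm]])
  also have "\<dots> = ennreal (measure lebesgue (box l u))"
    by (subst measure_orthogonal_image[OF orthogonal_reflect]) simp_all
  also have "\<dots> = emeasure lebesgue (box l u)"
    by (rule emeasure_eq_ennreal_measure[symmetric, OF fmeasurableD2]) simp
  also have "\<dots> = ennreal (\<Prod>b\<in>Basis. (u - l) \<bullet> b)"
    by (simp add: emeasure_lborel_box lu)
  finally show "emeasure (distr lborel borel (reflect v)) (box l u) = ennreal (\<Prod>b\<in>Basis. (u - l) \<bullet> b)" .
qed simp

lemma integral_lborel_reflect:
  fixes v :: "real^'n::{finite,wellorder}" and f :: "real^'n::_ \<Rightarrow> 'b::euclidean_space"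
  assumes [measurable]: "f \<in> borel_measurable borel"
  shows "(LINT x|lborel. f (reflect v x)) = (LINT x|lborel. f x)"
proof -
  have "(LINT x|lborel. f x) = (LINT x|distr lborel borel (reflect v). f x)"
    by (simp add: lborel_distr_reflect)
  also have "\<dots> = (LINT x|lborel. f (reflect v x))"
    by (rule integral_distr) simp_all
  finally show ?thesis ..
qed

section \<open>Newton's theorem for radial densities\<close>

lemma sphere_area_3: "sphere_area TYPE(real^3) = 4 * pi"
  by (simp add: sphere_area_def content_ball eval_unit_ball_vol)

locale radial_source =
  fixes f :: "real \<Rightarrow> real"
  assumes f_borel[measurable]: "f \<in> borel_measurable borel"
    and f_nonneg: "\<And>s. f s \<ge> 0"
    and f_integrable: "integrable lborel (\<lambda>x::real^3. f (norm x))"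
begin

text \<open>The mass per unit radius. At negative arguments \<open>f\<close> says nothing about the
  density, and the cutoff secures integrability on the whole line.\<close>

definition shell :: "real \<Rightarrow> real" where
  "shell s = indicator {0<..} s * (4 * pi * s ^ 2 * f s)"

lemma shell_borel[measurable]: "shell \<in> borel_measurable borel"
  unfolding shell_def by measurable

lemma shell_integrable: "integrable lborel shell"
proof -
  have "integrable lborel (\<lambda>s. indicator {0<..} s * (s ^ (DIM(real^3) - 1) * f s))"
    using f_integrable by (subst (asm) integrable_radial_iff) simp_all
  then have "integrable lborel (\<lambda>s. (4 * pi) * (indicator {0<..} s * (s ^ 2 * f s)))"
    by (intro integrable_mult_right) simp
  also have "(\<lambda>s. (4 * pi) * (indicator {0<..} s * (s ^ 2 * f s))) = shell"
    by (simp add: shell_def fun_eq_iff)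
  finally show ?thesis .
qed

sublocale mass_function shell
  by standard (auto intro: shell_integrable simp: shell_def f_nonneg)

lemma integral_radial_3:
  fixes h :: "real \<Rightarrow> real"
  assumes [measurable]: "h \<in> borel_measurable borel" and "integrable lborel (\<lambda>x::real^3. h (norm x))"
  shows "(LINT x|lborel. h (norm (x::real^3))) = (LINT s|lborel. indicator {0<..} s * (4 * pi * s ^ 2 * h s))"
proof -
  have "(LINT x|lborel. h (norm (x::real^3))) = 4 * pi * (LINT s|lborel. indicator {0<..} s * (s ^ 2 * h s))"
    using integral_radial[OF assms] by (simp add: sphere_area_3)
  also have "\<dots> = (LINT s|lborel. 4 * pi * (indicator {0<..} s * (s ^ 2 * h s)))" by simp
  also have "\<dots> = (LINT s|lborel. indicator {0<..} s * (4 * pi * s ^ 2 * h s))"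
    by (intro Bochner_Integration.integral_cong) auto
  finally show ?thesis .
qed

lemma integrable_source_mult:
  fixes h :: "real^3 \<Rightarrow> real"
  assumes "h \<in> borel_measurable borel" "\<And>x. \<bar>h x\<bar> \<le> 1"
  shows "integrable lborel (\<lambda>x. f (norm x) * h x)"
  by (rule Bochner_Integration.integrable_bound[OF f_integrable])
    (use assms in \<open>auto simp: abs_mult f_nonneg intro!: mult_left_le\<close>)

lemma mass_eq_ball_integral: "mass r = (LINT y|lborel. f (norm (y::real^3)) * indicator {..r} (norm y))"
proof -
  have "(LINT y|lborel. f (norm (y::real^3)) * indicator {..r} (norm y)) = (LINT s|lborel. indicator {0<..} s * (4 * pi * s ^ 2 * (f s * indicator {..r} s)))"
    by (rule integral_radial_3) (auto intro!: integrable_source_mult simp: indicator_def)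
  also have "\<dots> = mass r"
    unfolding mass_def set_lebesgue_integral_def shell_def
    by (intro Bochner_Integration.integral_cong) (auto simp: indicator_def)
  finally show ?thesis ..
qed

text \<open>The kernel is split at distance 1. The near part is a translate of a fixed integrable
  function, the far part is at most 1 on a ball, so the inner integral is bounded independently of
  y. This justifies exchanging the integrals in x and y.\<close>

lemma kernel_integrable:
  "integrable (lborel \<Otimes>\<^sub>M lborel) (\<lambda>(y::real^3, x::real^3). f (norm y) * (indicator {..S} (norm x) / norm (x - y) ^ 2))"
proof -
  define F where "F = (\<lambda>(y::real^3, x::real^3). f (norm y) * (indicator {..S} (norm x) / norm (x - y) ^ 2))"
  define k where "k z = indicator {..1} (norm z) / norm z ^ 2" for z :: "real^3"
  have [measurable]: "F \<in> borel_measurable (borel \<Otimes>\<^sub>M borel)" "k \<in> borel_measurable borel"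
    unfolding F_def k_def by measurable
  have k: "integrable lborel k"
    using integrable_inverse_norm_power[of 1, where 'a = "real^3"] by (simp add: k_def[abs_def])
  have b: "integrable lborel (\<lambda>x::real^3. indicator {..S} (norm x) :: real)"
    by (rule integrable_bounded_support[of _ S 1]) (auto simp: indicator_def)
  define C where "C = (LINT z|lborel. k z) + (LINT x|lborel. indicator {..S} (norm (x::real^3)))"
  have inner: "integrable lborel (\<lambda>x. indicator {..S} (norm x) / norm (x - y) ^ 2)"
    "(LINT x|lborel. indicator {..S} (norm x) / norm (x - y) ^ 2) \<le> C" for y :: "real^3"
  proof -
    have ky: "integrable lborel (\<lambda>x. k (x + (- y)))"
    proof -
      have "integrable (distr lborel borel ((+) (- y))) k" using k by (simp add: lborel_distr_plus)
      then show ?thesis by (subst (asm) integrable_distr_eq) (simp_all add: add.commute)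
    qed
    have le: "indicator {..S} (norm x) / norm (x - y) ^ 2 \<le> k (x + (- y)) + indicator {..S} (norm x)" for x
    proof (cases "norm (x - y) \<le> 1")
      case True
      then show ?thesis by (auto simp: k_def indicator_def)
    next
      case False
      then have "1 \<le> norm (x - y) ^ 2" by simp
      then have "1 / norm (x - y) ^ 2 \<le> 1" by (auto simp: divide_le_eq)
      moreover have "k (x + (- y)) = 0" using False by (simp add: k_def)
      ultimately show ?thesis by (auto simp: indicator_def)
    qed
    show I: "integrable lborel (\<lambda>x. indicator {..S} (norm x) / norm (x - y) ^ 2)"
    proof (rule Bochner_Integration.integrable_bound[OF Bochner_Integration.integrable_add[OF ky b]])
      show "AE x in lborel. norm (indicator {..S} (norm x) / norm (x - y) ^ 2) \<le> norm (k (x + (- y)) + indicator {..S} (norm x))"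
        using le by (intro AE_I2) (auto intro: order_trans[OF _ abs_ge_self])
    qed simp
    have "(LINT x|lborel. indicator {..S} (norm x) / norm (x - y) ^ 2) \<le> (LINT x|lborel. k (x + (- y)) + indicator {..S} (norm x))"
      by (intro integral_mono I Bochner_Integration.integrable_add ky b le)
    also have "\<dots> = (LINT x|lborel. k (x + (- y))) + (LINT x|lborel. indicator {..S} (norm (x::real^3)))"
      by (rule Bochner_Integration.integral_add[OF ky b])
    also have "\<dots> = C" by (simp only: C_def integral_lborel_translate)
    finally show "(LINT x|lborel. indicator {..S} (norm x) / norm (x - y) ^ 2) \<le> C" .
  qed
  have [measurable]: "(\<lambda>(y, x). norm (F (y, x))) \<in> borel_measurable (lborel \<Otimes>\<^sub>M lborel)"
    by (simp add: case_prod_beta')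
  have "integrable (lborel \<Otimes>\<^sub>M lborel) F"
  proof (rule lborel_pair.Fubini_integrable)
    show "F \<in> borel_measurable (lborel \<Otimes>\<^sub>M lborel)" by simp
    show "AE y in lborel. integrable lborel (\<lambda>x. F (y, x))"
      unfolding F_def prod.case by (intro AE_I2 integrable_mult_right inner(1))
    show "integrable lborel (\<lambda>y. LINT x|lborel. norm (F (y, x)))"
    proof (rule Bochner_Integration.integrable_bound)
      show "integrable lborel (\<lambda>y::real^3. f (norm y) * C)" by (intro integrable_mult_left f_integrable)
      show "(\<lambda>y. LINT x|lborel. norm (F (y, x))) \<in> borel_measurable lborel"
        by (rule lborel.borel_measurable_lebesgue_integral) simp
      show "AE y in lborel. norm (LINT x|lborel. norm (F (y, x))) \<le> norm (f (norm y) * C)"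
      proof (rule AE_I2)
        fix y :: "real^3"
        have "(LINT x|lborel. norm (F (y, x))) = (LINT x|lborel. f (norm y) * (indicator {..S} (norm x) / norm (x - y) ^ 2))"
          by (intro Bochner_Integration.integral_cong) (auto simp: F_def abs_mult f_nonneg)
        also have "\<dots> = f (norm y) * (LINT x|lborel. indicator {..S} (norm x) / norm (x - y) ^ 2)"
          by (rule integral_mult_right_zero)
        also have "\<dots> \<le> f (norm y) * C" by (intro mult_left_mono inner f_nonneg)
        finally show "norm (LINT x|lborel. norm (F (y, x))) \<le> norm (f (norm y) * C)"
          by (subst real_norm_def, subst abs_of_nonneg) (auto intro!: integral_nonneg_AE)
      qed
    qed
  qed
  then show ?thesis by (simp add: F_def)
qed

lemma AE_kernel_integrable: "AE x::real^3 in lborel. integrable lborel (\<lambda>y::real^3. f (norm y) / norm (x - y) ^ 2)"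
proof -
  have "AE x::real^3 in lborel. norm x \<le> real n \<longrightarrow> integrable lborel (\<lambda>y::real^3. f (norm y) / norm (x - y) ^ 2)" for n
  proof -
    have "integrable (lborel \<Otimes>\<^sub>M lborel) (\<lambda>(x::real^3, y::real^3). f (norm y) * (indicator {..real n} (norm x) / norm (x - y) ^ 2))"
      using lborel_pair.integrable_product_swap[OF kernel_integrable[of "real n"]] by simp
    from lborel_pair.AE_integrable_fst'[OF this] show ?thesis
      by eventually_elim (rule impI, simp)
  qed
  then have "AE x::real^3 in lborel. \<forall>n. norm x \<le> real n \<longrightarrow> integrable lborel (\<lambda>y::real^3. f (norm y) / norm (x - y) ^ 2)"
    by (subst AE_all_countable) blast
  then show ?thesis
  proof eventually_elim
    case (elim x)
    obtain n where "norm x \<le> real n" using real_arch_simple by blast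
    with elim show ?case by blast
  qed
qed

text \<open>The gradient of the potential for the Borel profile and \<open>lborel\<close>;
  \<open>newton_gradient_eq_grav\<close> identifies it with \<open>newton_gradient\<close>.\<close>

definition grav :: "real^3 \<Rightarrow> real^3" where
  "grav x = (LINT y|lborel. (f (norm y) / norm (x - y) ^ 3) *\<^sub>R (x - y))"

lemma grav_borel[measurable]: "grav \<in> borel_measurable borel"
proof -
  have "(\<lambda>(x::real^3, y::real^3). (f (norm y) / norm (x - y) ^ 3) *\<^sub>R (x - y)) \<in> borel_measurable (borel \<Otimes>\<^sub>M lborel)"
    by measurable
  then show ?thesis
    unfolding grav_def[abs_def] by (intro lborel.borel_measurable_lebesgue_integral) simp
qed

lemma grav_reflect: "grav (reflect v x) = reflect v (grav x)"
proof -
  have "grav (reflect v x) = (LINT y|lborel. (f (norm (reflect v y)) / norm (reflect v x - reflect v y) ^ 3) *\<^sub>R (reflect v x - reflect v y))"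
    unfolding grav_def by (rule integral_lborel_reflect[symmetric]) measurable
  also have "\<dots> = (LINT y|lborel. reflect v ((f (norm y) / norm (x - y) ^ 3) *\<^sub>R (x - y)))"
    by (simp add: linear_diff[OF linear_reflect, symmetric] norm_reflect linear_cmul[OF linear_reflect])
  \<comment> \<open>A reflection is invertible, so it can be taken out of the integral even at
    points where the integral diverges and has the default value 0.\<close>
  also have "\<dots> = reflect v (grav x)"
    unfolding grav_def using linear_reflect
    by (intro integral_bounded_linear'[of _ "reflect v"]) (auto simp: linear_conv_bounded_linear reflect_reflect)
  finally show ?thesis .
qed

definition pull :: "real \<Rightarrow> real" where "pull t = grav (t *\<^sub>R axis 1 1) \<bullet> axis 1 1"

lemma pull_borel[measurable]: "pull \<in> borel_measurable borel"
  unfolding pull_def by measurable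

text \<open>Reflections fixing \<open>x\<close> force the field to be parallel to \<open>x\<close>; reflections exchanging points
  of equal norm make its strength radial.\<close>

lemma grav_inner: "grav x \<bullet> x = norm x * pull (norm x)"
proof -
  define y :: "real^3" where "y = norm x *\<^sub>R axis 1 1"
  have n: "norm x = norm y" by (simp add: y_def)
  have "grav y \<bullet> y = reflect (x - y) (grav x) \<bullet> reflect (x - y) x"
    by (simp add: grav_reflect[symmetric] reflect_swap[OF n])
  also have "\<dots> = grav x \<bullet> x" by (rule inner_reflect)
  finally show ?thesis by (simp add: y_def pull_def)
qed

lemma grav_radial: "x \<noteq> 0 \<Longrightarrow> grav x = (pull (norm x) / norm x) *\<^sub>R x"
proof -
  assume x: "x \<noteq> 0"
  \<comment> \<open>The component of the field orthogonal to x. Reflection along it fixes x, hence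
    fixes the field, and yet reverses this component.\<close>
  define v where "v = grav x - ((grav x \<bullet> x) / (x \<bullet> x)) *\<^sub>R x"
  have xv: "x \<bullet> v = 0" using x by (simp add: v_def inner_diff_right inner_commute)
  have "v = 0"
  proof (rule ccontr)
    assume v: "v \<noteq> 0"
    have "reflect v (grav x) = grav x"
      using grav_reflect[of v x] reflect_fixed[OF xv] by simp
    then have "(2 * (grav x \<bullet> v) / (v \<bullet> v)) *\<^sub>R v = 0" by (simp add: reflect_def)
    then have "grav x \<bullet> v = 0" using v by simp
    moreover have "v \<bullet> v = grav x \<bullet> v"
      using xv by (subst (1) v_def) (simp add: inner_diff_left)
    ultimately show False using v by simp
  qed
  then have "grav x = ((grav x \<bullet> x) / (x \<bullet> x)) *\<^sub>R x" by (simp add: v_def)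
  also have "(grav x \<bullet> x) / (x \<bullet> x) = pull (norm x) / norm x"
    using x by (simp add: grav_inner power2_norm_eq_inner[symmetric] power2_eq_square)
  finally show ?thesis .
qed

text \<open>The averaged flux of a unit point mass at y through the spheres of a shell. The
  divergence of the kernel sits at y, so testing with a radial ramp evaluates the ramp there: 4 pi
  if y lies inside the shell, 0 if outside, interpolated in between.\<close>

lemma kernel_ramp_flux:
  fixes y :: "real^3"
  assumes h: "h > 0" and s: "s > 0"
  shows "(LINT x|lborel. ((x - y) \<bullet> x) / norm x * (indicator {s<..<s + h} (norm x) / h) / norm (x - y) ^ 3) = 4 * pi * ramp s h (norm y)"
proof -
  define G where "G z = - ((indicator {s<..<s + h} (norm (z + y)) / h / norm (z + y)) *\<^sub>R (z + y))" for z :: "real^3"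
  have "lipschitz_on_balls (\<lambda>z. norm (z + y))" using lipschitz_on_balls_norm_diff[of "- y"] by simp
  then have lip: "lipschitz_on_balls (\<lambda>z. ramp s h (norm (z + y)))"
    by (rule lipschitz_on_balls_compose[OF ramp_lipschitz[OF h]])
  have big: "norm (z + y) > s + h" if "norm z > s + h + norm y" for z
    using norm_triangle_ineq4[of "z + y" y] that by simp
  have shift: "AE z in lborel. norm (z + y) \<noteq> c" for c
  proof -
    have "AE x::real^3 in distr lborel borel ((+) y). norm x \<noteq> c" using AE_norm_neq[of c] by (simp only: lborel_distr_plus)
    then show ?thesis by (subst (asm) AE_distr_iff) (simp_all add: add.commute)
  qed
  have "(LINT z|lborel. (z \<bullet> G z) / norm z ^ DIM(real^3)) = - sphere_area TYPE(real^3) * ramp s h (norm (0 + y))"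
  proof (rule integral_kernel_gradient[OF lip, of "s + h + norm y" G "1 / h"])
    show "ramp s h (norm (z + y)) = 0" if "norm z > s + h + norm y" for z
      using big[OF that] by (intro ramp_eq_0[OF h]) simp
    show "G z = 0" if "norm z > s + h + norm y" for z using big[OF that] by (simp add: G_def)
    show "norm (G z) \<le> 1 / h" for z using h by (simp add: G_def indicator_def)
    show "G \<in> borel_measurable borel" unfolding G_def by measurable
    show "AE z in lborel. \<forall>e\<in>Basis. ((\<lambda>t. ramp s h (norm (z + t *\<^sub>R e + y))) has_real_derivative G z \<bullet> e) (at 0)"
      using shift[of 0] shift[of s] shift[of "s + h"]
    proof eventually_elim
      case (elim z)
      show ?case
      proof
        fix e :: "real^3"
        have "((\<lambda>t. ramp s h (norm ((z + y) + t *\<^sub>R e))) has_real_derivative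
          (- indicator {s<..<s + h} (norm (z + y)) / h) * ((e \<bullet> (z + y)) / norm (z + y))) (at 0)"
          using elim ramp_has_derivative[OF h, of "norm ((z + y) + 0 *\<^sub>R e)" s]
          by (intro DERIV_chain2[of "ramp s h"] has_real_derivative_norm_line) auto
        then show "((\<lambda>t. ramp s h (norm (z + t *\<^sub>R e + y))) has_real_derivative G z \<bullet> e) (at 0)"
          by (simp add: G_def inner_commute add_ac)
      qed
    qed
  qed
  then have "(LINT z|lborel. (z \<bullet> G z) / norm z ^ 3) = - (4 * pi * ramp s h (norm y))"
    by (simp add: sphere_area_3)
  then have "(LINT x|lborel. ((x + (- y)) \<bullet> G (x + (- y))) / norm (x + (- y)) ^ 3) = - (4 * pi * ramp s h (norm y))"
    by (subst integral_lborel_translate)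
  then have "- (LINT x|lborel. ((x + (- y)) \<bullet> G (x + (- y))) / norm (x + (- y)) ^ 3) = 4 * pi * ramp s h (norm y)"
    by simp
  then show ?thesis
    unfolding Bochner_Integration.integral_minus[symmetric]
    by (simp add: G_def mult_ac)
qed

text \<open>The flux of the field through the sphere of radius t, divided by 4 pi; this is what has
  to be identified with the enclosed mass.\<close>

definition pull2 :: "real \<Rightarrow> real" where "pull2 t = t ^ 2 * pull t"

lemma pull2_borel[measurable]: "pull2 \<in> borel_measurable borel"
  unfolding pull2_def by measurable

text \<open>Superposition of \<open>kernel_ramp_flux\<close> over all source points with weight
  \<open>f\<close>. Exchanging the integrals produces the radial component of the field, and polar
  coordinates turn it into \<open>pull2\<close>.\<close>

lemma pull2_flux:
  assumes h: "h > 0" and s: "s > 0"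
  shows "set_integrable lborel {s<..<s + h} pull2"
    and "(LINT t:{s<..<s + h}|lborel. pull2 t) = h * (LINT y|lborel. f (norm (y::real^3)) * ramp s h (norm y))"
proof -
  define P where "P = (\<lambda>(y::real^3, x::real^3). f (norm y) * (((x - y) \<bullet> x) / norm x * (indicator {s<..<s + h} (norm x) / h) / norm (x - y) ^ 3))"
  have [measurable]: "P \<in> borel_measurable (borel \<Otimes>\<^sub>M borel)" unfolding P_def by measurable
  have I: "integrable (lborel \<Otimes>\<^sub>M lborel) P"
  proof (rule Bochner_Integration.integrable_bound)
    show "integrable (lborel \<Otimes>\<^sub>M lborel) (\<lambda>yx. 1 / h * (case yx of (y::real^3, x::real^3) \<Rightarrow> f (norm y) * (indicator {..s + h} (norm x) / norm (x - y) ^ 2)))"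
      by (intro integrable_mult_right kernel_integrable)
    show "AE yx in lborel \<Otimes>\<^sub>M lborel. norm (P yx) \<le> norm (1 / h * (case yx of (y, x) \<Rightarrow> f (norm y) * (indicator {..s + h} (norm x) / norm (x - y) ^ 2)))"
    proof (rule AE_I2)
      fix yx :: "(real^3) \<times> (real^3)"
      obtain y x where yx: "yx = (y, x)" by (cases yx)
      have c: "\<bar>((x - y) \<bullet> x) / norm x\<bar> \<le> norm (x - y)" by (rule abs_inner_div_norm)
      have i: "\<bar>indicator {s<..<s + h} (norm x) / h\<bar> \<le> indicator {..s + h} (norm x) / h"
        using h by (auto simp: indicator_def)
      have "norm (P yx) = f (norm y) * (\<bar>((x - y) \<bullet> x) / norm x\<bar> * \<bar>indicator {s<..<s + h} (norm x) / h\<bar> / norm (x - y) ^ 3)"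
        by (simp add: P_def yx abs_mult f_nonneg)
      also have "\<dots> \<le> f (norm y) * (norm (x - y) * (indicator {..s + h} (norm x) / h) / norm (x - y) ^ 3)"
        using c i by (intro mult_left_mono divide_right_mono mult_mono f_nonneg) auto
      also have "\<dots> = 1 / h * (f (norm y) * (indicator {..s + h} (norm x) / norm (x - y) ^ 2))"
        by (cases "x = y") (auto simp: power2_eq_square power3_eq_cube)
      finally show "norm (P yx) \<le> norm (1 / h * (case yx of (y, x) \<Rightarrow> f (norm y) * (indicator {..s + h} (norm x) / norm (x - y) ^ 2)))"
        unfolding yx prod.case real_norm_def by (rule order_trans[OF _ abs_ge_self])
    qed
  qed simp_all
  define J where "J t = pull t * (indicator {s<..<s + h} t / h)" for t
  have [measurable]: "J \<in> borel_measurable borel" unfolding J_def by measurable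
  have inner: "AE x in lborel. (LINT y|lborel. P (y, x)) = J (norm x)"
    using AE_kernel_integrable AE_norm_neq[of 0]
  proof eventually_elim
    case (elim x)
    have "integrable lborel (\<lambda>y::real^3. (f (norm y) / norm (x - y) ^ 3) *\<^sub>R (x - y))"
    proof (rule Bochner_Integration.integrable_bound[OF elim(1)])
      show "AE y in lborel. norm ((f (norm y) / norm (x - y) ^ 3) *\<^sub>R (x - y)) \<le> norm (f (norm y) / norm (x - y) ^ 2)"
      proof (rule AE_I2)
        fix y
        show "norm ((f (norm y) / norm (x - y) ^ 3) *\<^sub>R (x - y)) \<le> norm (f (norm y) / norm (x - y) ^ 2)"
          by (cases "x = y") (auto simp: power2_eq_square power3_eq_cube)
      qed
    qed measurable
    then have "(LINT y|lborel. ((f (norm y) / norm (x - y) ^ 3) *\<^sub>R (x - y)) \<bullet> x) = grav x \<bullet> x"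
      unfolding grav_def by (rule integral_inner_left)
    then have "(LINT y|lborel. (indicator {s<..<s + h} (norm x) / h / norm x) * (((f (norm y) / norm (x - y) ^ 3) *\<^sub>R (x - y)) \<bullet> x))
      = (indicator {s<..<s + h} (norm x) / h / norm x) * (norm x * pull (norm x))"
      by (simp only: integral_mult_right_zero grav_inner)
    also have "(\<lambda>y. (indicator {s<..<s + h} (norm x) / h / norm x) * (((f (norm y) / norm (x - y) ^ 3) *\<^sub>R (x - y)) \<bullet> x)) = (\<lambda>y. P (y, x))"
      by (simp add: P_def fun_eq_iff mult_ac)
    also have "(indicator {s<..<s + h} (norm x) / h / norm x) * (norm x * pull (norm x)) = J (norm x)"
      using elim(2) by (simp add: J_def)
    finally show ?case .
  qed
  have iJ: "integrable lborel (\<lambda>x::real^3. J (norm x))"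
  proof -
    have "integrable lborel (\<lambda>x. LINT y|lborel. P (y, x))"
      using lborel_pair.integrable_snd[of "\<lambda>y x. P (y, x)"] I by simp
    then show ?thesis
      by (rule integrable_cong_AE_imp) (use inner in auto)
  qed
  have J: "indicator {0<..} t * (4 * pi * t ^ 2 * J t) = (4 * pi / h) * (indicator {s<..<s + h} t *\<^sub>R pull2 t)" for t
    using s by (auto simp: J_def pull2_def indicator_def)
  have "integrable lborel (\<lambda>t. indicator {0<..} t * (t ^ (DIM(real^3) - 1) * J t))"
    using iJ by (subst (asm) integrable_radial_iff) simp_all
  then have "integrable lborel (\<lambda>t. (4 * pi) * (indicator {0<..} t * (t ^ 2 * J t)))"
    by (intro integrable_mult_right) simp
  also have "(\<lambda>t. (4 * pi) * (indicator {0<..} t * (t ^ 2 * J t))) = (\<lambda>t. (4 * pi / h) * (indicator {s<..<s + h} t *\<^sub>R pull2 t))"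
    using J by (simp add: fun_eq_iff mult_ac)
  finally have "integrable lborel (\<lambda>t. (h / (4 * pi)) * ((4 * pi / h) * (indicator {s<..<s + h} t *\<^sub>R pull2 t)))"
    by (rule integrable_mult_right)
  then show "set_integrable lborel {s<..<s + h} pull2"
    using h by (simp add: set_integrable_def)
  have "4 * pi / h * (LINT t:{s<..<s + h}|lborel. pull2 t) = (LINT t|lborel. indicator {0<..} t * (4 * pi * t ^ 2 * J t))"
    unfolding J set_lebesgue_integral_def by simp
  also have "\<dots> = (LINT x|lborel. J (norm (x::real^3)))"
    by (rule integral_radial_3[symmetric, OF _ iJ]) simp
  also have "\<dots> = (LINT x|lborel. LINT y|lborel. P (y, x))"
  proof (rule integral_cong_AE)
    show "AE x in lborel. J (norm x) = (LINT y|lborel. P (y, x))" using inner by eventually_elim simp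
    show "(\<lambda>x. LINT y|lborel. P (y, x)) \<in> borel_measurable lborel"
      using lborel_pair.integrable_snd[of "\<lambda>y x. P (y, x)"] I by (intro borel_measurable_integrable) simp
  qed simp
  also have "\<dots> = (LINT y|lborel. LINT x|lborel. P (y, x))"
    by (rule lborel_pair.Fubini_integral) (use I in simp)
  also have "\<dots> = (LINT y|lborel. f (norm (y::real^3)) * (4 * pi * ramp s h (norm y)))"
  proof (rule Bochner_Integration.integral_cong[OF refl])
    fix y :: "real^3"
    have "(LINT x|lborel. P (y, x)) = f (norm y) * (LINT x|lborel. ((x - y) \<bullet> x) / norm x * (indicator {s<..<s + h} (norm x) / h) / norm (x - y) ^ 3)"
      unfolding P_def prod.case by (rule integral_mult_right_zero)
    then show "(LINT x|lborel. P (y, x)) = f (norm y) * (4 * pi * ramp s h (norm y))"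
      by (simp only: kernel_ramp_flux[OF h s])
  qed
  also have "\<dots> = 4 * pi * (LINT y|lborel. f (norm (y::real^3)) * ramp s h (norm y))"
    by (subst integral_mult_right_zero[symmetric]) (simp add: mult_ac)
  finally show "(LINT t:{s<..<s + h}|lborel. pull2 t) = h * (LINT y|lborel. f (norm (y::real^3)) * ramp s h (norm y))"
    using h by (simp add: field_simps)
qed

lemma pull2_integrable:
  assumes "0 < a"
  shows "set_integrable lborel {a..b} pull2"
proof (cases "a \<le> b")
  case True
  then have "set_integrable lborel {a / 2<..<a / 2 + (b + 1 - a / 2)} pull2"
    using assms by (intro pull2_flux(1)) auto
  then show ?thesis by (rule set_integrable_subset) (use assms True in auto)
qed simp

text \<open>By \<open>pull2_flux\<close> the average of \<open>pull2\<close> from a to b is the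
  integral of the density against a ramp; by \<open>integral_ramp\<close> this is also the average
  of \<open>mass\<close>.\<close>

lemma AE_pull2_eq_mass: "AE t in lborel. 0 < t \<longrightarrow> pull2 t = mass t"
proof (rule AE_eq_if_interval_integrals_eq[OF pull2_integrable])
  fix a b :: real assume a: "0 < a"
  have "set_integrable lborel {a / 2<..a / 2 + (\<bar>b\<bar> + 1)} mass"
    unfolding mass_eq_ball_integral[abs_def] by (intro set_integrable_ball_integral f_integrable) simp
  then show "set_integrable lborel {a..b} mass"
    by (rule set_integrable_subset) (use a in auto)
  assume ab: "a < b"
  have "(LINT t:{a<..b}|lborel. pull2 t) = (LINT t:{a<..<a + (b - a)}|lborel. pull2 t)"
    by (rule set_integral_discrete_difference[of "{b}"]) auto
  also have "\<dots> = (b - a) * (LINT y|lborel. f (norm (y::real^3)) * ramp a (b - a) (norm y))"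
    using a ab by (intro pull2_flux(2)) auto
  also have "\<dots> = (LINT t:{a<..b}|lborel. mass t)"
    using integral_ramp[OF f_integrable, of "b - a" a] ab by (simp add: mass_eq_ball_integral)
  finally show "(LINT t:{a<..b}|lborel. pull2 t) = (LINT t:{a<..b}|lborel. mass t)" .
qed

lemma AE_grav_eq: "AE x in lborel. grav x = (mass (norm x) / norm x ^ 3) *\<^sub>R x"
  using AE_radial[OF AE_pull2_eq_mass, where 'a = "real^3"] AE_norm_neq[of 0]
proof eventually_elim
  case (elim x)
  then have "pull (norm x) = mass (norm x) / norm x ^ 2" by (simp add: pull2_def field_simps)
  then show ?case using elim grav_radial[of x] by (simp add: power2_eq_square power3_eq_cube)
qed

end

section \<open>Local estimates\<close>

lemma set_integrable_powr:
  assumes a: "a > -1" and b: "b > 0"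
  shows "set_integrable lborel {0<..b} (\<lambda>s::real. s powr a)"
    "(LINT s:{0<..b}|lborel. s powr a) = b powr (a + 1) / (a + 1)"
proof -
  have "((\<lambda>s. s powr a) has_integral (b powr (a + 1) / (a + 1))) {0..b}"
    using a b by (intro has_integral_powr_from_0) auto
  then have "((\<lambda>s. indicator {0..b} s * s powr a) has_integral (b powr (a + 1) / (a + 1))) UNIV"
  proof (subst (asm) has_integral_restrict_UNIV[symmetric])
    have "(\<lambda>s. if s \<in> {0..b} then s powr a else 0) = (\<lambda>s. indicator {0..b} s * s powr a)"
      by (auto simp: indicator_def fun_eq_iff)
    moreover assume "((\<lambda>s. if s \<in> {0..b} then s powr a else 0) has_integral (b powr (a + 1) / (a + 1))) UNIV"
    ultimately show ?thesis by simp
  qed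
  then have "has_bochner_integral lborel (\<lambda>s. indicator {0..b} s * s powr a) (b powr (a + 1) / (a + 1))"
    using a b by (intro has_bochner_integral_nn_integral nn_integral_has_integral_lborel) auto
  then have *: "set_integrable lborel {0..b} (\<lambda>s::real. s powr a)"
    "(LINT s:{0..b}|lborel. s powr a) = b powr (a + 1) / (a + 1)"
    by (auto simp: set_integrable_def set_lebesgue_integral_def has_bochner_integral_iff)
  show "set_integrable lborel {0<..b} (\<lambda>s::real. s powr a)"
    by (rule set_integrable_subset[OF *(1)]) auto
  show "(LINT s:{0<..b}|lborel. s powr a) = b powr (a + 1) / (a + 1)"
    unfolding *(2)[symmetric] by (rule set_integral_discrete_difference[of "{0}"]) auto
qed

text \<open>Young's inequality in disguise: one of the two terms on the right dominates, according to which
  of \<open>x powr (q - 1)\<close> and the corresponding power of \<open>y\<close> is larger. The exponent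
  \<open>s\<close> is determined by the requirement that the second case produce exactly \<open>x powr p\<close>.\<close>

lemma powr_split_bound:
  fixes x y p q s :: real
  assumes x: "x \<ge> 0" and y: "y > 0" and q: "1 < q" and pq: "q < p"
    and s: "s = q * (p - 1) / (2 * (p - q))"
  shows "x powr q * y powr (- (q / 2)) \<le> y powr (- s) * x + x powr p"
proof (cases "x = 0")
  case True
  then show ?thesis using q pq by simp
next
  case False
  then have x0: "x > 0" using x by simp
  define d where "d = s - q / 2"
  have d: "d = q * (q - 1) / (2 * (p - q))"
    unfolding d_def s using pq by (simp add: field_simps)
  have d0: "d > 0" unfolding d using q pq by (intro divide_pos_pos mult_pos_pos) auto
  show ?thesis
  proof (cases "x powr (q - 1) \<le> y powr (- d)")
    case True
    have "x powr q = x powr (q - 1) * x" using x0 by (simp add: powr_diff)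
    then have "x powr q * y powr (- (q / 2)) = x powr (q - 1) * (x * y powr (- (q / 2)))" by simp
    also have "\<dots> \<le> y powr (- d) * (x * y powr (- (q / 2)))"
      using True x by (intro mult_right_mono) auto
    also have "\<dots> = y powr (- d + - (q / 2)) * x"
      by (subst powr_add) (simp add: mult_ac)
    also have "- d + - (q / 2) = - s" by (simp add: d_def)
    finally show ?thesis using powr_ge_zero[of x p] by linarith
  next
    case False
    have e: "d * (q / (2 * d)) = q / 2" "(q - 1) * (q / (2 * d)) = p - q"
      using d0 q pq by (simp add: field_simps, simp add: d field_simps)
    have "y powr (- (q / 2)) = (y powr (- d)) powr (q / (2 * d))"
      by (simp only: powr_powr mult_minus_left e(1))
    also have "\<dots> \<le> (x powr (q - 1)) powr (q / (2 * d))"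
      using False d0 q by (intro powr_mono2) auto
    also have "\<dots> = x powr (p - q)" by (simp only: powr_powr e(2))
    finally have "x powr q * y powr (- (q / 2)) \<le> x powr q * x powr (p - q)"
      by (intro mult_left_mono) auto
    also have "\<dots> = x powr p" by (simp add: powr_add[symmetric])
    finally show ?thesis using x y by (simp add: add_increasing)
  qed
qed

lemma powr_add_le:
  fixes a b q :: real
  assumes "a \<ge> 0" "b \<ge> 0" "q \<ge> 0"
  shows "(a + b) powr q \<le> 2 powr q * (a powr q + b powr q)"
proof -
  have "(a + b) powr q \<le> (2 * max a b) powr q" using assms by (intro powr_mono2) auto
  also have "\<dots> = 2 powr q * max a b powr q" using assms by (simp add: powr_mult)
  also have "\<dots> \<le> 2 powr q * (a powr q + b powr q)" by (intro mult_left_mono) (auto simp: max_def)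
  finally show ?thesis .
qed

text \<open>The constant in the bound of the enclosed mass by N r^(3 - 3 / p): a power of the volume
  of the unit ball, as in Hoelder's inequality, doubled because the proof bounds the density by a
  sum of two equally large terms.\<close>

definition conc_const :: "real \<Rightarrow> real" where
  "conc_const p = 2 * (4 / 3 * pi) powr (1 - 1 / p)"

text \<open>\<open>\<sigma>\<close> is the splitting exponent from \<open>powr_split_bound\<close>,
  \<open>\<gamma>\<close> the growth exponent from \<open>mass_concentration\<close>, and
  \<open>\<beta>\<close> the power of the radius left in the mass term. The first summand collects
  the contribution of the density, the second that of the mass.\<close>

definition flow_const :: "real \<Rightarrow> real \<Rightarrow> real \<Rightarrow> real \<Rightarrow> real" where
  "flow_const L p q b =
    (let \<sigma> = q * (p - 1) / (2 * (p - q)); \<gamma> = 3 * (1 - 1 / p); \<beta> = \<gamma> * (q / 2) - 2 * q in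
     (2 * L) powr q * ((4 * pi * b) powr q * ((conc_const p * b powr \<gamma>) powr (1 - \<sigma>) / (1 - \<sigma>) + 1)
       + 4 powr q * conc_const p powr (q / 2) * (4 * pi * (b powr (\<beta> + 3) / (\<beta> + 3)))))"

section \<open>Integrability of a majorant of the Jacobian\<close>

locale flow_in_Lp = radial_source f + radial_flow shell \<mu> \<mu>' L for f \<mu> \<mu>' L +
  fixes p q N :: real
  assumes q: "1 < q" "q < 2" and p: "q / (2 - q) + q < p"
    and Lp: "integrable lborel (\<lambda>x::real^3. f (norm x) powr p)"
    and N: "N \<ge> 0" "N powr p = (LINT x|lborel. f (norm (x::real^3)) powr p)"
begin

lemma p_gt: "p > 2" "p > q" "p > q / (2 - q)"
proof -
  have "q / (2 - q) > 1" using q by simp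
  then show "p > 2" "p > q" using p q by linarith+
  show "p > q / (2 - q)" using p q by linarith
qed

text \<open>A form of Hoelder's inequality on the ball. Either f \<le> 1 / t, or (f t)^(p - 1) \<ge>
  1 and f is at most t^(p - 1) f^p; the sum of both bounds is integrated over the ball and the whole
  space respectively.\<close>

lemma mass_concentration:
  assumes r: "r > 0" and N0: "N > 0"
  shows "mass r \<le> N * (conc_const p * r powr (3 * (1 - 1 / p)))"
proof -
  define V where "V = 4 / 3 * pi * r ^ 3"
  have V: "V > 0" using r by (simp add: V_def)
  have p0: "p > 0" using p_gt by simp
  \<comment> \<open>With this choice both integrated terms equal
    \<open>N * V powr (1 - 1 / p)\<close>.\<close>
  define t where "t = V powr (1 / p) / N"
  have t: "t > 0" using V N0 by (simp add: t_def)
  have pw: "f s \<le> 1 / t + t powr (p - 1) * f s powr p" for s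
  proof (cases "f s \<le> 1 / t")
    case False
    then have ft: "f s * t > 1" using t by (simp add: field_simps)
    then have fs: "f s > 0" using t by (metis less_trans zero_less_mult_pos2 zero_less_one)
    have "1 \<le> (f s * t) powr (p - 1)" using ft p_gt by (intro ge_one_powr_ge_zero) auto
    then have "f s \<le> f s * (f s * t) powr (p - 1)" using fs by simp
    also have "\<dots> = t powr (p - 1) * (f s powr 1 * f s powr (p - 1))"
      using fs t by (simp add: powr_mult)
    also have "f s powr 1 * f s powr (p - 1) = f s powr p" by (subst powr_add[symmetric]) simp
    finally show ?thesis using t by (simp add: add_increasing)
  qed (simp add: add_increasing2)
  have iB: "integrable lborel (\<lambda>y::real^3. 1 / t * indicator {..r} (norm y))"
    by (intro integrable_mult_right integrable_bounded_support[of _ r 1]) (auto simp: indicator_def)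
  have iP: "integrable lborel (\<lambda>y::real^3. t powr (p - 1) * f (norm y) powr p)"
    by (intro integrable_mult_right Lp)
  have "mass r \<le> (LINT y|lborel. 1 / t * indicator {..r} (norm (y::real^3)) + t powr (p - 1) * f (norm y) powr p)"
    unfolding mass_eq_ball_integral
  proof (rule integral_mono)
    show "integrable lborel (\<lambda>y::real^3. f (norm y) * indicator {..r} (norm y))"
      by (rule integrable_source_mult) (auto simp: indicator_def)
    show "integrable lborel (\<lambda>y::real^3. 1 / t * indicator {..r} (norm y) + t powr (p - 1) * f (norm y) powr p)"
      by (rule Bochner_Integration.integrable_add[OF iB iP])
    show "f (norm y) * indicator {..r} (norm y) \<le> 1 / t * indicator {..r} (norm y) + t powr (p - 1) * f (norm y) powr p" for y :: "real^3"
      using pw[of "norm y"] by (auto simp: indicator_def)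
  qed
  also have "\<dots> = 1 / t * (LINT y|lborel. indicator {..r} (norm (y::real^3))) + t powr (p - 1) * N powr p"
    unfolding N(2) by (subst Bochner_Integration.integral_add[OF iB iP]) simp
  also have "(LINT y|lborel. indicator {..r} (norm (y::real^3))) = V"
  proof -
    have "(LINT y|lborel. indicator {..r} (norm (y::real^3))) = (LINT y|lborel. indicator (cball (0::real^3) r) y :: real)"
      by (rule Bochner_Integration.integral_cong) (auto simp: indicator_def)
    then show ?thesis using r by (simp add: content_cball V_def eval_unit_ball_vol)
  qed
  also have "1 / t * V = N * V powr (1 - 1 / p)"
    using V N0 by (simp add: t_def powr_diff)
  also have "t powr (p - 1) * N powr p = N * V powr (1 - 1 / p)"
  proof -
    have "t powr (p - 1) = V powr (1 / p * (p - 1)) / N powr (p - 1)"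
      using V N0 by (simp add: t_def powr_divide powr_powr)
    also have "1 / p * (p - 1) = 1 - 1 / p" using p0 by (simp add: field_simps)
    finally have "t powr (p - 1) * N powr p = V powr (1 - 1 / p) * (N powr p / N powr (p - 1))" by simp
    also have "N powr p / N powr (p - 1) = N"
      using N0 by (simp add: powr_diff[symmetric])
    finally show ?thesis by simp
  qed
  also have "V powr (1 - 1 / p) = (4 / 3 * pi) powr (1 - 1 / p) * r powr (3 * (1 - 1 / p))"
  proof -
    have "r ^ 3 = r powr 3" using r by simp
    then have "(r ^ 3) powr (1 - 1 / p) = r powr (3 * (1 - 1 / p))" by (simp only: powr_powr)
    then show ?thesis using r unfolding V_def by (subst powr_mult) auto
  qed
  finally show ?thesis by (simp add: conc_const_def algebra_simps)
qed

text \<open>A majorant of every Jacobian entry: the diagonal contributes \<open>profile\<close>, the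
  radial derivative contributes \<open>profile'\<close> times x_i x_j / |x|, which is at most the
  radius.\<close>

definition flow_bound :: "real \<Rightarrow> real" where
  "flow_bound s = \<bar>profile s\<bar> + s * \<bar>profile' s\<bar>"

lemma flow_bound_borel[measurable]: "flow_bound \<in> borel_measurable borel"
  unfolding flow_bound_def by measurable

lemma flow_bound_nonneg: "s > 0 \<Longrightarrow> flow_bound s \<ge> 0"
  by (simp add: flow_bound_def)

lemma flow_bound_le:
  assumes s: "s > 0"
  shows "flow_bound s \<le> L * (4 * pi * s * f s * mass s powr (- (1/2)) + 4 * sqrt (mass s) / s ^ 2)"
proof -
  have "flow_bound s \<le> L * sqrt (mass s) / s ^ 2 + s * (L * (shell s * mass s powr (- (1/2)) / s ^ 2 + 3 * sqrt (mass s) / s ^ 3))"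
    unfolding flow_bound_def using s by (intro add_mono profile_bound mult_left_mono profile'_bound) auto
  also have "\<dots> = L * (4 * pi * s * f s * mass s powr (- (1/2)) + 4 * sqrt (mass s) / s ^ 2)"
    using s by (simp add: shell_def field_simps power2_eq_square power3_eq_cube)
  finally show ?thesis .
qed

text \<open>The terms f^q M^(-q/2) and M^(q/2) have degree q/2 under a common scaling of density and
  mass. Dividing by \<open>N\<close> before applying \<open>powr_split_bound\<close> thus releases
  the factor \<open>N powr (q / 2)\<close> and leaves normalised quantities.\<close>

lemma flow_bound_powr_le:
  assumes s: "0 < s" "s \<le> b" and N0: "N > 0"
    and \<sigma>: "\<sigma> = q * (p - 1) / (2 * (p - q))" and \<beta>: "\<beta> = 3 * (1 - 1 / p) * (q / 2) - 2 * q"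
  shows "flow_bound s powr q \<le> (2 * L) powr q * N powr (q / 2) *
    ((4 * pi * b) powr q * ((mass s / N) powr (- \<sigma>) * (f s / N) + (f s / N) powr p)
     + 4 powr q * conc_const p powr (q / 2) * s powr \<beta>)"
proof -
  have c: "conc_const p \<ge> 0" by (simp add: conc_const_def)
  have M: "mass s \<ge> 0" by (rule mass_nonneg)
  have A: "(4 * pi * s * f s * mass s powr (- (1/2))) powr q \<le> N powr (q / 2) *
    ((4 * pi * b) powr q * ((mass s / N) powr (- \<sigma>) * (f s / N) + (f s / N) powr p))"
  \<comment> \<open>At zero mass the left side is 0, because \<open>0 powr x\<close> is 0; the
    splitting inequality is applied at positive mass.\<close>
  proof (cases "mass s = 0")
    case True
    then show ?thesis using N0 f_nonneg[of s] by simp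
  next
    case False
    then have M0: "mass s > 0" using M by simp
    have "(4 * pi * s * f s * mass s powr (- (1/2))) powr q = (4 * pi * s) powr q * (f s powr q * mass s powr (- (q / 2)))"
      using s f_nonneg[of s] by (simp add: powr_mult powr_powr mult.assoc)
    also have "f s powr q * mass s powr (- (q / 2)) = N powr (q / 2) * ((f s / N) powr q * (mass s / N) powr (- (q / 2)))"
    proof -
      have "(f s / N) powr q * (mass s / N) powr (- (q / 2)) = f s powr q * mass s powr (- (q / 2)) / (N powr q * N powr (- (q / 2)))"
        using N0 M0 f_nonneg[of s] by (simp add: powr_divide)
      also have "N powr q * N powr (- (q / 2)) = N powr (q / 2)"
        using N0 by (simp add: powr_add[symmetric])
      finally show ?thesis using N0 by simp
    qed
    also have "(4 * pi * s) powr q * (N powr (q / 2) * ((f s / N) powr q * (mass s / N) powr (- (q / 2))))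
      \<le> (4 * pi * b) powr q * (N powr (q / 2) * ((mass s / N) powr (- \<sigma>) * (f s / N) + (f s / N) powr p))"
    proof (intro mult_mono mult_left_mono powr_split_bound[OF _ _ q(1) p_gt(2) \<sigma>])
      show "(4 * pi * s) powr q \<le> (4 * pi * b) powr q" using s q by (intro powr_mono2) auto
    qed (use N0 M0 f_nonneg[of s] in auto)
    finally show ?thesis by (simp add: mult_ac)
  qed
  have B: "(4 * sqrt (mass s) / s ^ 2) powr q \<le> N powr (q / 2) * (4 powr q * conc_const p powr (q / 2) * s powr \<beta>)"
  proof -
    have "(4 * sqrt (mass s) / s ^ 2) powr q = 4 powr q * mass s powr (q / 2) / s powr (2 * q)"
    proof -
      have "sqrt (mass s) powr q = mass s powr (q / 2)"
        using M by (simp add: powr_half_sqrt[symmetric] powr_powr)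
      moreover have "(s ^ 2) powr q = s powr (2 * q)"
      proof -
        have "s ^ 2 = s powr 2" using s by simp
        then show ?thesis by (simp only: powr_powr)
      qed
      ultimately show ?thesis using M s by (simp add: powr_divide powr_mult)
    qed
    also have "\<dots> \<le> 4 powr q * (N * (conc_const p * s powr (3 * (1 - 1 / p)))) powr (q / 2) / s powr (2 * q)"
      using mass_concentration[OF s(1) N0] M q by (intro divide_right_mono mult_left_mono powr_mono2) auto
    also have "(N * (conc_const p * s powr (3 * (1 - 1 / p)))) powr (q / 2)
      = N powr (q / 2) * (conc_const p powr (q / 2) * s powr (3 * (1 - 1 / p) * (q / 2)))"
      using N0 c s by (simp add: powr_mult powr_powr)
    also have "4 powr q * (N powr (q / 2) * (conc_const p powr (q / 2) * s powr (3 * (1 - 1 / p) * (q / 2)))) / s powr (2 * q)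
      = N powr (q / 2) * (4 powr q * conc_const p powr (q / 2) * s powr \<beta>)"
      unfolding \<beta> powr_diff by simp
    finally show ?thesis .
  qed
  define a1 where "a1 = 4 * pi * s * f s * mass s powr (- (1/2))"
  define a2 where "a2 = 4 * sqrt (mass s) / s ^ 2"
  have a: "a1 \<ge> 0" "a2 \<ge> 0" using s f_nonneg[of s] M by (auto simp: a1_def a2_def)
  have "flow_bound s powr q \<le> (L * (a1 + a2)) powr q"
    using flow_bound_le[OF s(1)] flow_bound_nonneg[OF s(1)] q unfolding a1_def a2_def
    by (intro powr_mono2) auto
  also have "\<dots> = L powr q * (a1 + a2) powr q" using L_nonneg a by (simp add: powr_mult)
  also have "\<dots> \<le> L powr q * (2 powr q * (a1 powr q + a2 powr q))"
    using a q by (intro mult_left_mono powr_add_le) auto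
  also have "\<dots> = (2 * L) powr q * (a1 powr q + a2 powr q)" using L_nonneg by (simp add: powr_mult)
  also have "\<dots> \<le> (2 * L) powr q * (N powr (q / 2) *
    ((4 * pi * b) powr q * ((mass s / N) powr (- \<sigma>) * (f s / N) + (f s / N) powr p))
     + N powr (q / 2) * (4 powr q * conc_const p powr (q / 2) * s powr \<beta>))"
    using A B unfolding a1_def[symmetric] a2_def[symmetric] by (intro mult_left_mono add_mono) auto
  finally show ?thesis by (simp add: algebra_simps)
qed

text \<open>The case excluded by dividing by \<open>N\<close>. The density vanishes almost
  everywhere, so the mass vanishes at every radius; a nonzero value of \<open>shell\<close> at a
  single radius is annihilated by \<open>\<mu>' 0 = 0\<close>.\<close>

lemma flow_bound_0: "N = 0 \<Longrightarrow> s > 0 \<Longrightarrow> flow_bound s = 0"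
proof -
  assume N0: "N = 0" and s: "s > 0"
  have "(LINT x|lborel. f (norm (x::real^3)) powr p) = 0" using N N0 by simp
  then have "AE x::real^3 in lborel. f (norm x) powr p = 0"
    by (subst (asm) integral_nonneg_eq_0_iff_AE[OF Lp]) auto
  then have "AE x::real^3 in lborel. f (norm x) * indicator {..s} (norm x) = 0"
    by eventually_elim simp
  then have "mass s = 0"
    unfolding mass_eq_ball_integral by (subst integral_eq_zero_AE) auto
  then show ?thesis
    by (simp add: flow_bound_def profile_def profile'_def field_def \<mu>_0 \<mu>'_0)
qed

text \<open>The bound \<open>\<sigma> < 1\<close> amounts to q (p - 1) < 2 (p - q), that is q < p (2
  - q); it makes mass^(-\<sigma>) times its derivative integrable. The last bound makes s^(\<beta> +
  2) integrable at the origin; it follows from p > 2 and q < 2.\<close>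

lemma exponent_bounds:
  assumes "\<sigma> = q * (p - 1) / (2 * (p - q))" "\<beta> = 3 * (1 - 1 / p) * (q / 2) - 2 * q"
  shows "0 < \<sigma>" "\<sigma> < 1" "\<beta> + 2 > -1"
proof -
  show "0 < \<sigma>" unfolding assms using q p_gt by (intro divide_pos_pos mult_pos_pos) auto
  have "q < p * (2 - q)" using p_gt(3) q by (simp add: pos_divide_less_eq)
  then have "q * (p - 1) < 2 * (p - q)" by (simp add: algebra_simps)
  then show "\<sigma> < 1" unfolding assms using p_gt by (simp add: divide_less_eq)
  have "1 / p < 1 / 2" using p_gt by (simp add: field_simps)
  then have "3 * (1 - 1 / p) * (q / 2) \<ge> (3 / 2) * (q / 2)" using q by (intro mult_right_mono) auto
  then show "\<beta> + 2 > -1" unfolding assms using q by (simp add: algebra_simps)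
qed

lemma source_powr_ball:
  shows "set_integrable lborel {0<..b} (\<lambda>s. 4 * pi * s ^ 2 * f s powr p)"
    "(LINT s:{0<..b}|lborel. 4 * pi * s ^ 2 * f s powr p) \<le> N powr p"
proof -
  have i: "integrable lborel (\<lambda>s. (4 * pi) * (indicator {0<..} s * (s ^ 2 * f s powr p)))"
    using Lp by (subst (asm) integrable_radial_iff[of "\<lambda>s. f s powr p"]) auto
  then have i': "integrable lborel (\<lambda>s. indicator {0<..} s * (4 * pi * s ^ 2 * f s powr p))"
    by (simp add: mult_ac)
  then have S: "set_integrable lborel {0<..} (\<lambda>s. 4 * pi * s ^ 2 * f s powr p)"
    by (simp add: set_integrable_def)
  show S': "set_integrable lborel {0<..b} (\<lambda>s. 4 * pi * s ^ 2 * f s powr p)"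
    by (rule set_integrable_subset[OF S]) auto
  have "(LINT s:{0<..b}|lborel. 4 * pi * s ^ 2 * f s powr p) \<le> (LINT s|lborel. indicator {0<..} s * (4 * pi * s ^ 2 * f s powr p))"
    unfolding set_lebesgue_integral_def
    using S' i' unfolding set_integrable_def by (intro integral_mono) (auto simp: indicator_def)
  also have "\<dots> = N powr p" unfolding N(2) using Lp by (subst integral_radial_3[of "\<lambda>s. f s powr p"]) auto
  finally show "(LINT s:{0<..b}|lborel. 4 * pi * s ^ 2 * f s powr p) \<le> N powr p" .
qed

text \<open>With the polar weight, the pointwise bound has three terms. \<open>T1\<close> integrates
  to a power of the mass, whose powers of \<open>N\<close> cancel by
  \<open>mass_concentration\<close>; \<open>T2\<close> has integral at most 1 by normalisation;
  \<open>T3\<close> is an explicit power of the radius.\<close>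

lemma flow_bound_powr_integral:
  assumes b: "b > 0"
  shows "integrable lborel (\<lambda>x::real^3. indicator {..b} (norm x) * flow_bound (norm x) powr q)"
    "(LINT x|lborel. indicator {..b} (norm (x::real^3)) * flow_bound (norm x) powr q) \<le> flow_const L p q b * N powr (q / 2)"
proof -
  define \<sigma> where "\<sigma> = q * (p - 1) / (2 * (p - q))"
  define \<gamma> where "\<gamma> = 3 * (1 - 1 / p)"
  define \<beta> where "\<beta> = \<gamma> * (q / 2) - 2 * q"
  have ex: "0 < \<sigma>" "\<sigma> < 1" "\<beta> + 2 > -1"
    using exponent_bounds[OF \<sigma>_def, of \<beta>] by (auto simp: \<beta>_def \<gamma>_def)
  let ?P = "\<lambda>s. 4 * pi * s ^ 2 * flow_bound s powr q"
  have main: "set_integrable lborel {0<..b} ?P \<and> (LINT s:{0<..b}|lborel. ?P s) \<le> flow_const L p q b * N powr (q / 2)"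
  proof (cases "N = 0")
    case True
    have "indicator {0<..b} s *\<^sub>R ?P s = 0" for s using flow_bound_0[OF True, of s] by (simp add: indicator_def)
    then show ?thesis
      unfolding set_integrable_def set_lebesgue_integral_def by (simp only:) (simp add: True)
  next
    case False
    then have N0: "N > 0" using N by simp
    define T1 where "T1 s = N powr (\<sigma> - 1) * (shell s * mass s powr (- \<sigma>))" for s
    define T2 where "T2 s = N powr (- p) * (4 * pi * s ^ 2 * f s powr p)" for s
    define T3 where "T3 s = 4 * pi * (s powr (\<beta> + 2))" for s :: real
    define k where "k = (2 * L) powr q * N powr (q / 2)"
    define T where "T s = k * ((4 * pi * b) powr q * (T1 s + T2 s) + 4 powr q * conc_const p powr (q / 2) * T3 s)" for s
    have T1: "set_integrable lborel {0<..b} T1"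
      unfolding T1_def using b ex by (intro set_integrable_mult_right mass_powr_integrable(1)) auto
    have T1v: "(LINT s:{0<..b}|lborel. T1 s) \<le> (conc_const p * b powr \<gamma>) powr (1 - \<sigma>) / (1 - \<sigma>)"
    proof -
      have "(LINT s:{0<..b}|lborel. T1 s) = N powr (\<sigma> - 1) * (LINT s:{0<..b}|lborel. shell s * mass s powr (- \<sigma>))"
        unfolding T1_def by (rule set_integral_mult_right')
      also have "\<dots> \<le> N powr (\<sigma> - 1) * (mass b powr (1 - \<sigma>) / (1 - \<sigma>))"
        using b ex by (intro mult_left_mono mass_powr_integrable(2)) auto
      also have "\<dots> \<le> N powr (\<sigma> - 1) * ((N * (conc_const p * b powr \<gamma>)) powr (1 - \<sigma>) / (1 - \<sigma>))"
        unfolding \<gamma>_def using ex mass_nonneg mass_concentration[OF b N0]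
        by (intro mult_left_mono divide_right_mono powr_mono2) auto
      also have "(N * (conc_const p * b powr \<gamma>)) powr (1 - \<sigma>) = N powr (1 - \<sigma>) * (conc_const p * b powr \<gamma>) powr (1 - \<sigma>)"
        using N0 by (subst powr_mult) (auto simp: conc_const_def)
      also have "N powr (\<sigma> - 1) * (N powr (1 - \<sigma>) * (conc_const p * b powr \<gamma>) powr (1 - \<sigma>) / (1 - \<sigma>))
        = (N powr (\<sigma> - 1) * N powr (1 - \<sigma>)) * ((conc_const p * b powr \<gamma>) powr (1 - \<sigma>) / (1 - \<sigma>))" by simp
      also have "N powr (\<sigma> - 1) * N powr (1 - \<sigma>) = 1" using N0 by (simp add: powr_add[symmetric])
      finally show ?thesis by simp
    qed
    have T2: "set_integrable lborel {0<..b} T2"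
      unfolding T2_def by (intro set_integrable_mult_right source_powr_ball)
    have T2v: "(LINT s:{0<..b}|lborel. T2 s) \<le> 1"
    proof -
      have "(LINT s:{0<..b}|lborel. T2 s) = N powr (- p) * (LINT s:{0<..b}|lborel. 4 * pi * s ^ 2 * f s powr p)"
        unfolding T2_def by (rule set_integral_mult_right')
      also have "\<dots> \<le> N powr (- p) * N powr p" by (intro mult_left_mono source_powr_ball) simp
      also have "\<dots> = 1" using N0 by (simp add: powr_add[symmetric])
      finally show ?thesis .
    qed
    have T3: "set_integrable lborel {0<..b} T3"
      unfolding T3_def using ex b by (intro set_integrable_mult_right set_integrable_powr) auto
    have T3v: "(LINT s:{0<..b}|lborel. T3 s) = 4 * pi * (b powr (\<beta> + 3) / (\<beta> + 3))"
    proof -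
      have "\<beta> + 2 + 1 = \<beta> + 3" by simp
      then show ?thesis
        using set_integrable_powr(2)[OF ex(3) b] unfolding T3_def set_integral_mult_right' by (simp add: add.commute)
    qed
    have T: "set_integrable lborel {0<..b} T"
      unfolding T_def by (intro set_integrable_mult_right set_integral_add T1 T2 T3)
    have "(LINT s:{0<..b}|lborel. T s) = k * ((4 * pi * b) powr q * ((LINT s:{0<..b}|lborel. T1 s) + (LINT s:{0<..b}|lborel. T2 s))
      + 4 powr q * conc_const p powr (q / 2) * (LINT s:{0<..b}|lborel. T3 s))"
      unfolding T_def
      by (simp only: set_integral_mult_right' set_integral_add set_integrable_mult_right T1 T2 T3)
    also have "\<dots> \<le> k * ((4 * pi * b) powr q * ((conc_const p * b powr \<gamma>) powr (1 - \<sigma>) / (1 - \<sigma>) + 1)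
      + 4 powr q * conc_const p powr (q / 2) * (4 * pi * (b powr (\<beta> + 3) / (\<beta> + 3))))"
      unfolding T3v by (intro mult_left_mono add_mono T1v T2v order_refl) (auto simp: k_def)
    also have "\<dots> = flow_const L p q b * N powr (q / 2)"
      unfolding flow_const_def Let_def \<sigma>_def[symmetric] \<gamma>_def[symmetric] \<beta>_def[symmetric] k_def
      by (simp only: mult_ac)
    finally have Tv: "(LINT s:{0<..b}|lborel. T s) \<le> flow_const L p q b * N powr (q / 2)" .
    have le: "?P s \<le> T s" if s: "s \<in> {0<..b}" for s
    proof -
      have "?P s \<le> 4 * pi * s ^ 2 * (k * ((4 * pi * b) powr q * ((mass s / N) powr (- \<sigma>) * (f s / N) + (f s / N) powr p)
        + 4 powr q * conc_const p powr (q / 2) * s powr \<beta>))"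
        unfolding k_def using s by (intro mult_left_mono flow_bound_powr_le N0) (auto simp: \<sigma>_def \<beta>_def \<gamma>_def)
      also have "\<dots> = k * ((4 * pi * b) powr q * (4 * pi * s ^ 2 * ((mass s / N) powr (- \<sigma>) * (f s / N)) + 4 * pi * s ^ 2 * (f s / N) powr p)
        + 4 powr q * conc_const p powr (q / 2) * (4 * pi * (s ^ 2 * s powr \<beta>)))"
        by (simp add: algebra_simps)
      also have "4 * pi * s ^ 2 * ((mass s / N) powr (- \<sigma>) * (f s / N)) = T1 s"
      proof -
        have "(mass s / N) powr (- \<sigma>) * (f s / N) = mass s powr (- \<sigma>) * f s / (N powr (- \<sigma>) * N powr 1)"
          using N0 mass_nonneg[of s] by (simp add: powr_divide)
        also have "N powr (- \<sigma>) * N powr 1 = N powr (- (\<sigma> - 1))" by (simp only: powr_add[symmetric]) simp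
        also have "mass s powr (- \<sigma>) * f s / N powr (- (\<sigma> - 1)) = N powr (\<sigma> - 1) * (mass s powr (- \<sigma>) * f s)"
          using powr_minus_divide[of N "1 - \<sigma>"] by simp
        finally have "(mass s / N) powr (- \<sigma>) * (f s / N) = N powr (\<sigma> - 1) * (mass s powr (- \<sigma>) * f s)" .
        moreover have "shell s = 4 * pi * s ^ 2 * f s" using s by (simp add: shell_def)
        ultimately show ?thesis by (simp only: T1_def mult_ac)
      qed
      also have "4 * pi * s ^ 2 * (f s / N) powr p = T2 s"
        using N0 f_nonneg[of s] by (simp add: T2_def powr_divide powr_minus_divide)
      also have "4 * pi * (s ^ 2 * s powr \<beta>) = T3 s"
      proof -
        have "s ^ 2 = s powr 2" using s by simp
        then have "s ^ 2 * s powr \<beta> = s powr (\<beta> + 2)" by (simp only: powr_add[symmetric]) (simp add: add.commute)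
        then show ?thesis by (simp add: T3_def)
      qed
      finally show ?thesis by (simp add: T_def)
    qed
    have P: "set_integrable lborel {0<..b} ?P"
    proof (rule set_integrable_bound[OF T])
      show "set_borel_measurable lborel {0<..b} ?P" by (simp add: set_borel_measurable_def)
      show "AE s in lborel. s \<in> {0<..b} \<longrightarrow> norm (?P s) \<le> norm (T s)"
        using le by (intro AE_I2 impI) (auto intro: order_trans[OF _ abs_ge_self])
    qed
    have "(LINT s:{0<..b}|lborel. ?P s) \<le> (LINT s:{0<..b}|lborel. T s)"
      by (rule set_integral_mono[OF P T le])
    with P Tv show ?thesis by simp
  qed
  define h where "h s = indicator {..b} s * flow_bound s powr q" for s
  have [measurable]: "h \<in> borel_measurable borel" unfolding h_def by measurable
  have e: "indicator {0<..} s * (4 * pi * s ^ 2 * h s) = indicator {0<..b} s *\<^sub>R ?P s" for s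
    by (auto simp: h_def indicator_def)
  have "integrable lborel (\<lambda>s. 1 / (4 * pi) * (indicator {0<..b} s *\<^sub>R ?P s))"
    using main by (intro integrable_mult_right) (simp add: set_integrable_def)
  then have "integrable lborel (\<lambda>s. indicator {0<..} s * (s ^ (DIM(real^3) - 1) * h s))"
    unfolding e[symmetric] by (simp add: mult_ac)
  then have I: "integrable lborel (\<lambda>x::real^3. h (norm x))"
    by (subst integrable_radial_iff) simp_all
  then show "integrable lborel (\<lambda>x::real^3. indicator {..b} (norm x) * flow_bound (norm x) powr q)"
    by (simp add: h_def)
  have "(LINT x|lborel. h (norm (x::real^3))) = (LINT s:{0<..b}|lborel. ?P s)"
    using integral_radial_3[OF _ I] by (simp add: e set_lebesgue_integral_def)
  then show "(LINT x|lborel. indicator {..b} (norm (x::real^3)) * flow_bound (norm x) powr q) \<le> flow_const L p q b * N powr (q / 2)"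
    using main by (simp add: h_def)
qed

end

section \<open>Measurable profiles, local Lebesgue spaces and test functions\<close>

text \<open>The profile of a spherically symmetric function need not be measurable a priori. By Tonelli,
  almost every ray avoids the exceptional null set at almost every radius; one such ray provides
  a Borel profile.\<close>

lemma radial_borel_profile:
  fixes \<rho> :: "'a::euclidean_space \<Rightarrow> real"
  assumes \<rho>: "\<rho> \<in> borel_measurable lebesgue" and f0: "AE x in lebesgue. \<rho> x = f0 (norm x)"
    and nonneg: "AE x in lebesgue. \<rho> x \<ge> 0"
  obtains f where "f \<in> borel_measurable borel" "\<And>s::real. f s \<ge> 0" "AE x in lebesgue. \<rho> x = f (norm x)"
proof -
  obtain B where B: "B \<in> borel_measurable lborel" "AE x in lborel. \<rho> x = B x"
    using completion_ex_borel_measurable_real[OF \<rho>] by blast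
  then have [measurable]: "B \<in> borel_measurable borel" by simp
  have "AE x in lborel. \<rho> x = f0 (norm x)" using f0 by (simp add: AE_completion_iff)
  with B(2) have "AE x in lborel. B x = f0 (norm x)" by eventually_elim simp
  then obtain Z where Z: "{x. B x \<noteq> f0 (norm x)} \<subseteq> Z" "Z \<in> null_sets lborel"
    by (auto elim!: AE_E simp: null_setsI)
  then have [measurable]: "Z \<in> sets borel" by auto
  have zero: "(\<integral>\<^sup>+x. indicator Z (r *\<^sub>R x) \<partial>(lborel::'a measure)) = 0" if r: "r > 0" for r
  proof -
    have "ennreal (r ^ DIM('a)) * (\<integral>\<^sup>+x. indicator Z (r *\<^sub>R x) \<partial>(lborel::'a measure)) = (\<integral>\<^sup>+x. indicator Z x \<partial>lborel)"
      using r by (intro nn_integral_lborel_scale[symmetric]) simp_all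
    also have "\<dots> = 0" by (simp add: null_setsD1[OF Z(2)])
    finally show ?thesis using r by simp
  qed
  have "(\<integral>\<^sup>+x. \<integral>\<^sup>+r. indicator {0<..} r * indicator Z (r *\<^sub>R x) \<partial>lborel \<partial>(lborel::'a measure))
    = (\<integral>\<^sup>+r. \<integral>\<^sup>+x. indicator {0<..} r * indicator Z (r *\<^sub>R x) \<partial>(lborel::'a measure) \<partial>lborel)"
    by (rule lborel_pair.Fubini') measurable
  also have "\<dots> = 0"
  proof (subst nn_integral_0_iff_AE)
    show "AE r in lborel. (\<integral>\<^sup>+x. indicator {0<..} r * indicator Z (r *\<^sub>R x) \<partial>(lborel::'a measure)) = 0"
      by (rule AE_I2) (auto simp: zero indicator_def[of "{0<..}"])
  qed measurable
  finally have z0: "(\<integral>\<^sup>+x. \<integral>\<^sup>+r. indicator {0<..} r * indicator Z (r *\<^sub>R x) \<partial>lborel \<partial>(lborel::'a measure)) = 0" .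
  have "(\<lambda>x::'a. \<integral>\<^sup>+r. indicator {0<..} r * indicator Z (r *\<^sub>R x) \<partial>lborel) \<in> borel_measurable lborel"
    by (rule lborel.borel_measurable_nn_integral) measurable
  from nn_integral_0_iff_AE[OF this] z0
  have "AE x::'a in lborel. (\<integral>\<^sup>+r. indicator {0<..} r * indicator Z (r *\<^sub>R x) \<partial>lborel) = 0" by blast
  moreover have "\<not> (AE x::'a in lborel. False)"
    by (simp add: AE_iff_null null_sets_def)
  ultimately obtain u :: 'a where u: "u \<noteq> 0" "(\<integral>\<^sup>+r. indicator {0<..} r * indicator Z (r *\<^sub>R u) \<partial>lborel) = 0"
    using AE_norm_neq[of 0, where 'a = 'a] by (smt (verit) eventually_elim2 norm_zero)
  have ray: "AE r in lborel. 0 < r \<longrightarrow> r *\<^sub>R u \<notin> Z"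
  proof -
    have "AE r in lborel. indicator {0<..} r * indicator Z (r *\<^sub>R u) = (0::ennreal)"
      using u(2) by (subst (asm) nn_integral_0_iff_AE) simp_all
    then show ?thesis by eventually_elim (auto simp: indicator_def split: if_splits)
  qed
  have "AE s in lborel. 0 < 0 + (1 / norm u) * s \<longrightarrow> (0 + (1 / norm u) * s) *\<^sub>R u \<notin> Z"
    by (rule AE_borel_affine[OF _ _ ray]) (use u in simp, measurable)
  then have ray': "AE s in lborel. 0 < s \<longrightarrow> B ((s / norm u) *\<^sub>R u) = f0 s"
  proof eventually_elim
    case (elim s)
    show ?case
    proof
      assume s: "0 < s"
      then have "(s / norm u) *\<^sub>R u \<notin> Z" using elim u by simp
      then have "B ((s / norm u) *\<^sub>R u) = f0 (norm ((s / norm u) *\<^sub>R u))" using Z(1) by blast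
      then show "B ((s / norm u) *\<^sub>R u) = f0 s" using s u by simp
    qed
  qed
  define f where "f s = max 0 (B ((s / norm u) *\<^sub>R u))" for s
  show ?thesis
  proof (rule that)
    show "f \<in> borel_measurable borel" unfolding f_def by measurable
    show "f s \<ge> 0" for s by (simp add: f_def)
    have "AE x::'a in lebesgue. x \<noteq> 0 \<longrightarrow> B ((norm x / norm u) *\<^sub>R u) = f0 (norm x)"
      using AE_radial[OF ray'] by (rule AE_completion)
    moreover have "AE x::'a in lebesgue. norm x \<noteq> 0" using AE_norm_neq[of 0] by (rule AE_completion)
    ultimately show "AE x in lebesgue. \<rho> x = f (norm x)"
      using f0 nonneg by eventually_elim (simp add: f_def)
  qed
qed

lemma set_borel_measurable_lebesgueI:
  fixes G :: "'a::euclidean_space \<Rightarrow> 'b::euclidean_space"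
  assumes [measurable]: "G \<in> borel_measurable borel" "S \<in> sets borel"
  shows "set_borel_measurable lebesgue S G"
proof -
  have "(\<lambda>x. indicator S x *\<^sub>R G x) \<in> borel_measurable lborel" by measurable
  then show ?thesis unfolding set_borel_measurable_def by (rule measurable_completion)
qed

lemma
  fixes G :: "'a::euclidean_space \<Rightarrow> 'b::euclidean_space"
  assumes [measurable]: "G \<in> borel_measurable borel" and [measurable]: "S \<in> sets borel" and S: "\<And>x. x \<in> S \<Longrightarrow> norm x \<le> b"
    and I: "integrable lborel (\<lambda>x. indicator {..b} (norm x) * norm (G x) powr q)"
  shows in_Lp_bounded: "in_Lp q S G"
    and Lp_integral_bounded: "(LINT x:S|lebesgue. norm (G x) powr q) \<le> (LINT x|lborel. indicator {..b} (norm x) * norm (G x) powr q)"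
proof -
  have I': "integrable lborel (\<lambda>x. indicator S x *\<^sub>R (norm (G x) powr q))"
    by (rule Bochner_Integration.integrable_bound[OF I]) (use S in \<open>auto simp: indicator_def\<close>)
  then have "integrable lebesgue (\<lambda>x. indicator S x *\<^sub>R (norm (G x) powr q))"
    by (subst integrable_completion) simp_all
  then show "in_Lp q S G"
    unfolding in_Lp_def set_integrable_def by (intro conjI set_borel_measurable_lebesgueI) simp_all
  have "(LINT x:S|lebesgue. norm (G x) powr q) = (LINT x|lborel. indicator S x *\<^sub>R (norm (G x) powr q))"
    unfolding set_lebesgue_integral_def by (rule integral_completion) simp
  also have "\<dots> \<le> (LINT x|lborel. indicator {..b} (norm x) * norm (G x) powr q)"
    by (intro integral_mono I I') (use S in \<open>auto simp: indicator_def\<close>)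
  finally show "(LINT x:S|lebesgue. norm (G x) powr q) \<le> (LINT x|lborel. indicator {..b} (norm x) * norm (G x) powr q)" .
qed

text \<open>A working form of \<open>in_Lp_loc\<close> for Borel functions, with balls for compact
  sets and \<open>lborel\<close> for its completion, so that polar coordinates apply.\<close>

definition locally_Lp :: "real \<Rightarrow> ('a::euclidean_space \<Rightarrow> 'b::euclidean_space) \<Rightarrow> bool" where
  "locally_Lp q G \<longleftrightarrow> G \<in> borel_measurable borel \<and>
    (\<forall>b>0. integrable lborel (\<lambda>x. indicator {..b} (norm x) * norm (G x) powr q))"

lemma locally_LpI:
  fixes G :: "'a::euclidean_space \<Rightarrow> 'b::euclidean_space" and H :: "'a \<Rightarrow> real"
  assumes [measurable]: "G \<in> borel_measurable borel" and le: "\<And>x. norm (G x) \<le> H x" and q: "q \<ge> 0"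
    and H: "\<And>b. b > 0 \<Longrightarrow> integrable lborel (\<lambda>x. indicator {..b} (norm x) * H x powr q)"
  shows "locally_Lp q G"
  unfolding locally_Lp_def
proof (intro conjI allI impI)
  fix b :: real assume "b > 0"
  from H[OF this] show "integrable lborel (\<lambda>x. indicator {..b} (norm x) * norm (G x) powr q)"
    by (rule Bochner_Integration.integrable_bound)
      (use le q in \<open>auto simp: indicator_def intro!: powr_mono2\<close>)
qed simp

lemma in_Lp_loc_if_locally_Lp:
  assumes "locally_Lp q G" shows "in_Lp_loc q G"
  unfolding in_Lp_loc_def
proof (intro allI impI)
  fix K :: "'a set" assume K: "compact K"
  then obtain b where b: "b > 0" "\<And>x. x \<in> K \<Longrightarrow> norm x \<le> b"
    using compact_imp_bounded bounded_pos by metis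
  show "in_Lp q K G"
    by (rule in_Lp_bounded[of G K b]) (use assms b K in \<open>auto simp: locally_Lp_def compact_imp_closed\<close>)
qed

lemma locally_Lp_1:
  assumes G: "locally_Lp q G" and q: "q \<ge> 1"
  shows "locally_Lp 1 G"
  unfolding locally_Lp_def
proof (intro conjI allI impI)
  show [measurable]: "G \<in> borel_measurable borel" using G by (simp add: locally_Lp_def)
  fix b :: real assume b: "b > 0"
  have i1: "integrable lborel (\<lambda>x::'a. indicator {..b} (norm x) :: real)"
    by (rule integrable_bounded_support[of _ b 1]) (auto simp: indicator_def)
  have i2: "integrable lborel (\<lambda>x. indicator {..b} (norm x) * norm (G x) powr q)"
    using G b by (simp add: locally_Lp_def)
  have t: "t powr 1 \<le> 1 + t powr q" if "t \<ge> 0" for t :: real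
  proof (cases "t \<le> 1")
    case False
    then have "t powr 1 \<le> t powr q" using q by (intro powr_mono) auto
    then show ?thesis by simp
  qed (use that in \<open>simp add: add_increasing2\<close>)
  show "integrable lborel (\<lambda>x. indicator {..b} (norm x) * norm (G x) powr 1)"
  proof (rule Bochner_Integration.integrable_bound[OF Bochner_Integration.integrable_add[OF i1 i2]])
    show "AE x in lborel. norm (indicator {..b} (norm x) * norm (G x) powr 1)
      \<le> norm (indicator {..b} (norm x) + indicator {..b} (norm x) * norm (G x) powr q)"
      using t[of "norm (G _)"] by (intro AE_I2) (auto simp: indicator_def)
  qed measurable
qed

lemma locally_Lp_mult_integrable:
  fixes G \<phi> :: "'a::euclidean_space \<Rightarrow> real"
  assumes G: "locally_Lp 1 G" and [measurable]: "\<phi> \<in> borel_measurable borel" and B: "\<And>x. \<bar>\<phi> x\<bar> \<le> B"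
    and supp: "\<And>x. norm x > b \<Longrightarrow> \<phi> x = 0" and b: "b > 0"
  shows "integrable lborel (\<lambda>x. G x * \<phi> x)"
proof -
  have [measurable]: "G \<in> borel_measurable borel" using G by (simp add: locally_Lp_def)
  have "integrable lborel (\<lambda>x. B * (indicator {..b} (norm x) * norm (G x) powr 1))"
    using G b by (intro integrable_mult_right) (simp add: locally_Lp_def)
  then show ?thesis
  proof (rule Bochner_Integration.integrable_bound)
    show "AE x in lborel. norm (G x * \<phi> x) \<le> norm (B * (indicator {..b} (norm x) * norm (G x) powr 1))"
    proof (rule AE_I2)
      fix x
      have "\<bar>G x * \<phi> x\<bar> \<le> \<bar>G x\<bar> * B" unfolding abs_mult using B by (intro mult_left_mono) auto
      then show "norm (G x * \<phi> x) \<le> norm (B * (indicator {..b} (norm x) * norm (G x) powr 1))"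
        using supp[of x] B[of x] by (auto simp: indicator_def abs_mult mult.commute)
    qed
  qed simp
qed

text \<open>Continuous partial derivatives are bounded on a ball and their absolute sum bounds the
  operator norm of the derivative. The mean value inequality on the convex ball then gives the
  Lipschitz constant.\<close>

lemma
  fixes \<phi> :: "real^'n \<Rightarrow> real"
  assumes \<phi>: "test_function \<phi>"
  shows test_function_line: "((\<lambda>t. \<phi> (x + t *\<^sub>R axis j 1)) has_real_derivative partial_deriv j \<phi> x) (at 0)"
    and test_function_cont_partial: "continuous_on UNIV (partial_deriv j \<phi>)"
    and test_function_lipschitz: "lipschitz_on_balls \<phi>"
proof -
  have d: "(\<phi> has_derivative frechet_derivative \<phi> (at y)) (at y)" for y
    using \<phi> by (metis test_function_def C_k.simps(2) frechet_derivative_works)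
  show c: "continuous_on UNIV (partial_deriv j \<phi>)" for j
    using \<phi> by (metis test_function_def C_k.simps)
  have 1: "((\<lambda>t. x + t *\<^sub>R axis j 1) has_derivative (\<lambda>t. t *\<^sub>R axis j 1)) (at 0)"
    by (auto intro!: derivative_eq_intros)
  have "((\<lambda>t. \<phi> (x + t *\<^sub>R axis j 1)) has_derivative (\<lambda>t. frechet_derivative \<phi> (at x) (t *\<^sub>R axis j 1))) (at 0)"
    using has_derivative_compose[OF 1, of \<phi> "frechet_derivative \<phi> (at x)"] d[of x] by simp
  then show "((\<lambda>t. \<phi> (x + t *\<^sub>R axis j 1)) has_real_derivative partial_deriv j \<phi> x) (at 0)"
    unfolding has_field_derivative_def partial_deriv_def
    by (rule has_derivative_eq_rhs)
      (auto simp: fun_eq_iff linear_cmul[OF has_derivative_linear[OF d]])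
  show "lipschitz_on_balls \<phi>"
    unfolding lipschitz_on_balls_def
  proof
    fix r
    have "continuous_on (cball 0 r) (\<lambda>y. \<Sum>j\<in>UNIV. \<bar>partial_deriv j \<phi> y\<bar>)"
      by (intro continuous_intros continuous_on_subset[OF c]) auto
    then have "compact ((\<lambda>y. \<Sum>j\<in>UNIV. \<bar>partial_deriv j \<phi> y\<bar>) ` cball 0 r)"
      by (intro compact_continuous_image) auto
    then have "bounded ((\<lambda>y. \<Sum>j\<in>UNIV. \<bar>partial_deriv j \<phi> y\<bar>) ` cball 0 r)"
      by (rule compact_imp_bounded)
    then obtain C where "\<forall>s\<in>(\<lambda>y. \<Sum>j\<in>UNIV. \<bar>partial_deriv j \<phi> y\<bar>) ` cball 0 r. norm s \<le> C"
      unfolding bounded_iff by blast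
    then have C: "\<And>y. y \<in> cball 0 r \<Longrightarrow> \<bar>\<Sum>j\<in>UNIV. \<bar>partial_deriv j \<phi> y\<bar>\<bar> \<le> C" by simp
    define C' where "C' = max C 0"
    have on: "onorm (frechet_derivative \<phi> (at y)) \<le> C'" if y: "y \<in> cball 0 r" for y
    proof (rule onorm_bound)
      fix h :: "real^'n"
      have lin: "linear (frechet_derivative \<phi> (at y))" by (rule has_derivative_linear[OF d])
      have "h = (\<Sum>j\<in>UNIV. h $ j *\<^sub>R axis j 1)"
        using basis_expansion[of h] by (simp add: scalar_mult_eq_scaleR)
      then have "frechet_derivative \<phi> (at y) h = frechet_derivative \<phi> (at y) (\<Sum>j\<in>UNIV. h $ j *\<^sub>R axis j 1)"
        by simp
      also have "\<dots> = (\<Sum>j\<in>UNIV. h $ j * partial_deriv j \<phi> y)"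
        by (simp add: linear_sum[OF lin] linear_cmul[OF lin] partial_deriv_def)
      also have "norm \<dots> \<le> (\<Sum>j\<in>UNIV. norm h * \<bar>partial_deriv j \<phi> y\<bar>)"
        by (intro sum_norm_le) (auto simp: abs_mult intro!: mult_right_mono component_le_norm_cart)
      also have "\<dots> = (\<Sum>j\<in>UNIV. \<bar>partial_deriv j \<phi> y\<bar>) * norm h"
        by (simp add: sum_distrib_left[symmetric] mult.commute)
      also have "\<dots> \<le> C' * norm h"
        using C[OF y] by (intro mult_right_mono) (auto simp: C'_def)
      finally show "norm (frechet_derivative \<phi> (at y) h) \<le> C' * norm h" .
    qed (simp add: C'_def)
    have "C'-lipschitz_on (cball 0 r) \<phi>"
    proof (rule lipschitz_onI)
      fix y z :: "real^'n" assume "y \<in> cball 0 r" "z \<in> cball 0 r"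
      then have "norm (\<phi> y - \<phi> z) \<le> C' * norm (y - z)"
        by (intro differentiable_bound[of "cball 0 r" \<phi> "\<lambda>y. frechet_derivative \<phi> (at y)"])
          (auto intro: has_derivative_at_withinI[OF d] on)
      then show "dist (\<phi> y) (\<phi> z) \<le> C' * dist y z" by (simp add: dist_norm)
    qed (simp add: C'_def)
    then show "\<exists>L. L-lipschitz_on (cball 0 r) \<phi>" by blast
  qed
qed

lemma test_function_support:
  fixes \<phi> :: "real^'n \<Rightarrow> real"
  assumes \<phi>: "test_function \<phi>"
  obtains b where "b > 0" "\<And>x. norm x \<ge> b \<Longrightarrow> \<phi> x = 0" "\<And>x. norm x \<ge> b \<Longrightarrow> partial_deriv j \<phi> x = 0"
proof -
  have "bounded (closure {x. \<phi> x \<noteq> 0})" using \<phi> by (simp add: test_function_def compact_imp_bounded)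
  then obtain b where b: "b > 0" "\<And>x. x \<in> closure {x. \<phi> x \<noteq> 0} \<Longrightarrow> norm x \<le> b"
    by (meson bounded_pos)
  have z: "\<phi> x = 0" if "norm x > b" for x
    using b(2)[of x] closure_subset[of "{x. \<phi> x \<noteq> 0}"] that by fastforce
  show ?thesis
  \<comment> \<open>The additional 1 leaves room to move along an axis: from norm at least b + 1,
    displacements shorter than 1 stay where \<open>\<phi>\<close> vanishes, so the partial
    derivative vanishes as well.\<close>
  proof (rule that[of "b + 1"])
    show "\<phi> x = 0" if "norm x \<ge> b + 1" for x using z[of x] that by simp
    show "partial_deriv j \<phi> x = 0" if x: "norm x \<ge> b + 1" for x
    proof -
      have "((\<lambda>t. 0) has_real_derivative 0) (at 0)" by simp
      moreover have "\<forall>\<^sub>F t in nhds 0. 0 = \<phi> (x + t *\<^sub>R axis j 1)"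
      proof -
        have "\<forall>\<^sub>F t in nhds (0::real). t \<in> ball 0 1" by (intro eventually_nhds_in_open) auto
        then show ?thesis
        proof eventually_elim
          case (elim t)
          have "norm (t *\<^sub>R axis j (1::real) :: real^'n) < 1" using elim by simp
          then have "norm (x + t *\<^sub>R axis j 1) > b"
            using norm_triangle_ineq4[of "x + t *\<^sub>R axis j 1" "t *\<^sub>R axis j 1"] x by simp
          then show ?case using z by simp
        qed
      qed
      ultimately have "((\<lambda>t. \<phi> (x + t *\<^sub>R axis j 1)) has_real_derivative 0) (at 0)"
        using DERIV_cong_ev by fastforce
      then show ?thesis using test_function_line[OF \<phi>] DERIV_unique by blast
    qed
  qed (use b in simp)
qed

section \<open>The transformed field and its weak Jacobian\<close>

context flow_in_Lp
begin

definition flow :: "real^3 \<Rightarrow> real^3" where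
  "flow x = profile (norm x) *\<^sub>R x"

text \<open>The product rule for \<open>profile (norm x) * x $ i\<close>, the gradient of the norm
  being x / |x|.\<close>

definition jacobian :: "real^3 \<Rightarrow> real^3^3" where
  "jacobian x = (\<chi> i j. (if i = j then profile (norm x) else 0) + profile' (norm x) * (x $ i * x $ j / norm x))"

lemma flow_component: "flow x $ i = profile (norm x) * x $ i"
  by (simp add: flow_def)

lemma jacobian_component:
  "jacobian x $ i $ j = (if i = j then profile (norm x) else 0) + profile' (norm x) * (x $ i * x $ j / norm x)"
  by (simp add: jacobian_def)

lemma component_borel[measurable]: "(\<lambda>x::real^3. x $ i) \<in> borel_measurable borel"
  by (intro borel_measurable_continuous_onI continuous_intros)

lemma flow_borel[measurable]: "flow \<in> borel_measurable borel"
  unfolding flow_def by measurable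

lemma jacobian_component_borel[measurable]: "(\<lambda>x. jacobian x $ i $ j) \<in> borel_measurable borel"
  unfolding jacobian_component by (cases "i = j") simp_all

lemma vec_borel:
  fixes G :: "real^3 \<Rightarrow> 'b::euclidean_space^3"
  assumes "\<And>i. (\<lambda>x. G x $ i) \<in> borel_measurable borel"
  shows "G \<in> borel_measurable borel"
proof (rule borel_measurable_euclidean_space[THEN iffD2], intro ballI)
  fix e :: "'b^3" assume "e \<in> Basis"
  then obtain i u where e: "e = axis i u" by (auto simp: Basis_vec_def)
  show "(\<lambda>x. G x \<bullet> e) \<in> borel_measurable borel"
    unfolding e inner_axis using assms[of i] by simp
qed

lemma jacobian_borel[measurable]: "jacobian \<in> borel_measurable borel"
  by (intro vec_borel jacobian_component_borel)

lemma jacobian_component_bound: "\<bar>jacobian x $ i $ j\<bar> \<le> flow_bound (norm x)"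
proof -
  have "\<bar>x $ i\<bar> * \<bar>x $ j\<bar> \<le> norm x * norm x"
    by (intro mult_mono component_le_norm_cart) auto
  then have "\<bar>x $ i * x $ j / norm x\<bar> \<le> norm x"
    by (cases "x = 0") (auto simp: abs_mult divide_le_eq)
  then have "\<bar>profile' (norm x) * (x $ i * x $ j / norm x)\<bar> \<le> norm x * \<bar>profile' (norm x)\<bar>"
    unfolding abs_mult[of "profile' (norm x)"] by (subst mult.commute) (intro mult_right_mono, auto)
  then show ?thesis
    unfolding jacobian_component flow_bound_def by (intro order_trans[OF abs_triangle_ineq] add_mono) auto
qed

lemma jacobian_norm_bound: "norm (jacobian x) \<le> 9 * flow_bound (norm x)"
proof -
  have "norm (jacobian x) \<le> (\<Sum>i\<in>UNIV. norm (jacobian x $ i))"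
    unfolding norm_vec_def by (rule L2_set_le_sum) simp
  also have "\<dots> \<le> (\<Sum>i\<in>(UNIV::3 set). \<Sum>j\<in>(UNIV::3 set). flow_bound (norm x))"
    by (intro sum_mono order_trans[OF norm_le_l1_cart] jacobian_component_bound)
  also have "\<dots> = 9 * flow_bound (norm x)" by simp
  finally show ?thesis .
qed

lemma flow_bound_norm_nonneg: "flow_bound (norm (x::real^3)) \<ge> 0"
  by (simp add: flow_bound_def)

lemma locally_Lp_jacobian_component: "locally_Lp q (\<lambda>x. jacobian x $ i $ j)"
proof (rule locally_LpI[where H = "\<lambda>x. flow_bound (norm x)"])
  show "integrable lborel (\<lambda>x::real^3. indicator {..b} (norm x) * flow_bound (norm x) powr q)" if "b > 0" for b
    using that by (rule flow_bound_powr_integral)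
qed (use q jacobian_component_bound in auto)

text \<open>The mass is bounded by its total, so the field is at most a constant times 1 / |x|. Its
  q-th power is locally integrable in three dimensions since q < 2.\<close>

lemma locally_Lp_flow_component: "locally_Lp q (\<lambda>x. flow x $ i)"
proof (rule locally_LpI[where H = "\<lambda>x. L * sqrt total_mass * (1 / norm x)"])
  show "norm (flow x $ i) \<le> L * sqrt total_mass * (1 / norm x)" for x
  proof (cases "x = 0")
    case False
    then have x: "norm x > 0" by simp
    have "\<bar>profile (norm x)\<bar> * \<bar>x $ i\<bar> \<le> (L * sqrt (mass (norm x)) / norm x ^ 2) * norm x"
      using profile_bound[OF x] by (intro mult_mono component_le_norm_cart) auto
    also have "\<dots> = L * sqrt (mass (norm x)) * (1 / norm x)" using x by (simp add: power2_eq_square)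
    also have "\<dots> \<le> L * sqrt total_mass * (1 / norm x)"
      using x L_nonneg mass_le_total by (intro mult_right_mono mult_left_mono) auto
    finally show ?thesis by (simp add: flow_component abs_mult)
  qed (simp add: flow_component)
  fix b :: real assume b: "b > 0"
  define c where "c = (L * sqrt total_mass) powr q"
  have "set_integrable lborel {0<..b} (\<lambda>s. c * s powr (2 - q))"
    using q b by (intro set_integrable_mult_right set_integrable_powr) auto
  then have "integrable lborel (\<lambda>s. indicator {0<..b} s *\<^sub>R (c * s powr (2 - q)))"
    by (simp only: set_integrable_def)
  also have "(\<lambda>s. indicator {0<..b} s *\<^sub>R (c * s powr (2 - q)))
    = (\<lambda>s. indicator {0<..} s * (s ^ (DIM(real^3) - 1) * (indicator {..b} s * (L * sqrt total_mass * (1 / s)) powr q)))"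
  proof
    fix s :: real
    show "indicator {0<..b} s *\<^sub>R (c * s powr (2 - q))
      = indicator {0<..} s * (s ^ (DIM(real^3) - 1) * (indicator {..b} s * (L * sqrt total_mass * (1 / s)) powr q))"
    proof (cases "s > 0")
      case True
      have "(L * sqrt total_mass * (1 / s)) powr q = c * (1 / s powr q)"
        unfolding c_def using True L_nonneg total_mass_nonneg by (simp add: powr_mult powr_divide)
      moreover have "s powr (2 - q) = s ^ 2 * (1 / s powr q)"
        using True by (simp add: powr_diff)
      ultimately show ?thesis using True by (simp add: indicator_def)
    qed simp
  qed
  finally show "integrable lborel (\<lambda>x::real^3. indicator {..b} (norm x) * (L * sqrt total_mass * (1 / norm x)) powr q)"
    by (subst integrable_radial_iff[of "\<lambda>s. indicator {..b} s * (L * sqrt total_mass * (1 / s)) powr q"]) simp_all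
qed (use q in \<open>auto simp: flow_component\<close>)

text \<open>Integration by parts is applied to \<open>\<psi>\<close> = x_i \<open>\<phi>\<close>,
  which vanishes linearly at the origin. The derivative of the factor x_i yields the diagonal term
  of the Jacobian, which is moved to the other side.\<close>

lemma flow_weak_derivative:
  assumes \<phi>: "test_function \<phi>"
  shows "(LINT x|lborel. flow x $ i * partial_deriv j \<phi> x) = - (LINT x|lborel. jacobian x $ i $ j * \<phi> x)"
proof -
  obtain b where b: "b > 0" "\<And>x. norm x \<ge> b \<Longrightarrow> \<phi> x = 0" "\<And>x. norm x \<ge> b \<Longrightarrow> partial_deriv j \<phi> x = 0"
    using test_function_support[OF \<phi>] by metis
  have cont: "continuous_on UNIV \<phi>" "continuous_on UNIV (partial_deriv j \<phi>)"
    by (rule continuous_lipschitz_on_balls[OF test_function_lipschitz[OF \<phi>]], rule test_function_cont_partial[OF \<phi>])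
  have [measurable]: "\<phi> \<in> borel_measurable borel" "partial_deriv j \<phi> \<in> borel_measurable borel"
    using cont by (auto intro: borel_measurable_continuous_onI)
  have bounded: "\<exists>B\<ge>0. \<forall>x. \<bar>h x\<bar> \<le> B" if h: "continuous_on UNIV h" "\<And>x. norm x \<ge> b \<Longrightarrow> h x = 0" for h :: "real^3 \<Rightarrow> real"
  proof -
    have "compact (h ` cball 0 b)"
      by (intro compact_continuous_image continuous_on_subset[OF h(1)]) auto
    then have "bounded (h ` cball 0 b)" by (rule compact_imp_bounded)
    then obtain B where B: "\<forall>y\<in>h ` cball 0 b. norm y \<le> B"
      unfolding bounded_iff by blast
    have "\<bar>h x\<bar> \<le> max B 0" for x
      using B h(2)[of x] by (cases "norm x \<le> b") (auto simp: le_max_iff_disj)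
    then show ?thesis by (intro exI[of _ "max B 0"]) auto
  qed
  obtain B0 where B0: "B0 \<ge> 0" "\<And>x. \<bar>\<phi> x\<bar> \<le> B0" using bounded[OF cont(1) b(2)] by blast
  obtain B1 where B1: "B1 \<ge> 0" "\<And>x. \<bar>partial_deriv j \<phi> x\<bar> \<le> B1" using bounded[OF cont(2) b(3)] by blast
  define \<delta> :: real where "\<delta> = (if i = j then 1 else 0)"
  define \<psi> where "\<psi> x = x $ i * \<phi> x" for x :: "real^3"
  define \<psi>' where "\<psi>' x = \<delta> * \<phi> x + x $ i * partial_deriv j \<phi> x" for x :: "real^3"
  have [measurable]: "\<psi>' \<in> borel_measurable borel" unfolding \<psi>'_def by measurable
  have ibp: "(LINT x|lborel. profile (norm x) * \<psi>' x) = - (LINT x|lborel. profile' (norm x) * ((axis j 1 \<bullet> x) / norm x) * \<psi> x)"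
  proof (rule radial_integral_by_parts)
    have "lipschitz_on_balls (\<lambda>x::real^3. x $ i)"
      using lipschitz_on_balls_inner[of "axis i 1 :: real^3"] by (simp add: inner_axis)
    then show "lipschitz_on_balls \<psi>"
      unfolding \<psi>_def by (intro lipschitz_on_balls_mult test_function_lipschitz[OF \<phi>])
    show "\<bar>\<psi> x\<bar> \<le> B0 * norm x" for x
      unfolding \<psi>_def abs_mult by (subst mult.commute) (intro mult_mono B0 component_le_norm_cart, auto)
    show "((\<lambda>t. \<psi> (x + t *\<^sub>R axis j 1)) has_real_derivative \<psi>' x) (at 0)" for x
    proof -
      have "((\<lambda>t. (x + t *\<^sub>R axis j 1) $ i) has_real_derivative \<delta>) (at 0)"
        by (auto intro!: derivative_eq_intros simp: axis_def \<delta>_def)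
      from DERIV_mult[OF this test_function_line[OF \<phi>, of x j]] show ?thesis
        unfolding \<psi>_def \<psi>'_def by (rule DERIV_cong) (simp add: algebra_simps)
    qed
    show "\<bar>\<psi>' x\<bar> \<le> B0 + b * B1" for x
    proof -
      have "\<bar>\<delta> * \<phi> x\<bar> \<le> B0" using B0(2)[of x] B0(1) by (simp add: \<delta>_def)
      moreover have "\<bar>x $ i * partial_deriv j \<phi> x\<bar> \<le> b * B1"
      proof (cases "norm x \<ge> b")
        case False
        then show ?thesis
          unfolding abs_mult using b B1 component_le_norm_cart[of x i] by (intro mult_mono) auto
      qed (use b B1 in simp)
      ultimately show ?thesis unfolding \<psi>'_def by linarith
    qed
    show "primitive_on a b profile profile'" if "0 < a" "a \<le> b" for a
      using that by (rule primitive_on_profile)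
    show "set_integrable lborel {0<..b} (\<lambda>s. s ^ DIM(real^3) * profile' s)"
      using profile'_cube_integrable[of b] b by simp
  qed (use b in \<open>auto simp: \<psi>_def \<psi>'_def\<close>)
  have q1: "q \<ge> 1" using q by simp
  have i1: "integrable lborel (\<lambda>x. flow x $ i * partial_deriv j \<phi> x)"
    by (rule locally_Lp_mult_integrable[OF locally_Lp_1[OF locally_Lp_flow_component q1] _ B1(2) _ b(1)])
      (use b in auto)
  have i2: "integrable lborel (\<lambda>x. jacobian x $ i $ j * \<phi> x)"
    by (rule locally_Lp_mult_integrable[OF locally_Lp_1[OF locally_Lp_jacobian_component q1] _ B0(2) _ b(1)])
      (use b in auto)
  have i3: "integrable lborel (\<lambda>x. profile (norm x) * (\<delta> * \<phi> x))"
  proof -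
    have "locally_Lp q (\<lambda>x::real^3. profile (norm x))"
    proof (rule locally_LpI[where H = "\<lambda>x. flow_bound (norm x)"])
      show "integrable lborel (\<lambda>x::real^3. indicator {..b} (norm x) * flow_bound (norm x) powr q)" if "b > 0" for b
        using that by (rule flow_bound_powr_integral)
    qed (use q in \<open>auto simp: flow_bound_def\<close>)
    from locally_Lp_mult_integrable[OF locally_Lp_1[OF this q1] _ B0(2) _ b(1)]
    have "integrable lborel (\<lambda>x. profile (norm x) * \<phi> x)" using b by simp
    then have "integrable lborel (\<lambda>x. \<delta> * (profile (norm x) * \<phi> x))" by (rule integrable_mult_right)
    then show ?thesis by (simp add: mult_ac)
  qed
  have e1: "profile (norm x) * \<psi>' x = profile (norm x) * (\<delta> * \<phi> x) + flow x $ i * partial_deriv j \<phi> x" for x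
    by (simp add: \<psi>'_def flow_component algebra_simps)
  have e2: "profile' (norm x) * ((axis j 1 \<bullet> x) / norm x) * \<psi> x = jacobian x $ i $ j * \<phi> x - profile (norm x) * (\<delta> * \<phi> x)" for x
    by (simp add: \<psi>_def jacobian_component \<delta>_def inner_axis' algebra_simps)
  show ?thesis
    using ibp unfolding e1 e2
    by (simp only: Bochner_Integration.integral_add[OF i3 i1] Bochner_Integration.integral_diff[OF i2 i3])
qed

lemma flow_has_weak_partial: "has_weak_partial (\<lambda>x. flow x $ i) j (\<lambda>x. jacobian x $ i $ j)"
proof -
  have q1: "q \<ge> 1" using q by simp
  have tr: "(LINT x|lebesgue. G x * h x) = (LINT x|lborel. G x * h x)"
    if [measurable]: "G \<in> borel_measurable borel" and "continuous_on UNIV h" for G h :: "real^3 \<Rightarrow> real"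
  proof -
    have [measurable]: "h \<in> borel_measurable borel" using that(2) by (rule borel_measurable_continuous_onI)
    show ?thesis by (rule integral_completion) simp
  qed
  show ?thesis
    unfolding has_weak_partial_def
  proof (intro conjI allI impI)
    show "in_Lp_loc 1 (\<lambda>x. flow x $ i)"
      by (intro in_Lp_loc_if_locally_Lp locally_Lp_1[OF locally_Lp_flow_component q1])
    show "in_Lp_loc 1 (\<lambda>x. jacobian x $ i $ j)"
      by (intro in_Lp_loc_if_locally_Lp locally_Lp_1[OF locally_Lp_jacobian_component q1])
    fix \<phi> :: "real^3 \<Rightarrow> real" assume \<phi>: "test_function \<phi>"
    have "(LINT x|lebesgue. flow x $ i * partial_deriv j \<phi> x) = (LINT x|lborel. flow x $ i * partial_deriv j \<phi> x)"
      by (intro tr test_function_cont_partial[OF \<phi>]) measurable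
    moreover have "(LINT x|lebesgue. jacobian x $ i $ j * \<phi> x) = (LINT x|lborel. jacobian x $ i $ j * \<phi> x)"
      by (intro tr continuous_lipschitz_on_balls[OF test_function_lipschitz[OF \<phi>]]) measurable
    ultimately show "(LINT x|lebesgue. flow x $ i * partial_deriv j \<phi> x) = - (LINT x|lebesgue. jacobian x $ i $ j * \<phi> x)"
      using flow_weak_derivative[OF \<phi>] by simp
  qed
qed

lemma jacobian_Lp:
  assumes R: "R > 0"
  shows "in_Lp q (ball 0 R) jacobian"
    and "Lp_norm q (ball 0 R) jacobian \<le> 9 * max 0 (flow_const L p q R) powr (1 / q) * N powr (1 / 2)"
proof -
  have "locally_Lp q jacobian"
  proof (rule locally_LpI[where H = "\<lambda>x. 9 * flow_bound (norm x)"])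
    fix b :: real assume b: "b > 0"
    have "integrable lborel (\<lambda>x::real^3. 9 powr q * (indicator {..b} (norm x) * flow_bound (norm x) powr q))"
      by (intro integrable_mult_right flow_bound_powr_integral b)
    then show "integrable lborel (\<lambda>x::real^3. indicator {..b} (norm x) * (9 * flow_bound (norm x)) powr q)"
      by (simp add: powr_mult flow_bound_norm_nonneg mult_ac)
  qed (use q jacobian_norm_bound in auto)
  then have I: "integrable lborel (\<lambda>x. indicator {..R} (norm x) * norm (jacobian x) powr q)"
    using R by (simp add: locally_Lp_def)
  show "in_Lp q (ball 0 R) jacobian" by (rule in_Lp_bounded[OF _ _ _ I]) auto
  have I': "integrable lborel (\<lambda>x::real^3. 9 powr q * (indicator {..R} (norm x) * flow_bound (norm x) powr q))"
    by (intro integrable_mult_right flow_bound_powr_integral R)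
  have "(LINT x:ball 0 R|lebesgue. norm (jacobian x) powr q) \<le> (LINT x|lborel. indicator {..R} (norm x) * norm (jacobian x) powr q)"
    by (rule Lp_integral_bounded[OF _ _ _ I]) auto
  also have "\<dots> \<le> (LINT x|lborel. 9 powr q * (indicator {..R} (norm (x::real^3)) * flow_bound (norm x) powr q))"
  proof (rule integral_mono[OF I I'])
    fix x :: "real^3"
    have "norm (jacobian x) powr q \<le> (9 * flow_bound (norm x)) powr q"
      using jacobian_norm_bound q by (intro powr_mono2) auto
    also have "\<dots> = 9 powr q * flow_bound (norm x) powr q" by (simp add: powr_mult flow_bound_norm_nonneg)
    finally show "indicator {..R} (norm x) * norm (jacobian x) powr q \<le> 9 powr q * (indicator {..R} (norm x) * flow_bound (norm x) powr q)"
      by (simp add: indicator_def)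
  qed
  also have "\<dots> = 9 powr q * (LINT x|lborel. indicator {..R} (norm (x::real^3)) * flow_bound (norm x) powr q)"
    by (rule integral_mult_right_zero)
  \<comment> \<open>The maximum with 0 makes the constant nonnegative, so that powers of the product
    can be taken factor by factor.\<close>
  also have "\<dots> \<le> 9 powr q * (max 0 (flow_const L p q R) * N powr (q / 2))"
    by (intro mult_left_mono order_trans[OF flow_bound_powr_integral(2)[OF R]] mult_right_mono) auto
  finally have "Lp_norm q (ball 0 R) jacobian \<le> (9 powr q * (max 0 (flow_const L p q R) * N powr (q / 2))) powr (1 / q)"
    unfolding Lp_norm_def using q
    by (intro powr_mono2) (auto simp: set_lebesgue_integral_def intro!: integral_nonneg_AE)
  also have "\<dots> = 9 * max 0 (flow_const L p q R) powr (1 / q) * N powr (1 / 2)"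
    using q N by (simp add: powr_mult powr_powr)
  finally show "Lp_norm q (ball 0 R) jacobian \<le> 9 * max 0 (flow_const L p q R) powr (1 / q) * N powr (1 / 2)" .
qed

end

section \<open>Bounds on the nonlinearity and transfer to functions given almost everywhere\<close>

lemma lam_bounds:
  fixes lam lam' :: "real \<Rightarrow> real"
  assumes d: "\<And>y. y > 0 \<Longrightarrow> (lam has_real_derivative lam' y) (at y)"
    and lim: "(lam \<longlongrightarrow> 0) at_top"
    and b: "\<And>y. y > 0 \<Longrightarrow> - Lam / (2 * y powr (3/2)) \<le> lam' y \<and> lam' y \<le> 0"
    and y: "y > 0"
  shows "0 \<le> lam y" "lam y \<le> Lam / sqrt y"
proof -
  have "lam z \<le> lam y" if "y \<le> z" for z
  proof (rule DERIV_nonpos_imp_nonincreasing[OF that])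
    fix x assume "y \<le> x" "x \<le> z"
    then have "x > 0" using y by simp
    then show "\<exists>D. (lam has_real_derivative D) (at x) \<and> D \<le> 0" using d b by blast
  qed
  then show "0 \<le> lam y"
    by (intro tendsto_upperbound[OF lim]) (auto simp: eventually_at_top_linorder)
  \<comment> \<open>The subtracted power has derivative - Lam / (2 z^(3/2)), the lower bound for
    \<open>lam'\<close>. Hence \<open>G\<close> is nondecreasing, and since it tends to 0 at
    infinity it is nonpositive.\<close>
  define G where "G z = lam z - Lam * z powr (- (1/2))" for z
  have "G y \<le> G z" if "y \<le> z" for z
  proof (rule DERIV_nonneg_imp_nondecreasing[OF that])
    fix x assume "y \<le> x" "x \<le> z"
    then have x: "x > 0" using y by simp
    have "((\<lambda>z. z powr (- (1/2))) has_real_derivative - (1/2) * x powr (- (1/2) - 1)) (at x)"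
      by (rule has_real_derivative_powr[OF x])
    then have "(G has_real_derivative lam' x - Lam * (- (1/2) * x powr (- (1/2) - 1))) (at x)"
      unfolding G_def by (intro DERIV_diff d[OF x] DERIV_cmult)
    moreover have "lam' x - Lam * (- (1/2) * x powr (- (1/2) - 1)) \<ge> 0"
    proof -
      have "- (1/2) - 1 = - (3/2 :: real)" by simp
      then have "x powr (- (1/2) - 1) = 1 / x powr (3/2)" by (simp only: powr_minus_divide)
      then show ?thesis using b[OF x] by simp
    qed
    ultimately show "\<exists>D. (G has_real_derivative D) (at x) \<and> 0 \<le> D" by blast
  qed
  moreover have "(G \<longlongrightarrow> 0 - Lam * 0) at_top"
    unfolding G_def by (intro tendsto_intros lim tendsto_neg_powr filterlim_ident) auto
  ultimately have "G y \<le> 0"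
    by (intro tendsto_lowerbound[of G "0" at_top]) (auto simp: eventually_at_top_linorder)
  then show "lam y \<le> Lam / sqrt y" using y powr_minus_half[of y] by (simp add: G_def)
qed

text \<open>The integrands agree almost everywhere in y for each fixed x, so the values agree at
  every x; where the integral diverges both are 0.\<close>

lemma newton_gradient_eq_grav:
  assumes \<rho>: "\<rho> \<in> borel_measurable lebesgue" and f: "radial_source f" and eq: "AE y in lebesgue. \<rho> y = f (norm y)"
  shows "newton_gradient \<rho> = radial_source.grav f"
proof
  fix x
  interpret radial_source f by (rule f)
  have m: "(\<lambda>y::real^3. (f (norm y) / norm (x - y) ^ 3) *\<^sub>R (x - y)) \<in> borel_measurable lborel"
    by measurable
  have "(\<lambda>y::real^3. (1 / norm (x - y) ^ 3) *\<^sub>R (x - y)) \<in> borel_measurable lborel"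
    by measurable
  from borel_measurable_scaleR[OF \<rho> measurable_completion[OF this]]
  have m': "(\<lambda>y::real^3. (\<rho> y / norm (x - y) ^ 3) *\<^sub>R (x - y)) \<in> borel_measurable lebesgue" by simp
  have "newton_gradient \<rho> x = (LINT y|lebesgue. (f (norm y) / norm (x - y) ^ 3) *\<^sub>R (x - y))"
    unfolding newton_gradient_def
  proof (rule integral_cong_AE[OF m' measurable_completion[OF m]])
    show "AE y in lebesgue. (\<rho> y / norm (x - y) ^ 3) *\<^sub>R (x - y) = (f (norm y) / norm (x - y) ^ 3) *\<^sub>R (x - y)"
      using eq by eventually_elim simp
  qed
  also have "\<dots> = grav x" unfolding grav_def by (rule integral_completion[OF m])
  finally show "newton_gradient \<rho> x = grav x" .
qed

lemma integrable_lborel_radial_if_lebesgue: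
  fixes \<rho> :: "'a::euclidean_space \<Rightarrow> real" and f h :: "real \<Rightarrow> real"
  assumes h: "integrable lebesgue (h \<circ> \<rho>)" and eq: "AE x in lebesgue. \<rho> x = f (norm x)"
    and [measurable]: "f \<in> borel_measurable borel" "h \<in> borel_measurable borel"
  shows "integrable lborel (\<lambda>x::'a. h (f (norm x)))"
    "(LINT x|lebesgue. h (\<rho> x)) = (LINT x|lborel. h (f (norm (x::'a))))"
proof -
  have m: "(\<lambda>x::'a. h (f (norm x))) \<in> borel_measurable lborel" by measurable
  have ae: "AE x in lebesgue. (h \<circ> \<rho>) x = h (f (norm x))" using eq by eventually_elim simp
  have "integrable lebesgue (\<lambda>x::'a. h (f (norm x)))"
    by (rule integrable_cong_AE_imp[OF h measurable_completion[OF m]]) (use ae in eventually_elim, simp)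
  then show "integrable lborel (\<lambda>x::'a. h (f (norm x)))" by (simp add: integrable_completion[OF m])
  have "(LINT x|lebesgue. (h \<circ> \<rho>) x) = (LINT x|lebesgue. h (f (norm (x::'a))))"
    by (rule integral_cong_AE[OF borel_measurable_integrable[OF h] measurable_completion[OF m] ae])
  also have "\<dots> = (LINT x|lborel. h (f (norm (x::'a))))" by (rule integral_completion[OF m])
  finally show "(LINT x|lebesgue. h (\<rho> x)) = (LINT x|lborel. h (f (norm (x::'a))))" by (simp add: comp_def)
qed

lemma in_Lp_UNIV: "in_Lp q UNIV f \<longleftrightarrow> f \<in> borel_measurable lebesgue \<and> integrable lebesgue (\<lambda>x. norm (f x) powr q)"
  by (simp add: in_Lp_def set_borel_measurable_def set_integrable_def)

lemma in_Lp_cong_AE: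
  assumes G: "in_Lp q S G" and F: "F \<in> borel_measurable lebesgue" and S: "S \<in> sets lebesgue"
    and ae: "AE x in lebesgue. F x = G x"
  shows "in_Lp q S F"
  unfolding in_Lp_def
proof
  show m: "set_borel_measurable lebesgue S F"
    unfolding set_borel_measurable_def using S F by (intro borel_measurable_scaleR borel_measurable_indicator)
  have "(\<lambda>x. norm (F x) powr q) \<in> borel_measurable lebesgue" using F by measurable
  then have m': "(\<lambda>x. indicator S x *\<^sub>R (norm (F x) powr q)) \<in> borel_measurable lebesgue"
    using S by (intro borel_measurable_scaleR borel_measurable_indicator)
  show "set_integrable lebesgue S (\<lambda>x. norm (F x) powr q)"
    unfolding set_integrable_def
    by (rule integrable_cong_AE_imp[OF _ m']) (use G ae in \<open>auto simp: in_Lp_def set_integrable_def elim!: eventually_mono\<close>)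
qed

lemma in_Lp_loc_cong_AE:
  assumes "in_Lp_loc q G" "F \<in> borel_measurable lebesgue" "AE x in lebesgue. F x = G x"
  shows "in_Lp_loc q F"
  unfolding in_Lp_loc_def
proof (intro allI impI)
  fix K :: "'a set" assume K: "compact K"
  then have "K \<in> sets lebesgue" by (simp add: compact_imp_closed)
  then show "in_Lp q K F" using assms K by (intro in_Lp_cong_AE[of q K G F]) (auto simp: in_Lp_loc_def)
qed

lemma has_weak_partial_cong_AE:
  assumes G: "has_weak_partial G j D" and F: "F \<in> borel_measurable lebesgue" and ae: "AE x in lebesgue. F x = G x"
    and Gm: "G \<in> borel_measurable lebesgue"
  shows "has_weak_partial F j D"
  unfolding has_weak_partial_def
proof (intro conjI allI impI)
  show "in_Lp_loc 1 F" using G F ae by (intro in_Lp_loc_cong_AE[of 1 G F]) (auto simp: has_weak_partial_def)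
  show "in_Lp_loc 1 D" using G by (simp add: has_weak_partial_def)
  fix \<phi> :: "real^'a \<Rightarrow> real" assume \<phi>: "test_function \<phi>"
  have "partial_deriv j \<phi> \<in> borel_measurable lborel"
    using borel_measurable_continuous_onI[OF test_function_cont_partial[OF \<phi>]] by simp
  then have pm: "partial_deriv j \<phi> \<in> borel_measurable lebesgue" by (rule measurable_completion)
  have "(LINT x|lebesgue. F x * partial_deriv j \<phi> x) = (LINT x|lebesgue. G x * partial_deriv j \<phi> x)"
    by (rule integral_cong_AE) (use F Gm pm ae in \<open>auto elim!: eventually_mono\<close>)
  then show "(LINT x|lebesgue. F x * partial_deriv j \<phi> x) = - (LINT x|lebesgue. D x * \<phi> x)"
    using G \<phi> by (simp add: has_weak_partial_def)
qed

theorem lemma5p3: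
  fixes lam :: "real \<Rightarrow> real" and Lam p q R :: real
  assumes "lam C1_differentiable_on {0<..}"
    and "(lam \<longlongrightarrow> 0) at_top"
    and "Lam > 0"
    and "\<And>\<sigma>. \<sigma> > 0 \<Longrightarrow> - Lam / (2 * \<sigma> powr (3/2)) \<le> deriv lam \<sigma> \<and> deriv lam \<sigma> \<le> 0"
    and "1 < q" and "q < 2"
    and "p > q / (2 - q) + q"
    and "R > 0"
  shows "\<exists>C>0. \<forall>\<rho> :: real^3 \<Rightarrow> real.
           in_Lp 1 UNIV \<rho> \<and> in_Lp p UNIV \<rho> \<and> (AE x in lebesgue. \<rho> x \<ge> 0) \<and>
           spherically_symmetric \<rho> \<longrightarrow>
           (let F = (\<lambda>x. lam (norm (newton_gradient \<rho> x)) *\<^sub>R newton_gradient \<rho> x)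
            in vec_in_W1_loc q F \<and>
               (\<exists>D. has_weak_jacobian F D \<and> in_Lp q (ball 0 R) D \<and>
                    Lp_norm q (ball 0 R) D \<le> C * Lp_norm p UNIV \<rho> powr (1/2)))"
proof -
  obtain lam' where lam': "\<And>y. y > 0 \<Longrightarrow> (lam has_vector_derivative lam' y) (at y)" "continuous_on {0<..} lam'"
    using assms(1) unfolding C1_differentiable_on_def by auto
  have d: "(lam has_real_derivative lam' y) (at y)" if "y > 0" for y
    using lam'(1)[OF that] by (simp add: has_real_derivative_iff_has_vector_derivative)
  then have b: "- Lam / (2 * y powr (3/2)) \<le> lam' y \<and> lam' y \<le> 0" if "y > 0" for y
    using assms(4)[OF that] DERIV_imp_deriv[OF d[OF that]] by simp
  have lb: "0 \<le> lam y" "lam y \<le> Lam / sqrt y" if "y > 0" for y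
    using lam_bounds[of lam lam' Lam, OF _ assms(2) _ that] d b by blast+
  \<comment> \<open>Nothing is known about \<open>lam\<close> off the positive half-line, so Borel
    versions that are 0 there are used. The field does not change, since its vector factor is 0 when
    the norm is.\<close>
  define lam0 where "lam0 y = (if y > 0 then lam y else 0)" for y
  define \<mu> where "\<mu> y = (if y > 0 then lam y * y else 0)" for y
  define \<mu>' where "\<mu>' y = (if y > 0 then lam' y * y + lam y else 0)" for y
  \<comment> \<open>The derivative lam' y y + lam y has two terms, each of absolute value at most
    Lam / sqrt y.\<close>
  define L where "L = 2 * Lam"
  have lamc: "continuous_on {0<..} lam"
    using d by (intro continuous_at_imp_continuous_on ballI DERIV_isCont) auto
  have borelI: "(\<lambda>y. if y > 0 then h y else 0) \<in> borel_measurable borel" if "continuous_on {0<..} h" for h :: "real \<Rightarrow> real"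
  proof -
    have "(\<lambda>y. indicator {0<..} y *\<^sub>R h y) \<in> borel_measurable borel"
      using that by (intro borel_measurable_continuous_on_indicator) auto
    also have "(\<lambda>y. indicator {0<..} y *\<^sub>R h y) = (\<lambda>y. if y > 0 then h y else 0)" by (auto simp: fun_eq_iff)
    finally show ?thesis .
  qed
  have [measurable]: "lam0 \<in> borel_measurable borel" "\<mu> \<in> borel_measurable borel" "\<mu>' \<in> borel_measurable borel"
    unfolding lam0_def \<mu>_def \<mu>'_def by (intro borelI continuous_intros lamc lam'(2))+
  have flow_axioms: "radial_flow_axioms \<mu> \<mu>' L"
  proof
    show "(\<mu> has_real_derivative \<mu>' y) (at y)" if y: "y > 0" for y
    proof -
      have "((\<lambda>y. lam y * y) has_real_derivative lam' y * y + 1 * lam y) (at y)"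
        by (rule DERIV_mult[OF d[OF y] DERIV_ident])
      moreover have "\<forall>\<^sub>F z in nhds y. lam z * z = \<mu> z"
        using eventually_nhds_in_open[of "{0<..}" y] y by (auto elim!: eventually_mono simp: \<mu>_def)
      ultimately show ?thesis using DERIV_cong_ev y by (fastforce simp: \<mu>'_def)
    qed
    have "continuous_on {0<..} (\<lambda>y. lam' y * y + lam y)" by (intro continuous_intros lamc lam'(2))
    then show "continuous_on {0<..} \<mu>'" by (rule continuous_on_eq) (simp add: \<mu>'_def)
    fix y :: real assume y0: "y \<ge> 0"
    show "\<bar>\<mu> y\<bar> \<le> L * sqrt y"
    proof (cases "y > 0")
      case True
      have "lam y * y \<le> Lam / sqrt y * y" using lb[OF True] True by (intro mult_right_mono) auto
      also have "\<dots> = Lam * sqrt y" using True by (simp add: real_div_sqrt flip: times_divide_eq_right)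
      also have "\<dots> \<le> L * sqrt y" using assms(3) y0 by (intro mult_right_mono) (auto simp: L_def)
      finally show ?thesis using True lb(1)[OF True] by (simp add: \<mu>_def)
    qed (use assms(3) y0 in \<open>simp add: \<mu>_def L_def\<close>)
    show "\<bar>\<mu>' y\<bar> \<le> L / sqrt y"
    proof (cases "y > 0")
      case True
      have e: "y powr (3/2) = y * sqrt y"
      proof -
        have "y powr (3/2) = y powr (1 + 1/2)" by simp
        also have "\<dots> = y * sqrt y" unfolding powr_add using True by (simp add: powr_half_sqrt)
        finally show ?thesis .
      qed
      have "- (Lam / sqrt y) \<le> - Lam / (2 * (y * sqrt y)) * y" using True assms(3) by (simp add: field_simps)
      also have "\<dots> \<le> lam' y * y" using b[OF True] True unfolding e by (intro mult_right_mono) auto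
      finally have 1: "- (Lam / sqrt y) \<le> lam' y * y" .
      have 2: "lam' y * y \<le> 0" using b[OF True] True by (simp add: mult_nonpos_nonneg)
      have "Lam / sqrt y \<ge> 0" using assms(3) True by (intro divide_nonneg_nonneg) auto
      then have "\<bar>lam' y * y + lam y\<bar> \<le> Lam / sqrt y + Lam / sqrt y"
        using 1 2 lb[OF True] by (intro abs_leI) linarith+
      then show ?thesis using True by (simp add: \<mu>'_def L_def)
    qed (use assms(3) y0 in \<open>simp add: \<mu>'_def L_def\<close>)
  qed simp_all
  \<comment> \<open>The added 1 makes \<open>C\<close> positive. Through \<open>L\<close> it depends
    on \<open>Lam\<close>, which is fixed together with \<open>lam\<close>, but not on the
    density.\<close>
  define C where "C = 9 * max 0 (flow_const L p q R) powr (1 / q) + 1"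
  have C: "C > 0" by (simp add: C_def add_nonneg_pos)
  show ?thesis
  proof (intro exI[of _ C] conjI C allI impI)
    fix \<rho> :: "real^3 \<Rightarrow> real"
    assume "in_Lp 1 UNIV \<rho> \<and> in_Lp p UNIV \<rho> \<and> (AE x in lebesgue. \<rho> x \<ge> 0) \<and> spherically_symmetric \<rho>"
    then have \<rho>: "\<rho> \<in> borel_measurable lebesgue" "integrable lebesgue (\<lambda>x. norm (\<rho> x) powr 1)"
      "integrable lebesgue (\<lambda>x. norm (\<rho> x) powr p)" "AE x in lebesgue. \<rho> x \<ge> 0"
      and sym: "spherically_symmetric \<rho>" by (auto simp: in_Lp_UNIV)
    from sym obtain f0 where "AE x in lebesgue. \<rho> x = f0 (norm x)" unfolding spherically_symmetric_def by blast
    from radial_borel_profile[OF \<rho>(1) this \<rho>(4)] obtain f where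
      f: "f \<in> borel_measurable borel" "\<And>s. f s \<ge> 0" "AE x in lebesgue. \<rho> x = f (norm x)" by blast
    have i1: "integrable lborel (\<lambda>x::real^3. \<bar>f (norm x)\<bar> powr 1)"
      by (rule integrable_lborel_radial_if_lebesgue(1)[OF _ f(3) f(1), of "\<lambda>t. \<bar>t\<bar> powr 1"])
        (use \<rho>(2) in \<open>simp_all add: comp_def\<close>)
    have ip: "integrable lborel (\<lambda>x::real^3. \<bar>f (norm x)\<bar> powr p)"
      "(LINT x|lebesgue. \<bar>\<rho> x\<bar> powr p) = (LINT x|lborel. \<bar>f (norm (x::real^3))\<bar> powr p)"
      by (rule integrable_lborel_radial_if_lebesgue[OF _ f(3) f(1), of "\<lambda>t. \<bar>t\<bar> powr p"],
          use \<rho>(3) in \<open>simp_all add: comp_def\<close>)+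
    have src: "radial_source f" by standard (use f i1 in simp_all)
    interpret radial_source f by (rule src)
    define N where "N = Lp_norm p UNIV \<rho>"
    have pp: "p > 0"
    proof -
      have "q / (2 - q) > 0" using assms(5,6) by simp
      then show ?thesis using assms(5,7) by linarith
    qed
    have Np: "N powr p = (LINT x|lborel. f (norm (x::real^3)) powr p)"
    proof -
      have "N = (LINT x|lborel. f (norm (x::real^3)) powr p) powr (1 / p)"
        unfolding N_def Lp_norm_def set_lebesgue_integral_def using ip(2) f(2) by simp
      then show ?thesis using pp by (simp add: powr_powr integral_nonneg_AE)
    qed
    interpret flow_in_Lp f \<mu> \<mu>' L p q N
      by (intro flow_in_Lp.intro src radial_flow.intro mass_function_axioms flow_axioms flow_in_Lp_axioms.intro)
        (use assms ip f(2) Np in \<open>simp_all add: N_def Lp_norm_def\<close>)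
    define F where "F = (\<lambda>x. lam (norm (newton_gradient \<rho> x)) *\<^sub>R newton_gradient \<rho> x)"
    have ng: "newton_gradient \<rho> = grav" by (rule newton_gradient_eq_grav[OF \<rho>(1) src f(3)])
    have F0: "F = (\<lambda>x. lam0 (norm (grav x)) *\<^sub>R grav x)"
      unfolding F_def ng lam0_def by (auto simp: fun_eq_iff)
    have Fm [measurable]: "F \<in> borel_measurable borel" unfolding F0 by measurable
    have Fc: "(\<lambda>x. F x $ i) \<in> borel_measurable lebesgue" "(\<lambda>x. flow x $ i) \<in> borel_measurable lebesgue" for i
    proof -
      have "(\<lambda>x. F x $ i) \<in> borel_measurable lborel" "(\<lambda>x. flow x $ i) \<in> borel_measurable lborel" by measurable
      then show "(\<lambda>x. F x $ i) \<in> borel_measurable lebesgue" "(\<lambda>x. flow x $ i) \<in> borel_measurable lebesgue"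
        by (auto intro: measurable_completion)
    qed
    have ae: "AE x in lebesgue. F x = flow x"
    proof (rule AE_completion)
      show "AE x in lborel. F x = flow x"
        using AE_grav_eq AE_norm_neq[of 0]
      proof eventually_elim
        case (elim x)
        then have x: "norm x > 0" by simp
        have n: "norm (grav x) = field (norm x)"
          using x mass_nonneg[of "norm x"] unfolding elim(1)
          by (simp add: field_def power2_eq_square power3_eq_cube)
        show ?case
        proof (cases "mass (norm x) = 0")
          case True
          then show ?thesis using elim(1) by (simp add: F0 flow_def profile_def field_def \<mu>_0)
        next
          case False
          then have "field (norm x) > 0" using x mass_nonneg[of "norm x"] by (simp add: field_def)
          then show ?thesis
            unfolding F0 flow_def profile_def n lam0_def \<mu>_def elim(1)
            using x by (simp add: field_def power2_eq_square power3_eq_cube abs_of_nonneg[OF mass_nonneg])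
        qed
      qed
    qed
    have wp: "has_weak_partial (\<lambda>x. F x $ i) j (\<lambda>x. jacobian x $ i $ j)" for i j
      by (rule has_weak_partial_cong_AE[OF flow_has_weak_partial Fc(1) _ Fc(2)])
        (use ae in \<open>auto elim!: eventually_mono\<close>)
    have "vec_in_W1_loc q F"
      unfolding vec_in_W1_loc_def in_W1_loc_def
    proof (intro allI conjI)
      fix i j
      show "in_Lp_loc q (\<lambda>x. F x $ i)"
        by (rule in_Lp_loc_cong_AE[OF in_Lp_loc_if_locally_Lp[OF locally_Lp_flow_component] Fc(1)])
          (use ae in \<open>auto elim!: eventually_mono\<close>)
      show "\<exists>g. in_Lp_loc q g \<and> has_weak_partial (\<lambda>x. F x $ i) j g"
        using wp in_Lp_loc_if_locally_Lp[OF locally_Lp_jacobian_component] by blast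
    qed
    moreover have "has_weak_jacobian F jacobian"
      unfolding has_weak_jacobian_def using wp by blast
    moreover have "Lp_norm q (ball 0 R) jacobian \<le> C * N powr (1 / 2)"
      by (rule order_trans[OF jacobian_Lp(2)[OF assms(8)]]) (intro mult_right_mono, auto simp: C_def)
    ultimately show "let F = (\<lambda>x. lam (norm (newton_gradient \<rho> x)) *\<^sub>R newton_gradient \<rho> x)
            in vec_in_W1_loc q F \<and>
               (\<exists>D. has_weak_jacobian F D \<and> in_Lp q (ball 0 R) D \<and>
                    Lp_norm q (ball 0 R) D \<le> C * Lp_norm p UNIV \<rho> powr (1/2))"
      unfolding Let_def F_def[symmetric] N_def[symmetric] using jacobian_Lp(1)[OF assms(8)] by blast
  qed
qed

end
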